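(* Let $0<a\leqslant1$ and let $V\in L^\infty_{\rm loc}(\mathbb{R}^d)$ be an a.e. non-negative potential which satisfies the growth estimate $V(x)\leqslant C_1\exp(|x|^2/(4a))$ for a.e. $x$ with some constant $C_1>0$, and such that $e^{-tL}$ has exponential decay of some order $\delta>0$, i.e. $\|e^{-tL}(\mathbf 1)\|_\infty\leqslant C_2e^{-\delta t}$ for all $t>0$ with some constant $C_2>0$. If there are a compact set $F\subset\mathbb{R}^d$ and a constant $C_3>0$ such that $J^a(V)(x)\leqslant C_3$ and $I^a(V)(x)\leqslant C_3$ for a.e. $x\notin F$, then $R_V^a$ is bounded on $L^1(\mathbb{R}^d)$.
   Context: The Schrödinger operator $L=-\frac12\Delta+V$ is the positive self-adjoint operator on $L^2(\mathbb{R}^d)$ associated with the closed form $Q(u,v)=\int\frac12\langle\nabla u,\nabla v\rangle+Vu\overline v$ with domain $\{f\in L^2:\nabla f\in L^2,\ V^{1/2}f\in L^2\}$. Its semigroup is given by the Feynman–Kac formula $e^{-tL}f(x)=\mathbb{E}_x[e^{-\int_0^tV(X_s)ds}f(X_t)]$, $X$ standard $d$-dimensional Brownian motion (generator $\frac12\Delta$) started at $x$; this formula is taken as the definition of $e^{-tL}f$ for $f\in L^\infty$, in particular for the constant function $\mathbf 1$. For $a>0$ and a non-negative $f\in L^1$ define, for a.e. $x$, $R_V^af(x)=V^a(x)\cdot\frac1{\Gamma(a)}\int_0^\infty e^{-tL}f(x)\,t^{a-1}\,dt\in[0,\infty]$. $R_V^a$ is bounded on $L^1$ if there is $C>0$ such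 that $\|R_V^af\|_1\leqslant C\|f\|_1$ for all non-negative simple functions $f$ supported in a compact subset of $\mathbb{R}^d$. $V(x)$ denotes the value at $x$ of a fixed representative of $V$, and $B(x,r)$ is the closed Euclidean ball. For $u\geqslant1$ put $$\rho_x(u)=\sup\{r\geqslant0: V(x)/u\leqslant V(y)\text{ for a.e. }y\in B(x,r)\},\qquad \sigma_x(u)=\sup\{r\geqslant0: V(y)\leqslant uV(x)\text{ for a.e. }y\in B(x,r)\},$$ both in $[0,\infty]$. For $a>0$, $$I^a(V)(x)=\int_1^{\max(1,V(x))}s^{a-1}e^{-\rho_x(s)^2/(4d)}\,ds,\qquad J^a(V)(x)=\min(1,V(x)^a)\int_1^\infty s^{a-1}e^{-\sigma_x(s)^2/8}\,ds,$$ where exponentials of $-\infty$ are $0$ and the usual convention $0\cdot\infty=0$ is used. *)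

theory Defs
  imports "HOL-Probability.Probability"
begin

text \<open>
  Standard Brownian motion on \<open>\<real>\<^sup>d\<close> started at the origin, with generator
  \<open>\<Delta>/2\<close>: \<open>B t - B s\<close> is centred Gaussian with covariance \<open>(t - s) Id\<close>. Only times
  \<open>t \<ge> 0\<close> matter. Brownian motion started at \<open>x\<close> is \<open>\<lambda>t \<omega>. x + B t \<omega>\<close>.
\<close>

definition brownian_motion :: "'w measure \<Rightarrow> (real \<Rightarrow> 'w \<Rightarrow> 'a::euclidean_space) \<Rightarrow> bool" where
  "brownian_motion M B \<longleftrightarrow>
     prob_space M \<and>
     (\<forall>t\<ge>0. B t \<in> borel_measurable M) \<and>
     (AE \<omega> in M. B 0 \<omega> = 0) \<and>
     (\<forall>(n::nat) (t::nat \<Rightarrow> real). 0 \<le> t 0 \<and> (\<forall>i<n. t i < t (Suc i)) \<longrightarrow>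
        prob_space.indep_vars M (\<lambda>_. borel)
          (\<lambda>i \<omega>. B (t (Suc i)) \<omega> - B (t i) \<omega>) {..<n}) \<and>
     (\<forall>s t. 0 \<le> s \<and> s < t \<longrightarrow>
        distributed M lborel (\<lambda>\<omega>. B t \<omega> - B s \<omega>)
          (\<lambda>z. ennreal ((2 * pi * (t - s)) powr (- real DIM('a) / 2)
                        * exp (- (norm z)\<^sup>2 / (2 * (t - s)))))) \<and>
     (AE \<omega> in M. continuous_on {0..} (\<lambda>t. B t \<omega>))"

definition exp_minus :: "ennreal \<Rightarrow> ennreal" where
  "exp_minus z = (if z = \<infinity> then 0 else ennreal (exp (- enn2real z)))"

text \<open>
  The Feynman--Kac formula for \<open>exp (- t L) f (x)\<close> with \<open>L = - \<Delta>/2 + V\<close>, for non-negative \<open>V\<close>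
  and non-negative \<open>f\<close>. Negative values of \<open>V\<close> or \<open>f\<close> are truncated to \<open>0\<close> by \<open>ennreal\<close>; as
  both functions are non-negative almost everywhere, this concerns null sets only. The integral
  \<open>nn_integral\<close> does not change when its integrand is modified on a null set, so it is the right
  integral also if \<open>V\<close> and \<open>f\<close> are Lebesgue but not Borel measurable and the integrand is
  measurable only with respect to the completion of \<open>M\<close>.
\<close>

definition schroedinger_semigroup ::
  "'w measure \<Rightarrow> (real \<Rightarrow> 'w \<Rightarrow> 'a::euclidean_space) \<Rightarrow> ('a \<Rightarrow> real) \<Rightarrow>
     real \<Rightarrow> ('a \<Rightarrow> real) \<Rightarrow> 'a \<Rightarrow> ennreal" where
  "schroedinger_semigroup M B V t f x =
     (\<integral>\<^sup>+\<omega>. exp_minus (\<integral>\<^sup>+s\<in>{0..t}. ennreal (V (x + B s \<omega>)) \<partial>lebesgue)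
            * ennreal (f (x + B t \<omega>)) \<partial>M)"

definition riesz_transform ::
  "'w measure \<Rightarrow> (real \<Rightarrow> 'w \<Rightarrow> 'a::euclidean_space) \<Rightarrow> ('a \<Rightarrow> real) \<Rightarrow>
     real \<Rightarrow> ('a \<Rightarrow> real) \<Rightarrow> 'a \<Rightarrow> ennreal" where
  "riesz_transform M B V a f x =
     ennreal (V x powr a) *
       (ennreal (1 / Gamma a) *
        (\<integral>\<^sup>+t\<in>{0<..}. schroedinger_semigroup M B V t f x * ennreal (t powr (a - 1)) \<partial>lebesgue))"

definition riesz_transform_bounded_L1 ::
  "'w measure \<Rightarrow> (real \<Rightarrow> 'w \<Rightarrow> 'a::euclidean_space) \<Rightarrow> ('a \<Rightarrow> real) \<Rightarrow> real \<Rightarrow> bool" where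
  "riesz_transform_bounded_L1 M B V a \<longleftrightarrow>
     (\<exists>C>0. \<forall>f. simple_function lebesgue f \<and> (\<forall>x. 0 \<le> f x) \<and>
                (\<exists>K. compact K \<and> (\<forall>x. x \<notin> K \<longrightarrow> f x = 0)) \<longrightarrow>
        (\<integral>\<^sup>+x. riesz_transform M B V a f x \<partial>lebesgue)
          \<le> ennreal C * (\<integral>\<^sup>+x. ennreal (f x) \<partial>lebesgue))"

definition locally_essentially_bounded :: "('a::euclidean_space \<Rightarrow> real) \<Rightarrow> bool" where
  "locally_essentially_bounded V \<longleftrightarrow>
     V \<in> borel_measurable lebesgue \<and>
     (\<forall>K. compact K \<longrightarrow> (\<exists>C. AE x in lebesgue. x \<in> K \<longrightarrow> \<bar>V x\<bar> \<le> C))"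

definition rho :: "('a::euclidean_space \<Rightarrow> real) \<Rightarrow> 'a \<Rightarrow> real \<Rightarrow> ennreal" where
  "rho V x u = Sup {ennreal r | r. 0 \<le> r \<and> (AE y in lebesgue. y \<in> cball x r \<longrightarrow> V x / u \<le> V y)}"

definition sigma :: "('a::euclidean_space \<Rightarrow> real) \<Rightarrow> 'a \<Rightarrow> real \<Rightarrow> ennreal" where
  "sigma V x u = Sup {ennreal r | r. 0 \<le> r \<and> (AE y in lebesgue. y \<in> cball x r \<longrightarrow> V y \<le> u * V x)}"

definition I_fun :: "real \<Rightarrow> ('a::euclidean_space \<Rightarrow> real) \<Rightarrow> 'a \<Rightarrow> ennreal" where
  "I_fun a V x =
     (\<integral>\<^sup>+s\<in>{1..max 1 (V x)}. ennreal (s powr (a - 1))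
        * exp_minus ((rho V x s)\<^sup>2 / of_nat (4 * DIM('a))) \<partial>lebesgue)"

definition J_fun :: "real \<Rightarrow> ('a::euclidean_space \<Rightarrow> real) \<Rightarrow> 'a \<Rightarrow> ennreal" where
  "J_fun a V x =
     ennreal (min 1 (V x powr a)) *
     (\<integral>\<^sup>+s\<in>{1..}. ennreal (s powr (a - 1)) * exp_minus ((sigma V x s)\<^sup>2 / 8) \<partial>lebesgue)"

end

theory Submission
  imports Defs
begin

text \<open>
  Write \<open>T\<^sub>t = exp (- t L)\<close> and \<open>T\<^sub>t\<^sup>*\<close> for its adjoint on Lebesgue measure. By Tonelli's theorem
  the \<open>L\<^sup>1\<close> norm of the Riesz transform of \<open>f \<ge> 0\<close> is the integral of \<open>f\<close> against
  \<open>(1 / Gamma a) \<integral> t powr (a - 1) T\<^sub>t\<^sup>* (V powr a) dt\<close>, so the theorem asks for an almost everywhere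
  bound on this last function.

  Large times cost nothing but a geometric series. For \<open>t\<close> in the unit interval
  \<open>T (t + n) f = T t (T n f)\<close>, and \<open>(t + n) powr (a - 1) \<le> t powr (a - 1)\<close> because \<open>a \<le> 1\<close>; so if the
  integral over \<open>0 < t \<le> 1\<close> is at most \<open>K\<close>, the slice between \<open>n\<close> and \<open>n + 1\<close> contributes at most
  \<open>K\<close> times the norm of \<open>T n f\<close>. By symmetry that norm is at most the integral of \<open>f\<close> times
  \<open>T n 1\<close>, which decays exponentially (\<open>riesz_integral_bound\<close>). The semigroup law
  (\<open>fk_add\<close>) and the symmetry (\<open>fk_symmetric_le\<close>) are algebra for
  Lie--Trotter products of heat operators and multiplication operators. Riemann sums carry them to
  the Feynman--Kac operators of continuous potentials, and dominated convergence to Borel potentials.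

  For \<open>0 < t \<le> 1\<close> the adjoint has the explicit form \<open>fk_adj\<close>: \<open>T\<^sub>t\<^sup>* F (y)\<close> is the expectation of
  \<open>F (y - B t) * exp (- A)\<close>, where \<open>A\<close> is the integral of \<open>V\<close> along the path
  \<open>y - (B t - B r)\<close>, \<open>0 \<le> r \<le> t\<close>, which starts at \<open>y - B t\<close> and ends at \<open>y\<close>. Only the Gaussian law of
  single increments \<open>B t - B r\<close> enters the estimates. Three kinds of points \<open>y\<close> are distinguished.

  If \<open>1 \<le> V y\<close> and \<open>y\<close> lies outside the exceptional set (locale \<open>large_value\<close>), Jensen's inequality
  moves the exponential inside the time integral. Then \<open>V powr a\<close> at the starting point is split into
  layers \<open>{V > u V y}\<close> and \<open>exp (- t V)\<close> at the intermediate point into layers \<open>{V < V y / s}\<close>. By the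
  definitions of \<open>sigma\<close> and \<open>rho\<close> such layers lie, up to null sets, outside the balls around \<open>y\<close> of
  these radii. The probability that both points lie in their layers is at most the geometric mean of
  the two probabilities, which is where the denominators 8 and \<open>4 d\<close> come from: they are twice the
  denominators of the two Gaussian tail bounds. The layers integrate to \<open>J\<close>, and, after
  the integration over \<open>t\<close>, which produces Gamma functions, to \<open>I\<close>.

  If \<open>V y < 1\<close>, the estimate comes from the values of \<open>I\<close> at the other points, because \<open>J\<close> vanishes
  at \<open>y\<close> by convention if \<open>V y = 0\<close>. If \<open>1 \<le> V z\<close>, a bound for \<open>I\<close> at \<open>z\<close> forces
  \<open>V z powr a \<le> const * exp (R\<^sup>2 / (4 d))\<close> where \<open>R\<close> is the largest radius of a ball around \<open>z\<close> on which
  \<open>1 \<le> V\<close> almost everywhere. Almost every \<open>y\<close> with \<open>V y < 1\<close> is outside that ball, so seen from \<open>y\<close> the function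
  \<open>V powr a\<close> grows at most like \<open>exp ((norm (y - z))\<^sup>2 / (4 d))\<close>
  (\<open>far_from_small_values\<close>), which is integrable against the heat kernel for \<open>t \<le> 1\<close>. On the compact exceptional set the growth hypothesis gives an
  estimate of the same kind.
\<close>

section \<open>The factor exp (-z)\<close>

lemma exp_minus_ennreal: "0 \<le> r \<Longrightarrow> exp_minus (ennreal r) = ennreal (exp (- r))"
  by (simp add: exp_minus_def)

lemma exp_minus_top [simp]: "exp_minus \<infinity> = 0" "exp_minus \<top> = 0"
  by (simp_all add: exp_minus_def)

lemma exp_minus_0 [simp]: "exp_minus 0 = 1"
  by (simp add: exp_minus_def)

lemma exp_minus_le_1: "exp_minus z \<le> 1"
  by (simp add: exp_minus_def)

lemma exp_minus_antimono: "y \<le> z \<Longrightarrow> exp_minus z \<le> exp_minus y"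
  by (cases y; cases z) (auto simp: exp_minus_def top_unique)

lemma measurable_exp_minus [measurable]: "exp_minus \<in> borel \<rightarrow>\<^sub>M borel"
  unfolding exp_minus_def[abs_def] by measurable

lemma exp_minus_tendsto:
  assumes "z \<longlonglongrightarrow> l" "l < \<infinity>"
  shows "(\<lambda>n. exp_minus (z n)) \<longlonglongrightarrow> exp_minus l"
proof -
  have "(\<lambda>n. enn2real (z n)) \<longlonglongrightarrow> enn2real l"
    using assms by (cases l) (auto intro: tendsto_enn2real)
  then have "(\<lambda>n. ennreal (exp (- enn2real (z n)))) \<longlonglongrightarrow> ennreal (exp (- enn2real l))"
    by (intro tendsto_ennrealI tendsto_exp tendsto_minus)
  moreover have "eventually (\<lambda>n. z n < \<infinity>) sequentially"
    using assms by (rule order_tendstoD)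
  then have "eventually (\<lambda>n. ennreal (exp (- enn2real (z n))) = exp_minus (z n)) sequentially"
    by eventually_elim (auto simp: exp_minus_def)
  ultimately show ?thesis
    using assms(2) by (auto simp: exp_minus_def intro: Lim_transform_eventually)
qed

section \<open>The heat semigroup\<close>

definition heat_density :: "real \<Rightarrow> 'a::euclidean_space \<Rightarrow> real" where
  "heat_density t z = (2 * pi * t) powr (- real DIM('a) / 2) * exp (- (norm z)\<^sup>2 / (2 * t))"

lemma heat_density_nonneg [simp]: "0 \<le> heat_density t z"
  by (simp add: heat_density_def)

lemma heat_density_uminus [simp]: "heat_density t (- z) = heat_density t z"
  by (simp add: heat_density_def)

lemma measurable_heat_density [measurable]: "heat_density t \<in> borel_measurable borel"
  unfolding heat_density_def[abs_def] by measurable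

definition heat :: "real \<Rightarrow> ('a::euclidean_space \<Rightarrow> ennreal) \<Rightarrow> 'a \<Rightarrow> ennreal" where
  "heat t f x = (\<integral>\<^sup>+z. ennreal (heat_density t z) * f (x + z) \<partial>lborel)"

lemma measurable_heat [measurable]:
  assumes [measurable]: "f \<in> borel_measurable borel"
  shows "heat t f \<in> borel_measurable borel"
  unfolding heat_def[abs_def] by measurable

lemma nn_integral_lborel_shift:
  fixes f :: "'a::euclidean_space \<Rightarrow> ennreal"
  assumes [measurable]: "f \<in> borel_measurable borel"
  shows "(\<integral>\<^sup>+x. f (x + c) \<partial>lborel) = (\<integral>\<^sup>+x. f x \<partial>lborel)"
proof -
  have "(\<integral>\<^sup>+x. f x \<partial>lborel) = (\<integral>\<^sup>+x. f x \<partial>distr lborel borel ((+) c))"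
    by (simp add: lborel_distr_plus)
  also have "\<dots> = (\<integral>\<^sup>+x. f (x + c) \<partial>lborel)"
    by (subst nn_integral_distr) (auto simp: add.commute)
  finally show ?thesis ..
qed

lemma lborel_distr_reflect: "distr lborel borel uminus = (lborel :: 'a::euclidean_space measure)"
  by (subst lborel_affine[of "-1" 0]) (auto simp: density_1 one_ennreal_def[symmetric])

lemma nn_integral_lborel_uminus:
  fixes f :: "'a::euclidean_space \<Rightarrow> ennreal"
  assumes [measurable]: "f \<in> borel_measurable borel"
  shows "(\<integral>\<^sup>+x. f (- x) \<partial>lborel) = (\<integral>\<^sup>+x. f x \<partial>lborel)"
proof -
  have "(\<integral>\<^sup>+x. f x \<partial>lborel) = (\<integral>\<^sup>+x. f x \<partial>distr lborel borel uminus)"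
    by (simp add: lborel_distr_reflect)
  also have "\<dots> = (\<integral>\<^sup>+x. f (- x) \<partial>lborel)"
    by (subst nn_integral_distr) auto
  finally show ?thesis ..
qed

lemma heat_symmetric:
  fixes f g :: "'a::euclidean_space \<Rightarrow> ennreal"
  assumes [measurable]: "f \<in> borel_measurable borel" "g \<in> borel_measurable borel"
  shows "(\<integral>\<^sup>+x. g x * heat t f x \<partial>lborel) = (\<integral>\<^sup>+x. heat t g x * f x \<partial>lborel)"
proof -
  have "(\<integral>\<^sup>+x. g x * heat t f x \<partial>lborel)
      = (\<integral>\<^sup>+x. \<integral>\<^sup>+z. ennreal (heat_density t z) * (g x * f (x + z)) \<partial>lborel \<partial>lborel)"
    unfolding heat_def by (subst nn_integral_cmult[symmetric]) (auto simp: mult_ac)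
  also have "\<dots> = (\<integral>\<^sup>+z. \<integral>\<^sup>+x. ennreal (heat_density t z) * (g x * f (x + z)) \<partial>lborel \<partial>lborel)"
    by (rule lborel_pair.Fubini') measurable
  also have "\<dots> = (\<integral>\<^sup>+z. \<integral>\<^sup>+x. ennreal (heat_density t z) * (g (x - z) * f x) \<partial>lborel \<partial>lborel)"
  proof (rule nn_integral_cong)
    fix z :: 'a
    show "(\<integral>\<^sup>+x. ennreal (heat_density t z) * (g x * f (x + z)) \<partial>lborel)
        = (\<integral>\<^sup>+x. ennreal (heat_density t z) * (g (x - z) * f x) \<partial>lborel)"
      using nn_integral_lborel_shift[of "\<lambda>x. ennreal (heat_density t z) * (g (x - z) * f x)" z] by simp
  qed
  also have "\<dots> = (\<integral>\<^sup>+z. \<integral>\<^sup>+x. ennreal (heat_density t z) * (g (x + z) * f x) \<partial>lborel \<partial>lborel)"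
    by (subst nn_integral_lborel_uminus[symmetric]) auto
  also have "\<dots> = (\<integral>\<^sup>+x. \<integral>\<^sup>+z. ennreal (heat_density t z) * (g (x + z) * f x) \<partial>lborel \<partial>lborel)"
    by (rule lborel_pair.Fubini') measurable
  also have "\<dots> = (\<integral>\<^sup>+x. heat t g x * f x \<partial>lborel)"
    unfolding heat_def by (subst nn_integral_multc[symmetric]) (auto simp: mult_ac)
  finally show ?thesis .
qed

lemma brownian_increment_integral:
  fixes B :: "real \<Rightarrow> 'w \<Rightarrow> 'a::euclidean_space"
  assumes "brownian_motion M B" "0 \<le> s" "s < t" and [measurable]: "f \<in> borel_measurable borel"
  shows "(\<integral>\<^sup>+\<omega>. f (B t \<omega> - B s \<omega>) \<partial>M) = (\<integral>\<^sup>+z. ennreal (heat_density (t - s) z) * f z \<partial>lborel)"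
proof -
  have "distributed M lborel (\<lambda>\<omega>. B t \<omega> - B s \<omega>) (\<lambda>z. ennreal (heat_density (t - s) z))"
    using assms unfolding brownian_motion_def heat_density_def by blast
  from distributed_nn_integral[OF this, of f] show ?thesis
    by simp
qed

section \<open>Brownian motion with regular paths\<close>

text \<open>
  The Markov property in the only form that is needed: the last of finitely many factors may be
  replaced by its heat average. In terms of the increments, which are independent, this is an
  integration over the last coordinate of a product measure.
\<close>

lemma brownian_one_step:
  fixes B :: "real \<Rightarrow> 'w \<Rightarrow> 'a::euclidean_space" and t :: "nat \<Rightarrow> real"
  assumes bm: "brownian_motion M B" and t0: "t 0 = 0" and t: "\<And>i. i \<le> n \<Longrightarrow> t i < t (Suc i)"
    and [measurable]: "\<And>k. \<phi> k \<in> borel_measurable borel" "f \<in> borel_measurable borel"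
  shows "(\<integral>\<^sup>+\<omega>. (\<Prod>k\<le>n. \<phi> k (x + B (t k) \<omega>)) * f (x + B (t (Suc n)) \<omega>) \<partial>M)
       = (\<integral>\<^sup>+\<omega>. (\<Prod>k\<le>n. \<phi> k (x + B (t k) \<omega>)) * heat (t (Suc n) - t n) f (x + B (t n) \<omega>) \<partial>M)"
proof -
  let ?P = "\<lambda>y. \<Prod>k\<le>n. \<phi> k (x + (\<Sum>i<k. y i))" and ?Q = "\<lambda>\<omega>. \<Prod>k\<le>n. \<phi> k (x + B (t k) \<omega>)"
  interpret prob_space M using bm by (simp add: brownian_motion_def)
  have tmono: "0 \<le> t i" if "i \<le> Suc n" for i
    using that by (induction i) (use t t0 in \<open>force+\<close>)
  have B_meas: "\<And>s. 0 \<le> s \<Longrightarrow> B s \<in> borel_measurable M" and B0: "AE \<omega> in M. B 0 \<omega> = 0"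
    using bm by (auto simp: brownian_motion_def)
  define D where "D i \<omega> = B (t (Suc i)) \<omega> - B (t i) \<omega>" for i \<omega>
  have D_meas: "D i \<in> borel_measurable M" if "i \<le> n" for i
    unfolding D_def[abs_def] using that by (intro borel_measurable_diff B_meas tmono) auto
  define \<mu> where "\<mu> i = distr M borel (if i \<le> n then D i else (\<lambda>_. 0))" for i
  have "prob_space (\<mu> i)" for i
    unfolding \<mu>_def by (rule prob_space_distr) (use D_meas in auto)
  then interpret \<mu>: product_prob_space \<mu> "{..n}"
    unfolding product_prob_space_def product_sigma_finite_def product_prob_space_axioms_def
    by (simp add: prob_space_imp_sigma_finite)
  have sets_\<mu>[measurable_cong]: "sets (\<mu> i) = sets borel" for i by (simp add: \<mu>_def)
  have sum_eq: "AE \<omega> in M. \<forall>k\<le>Suc n. B (t k) \<omega> = (\<Sum>i<k. D i \<omega>)"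
    using B0
  proof eventually_elim
    case (elim \<omega>)
    have "(\<Sum>i<k. D i \<omega>) = B (t k) \<omega> - B (t 0) \<omega>" for k
      unfolding D_def by (rule sum_lessThan_telescope)
    with elim t0 show ?case by simp
  qed
  have "indep_vars (\<lambda>_. borel) D {..<Suc n}"
    using bm t t0 unfolding brownian_motion_def D_def[abs_def] by (auto simp: less_Suc_eq_le)
  then have distr: "distr M (\<Pi>\<^sub>M i\<in>{..n}. borel) (\<lambda>\<omega>. \<lambda>i\<in>{..n}. D i \<omega>) = (\<Pi>\<^sub>M i\<in>{..n}. \<mu> i)"
    by (subst (asm) indep_vars_iff_distr_eq_PiM')
       (auto simp: D_meas \<mu>_def lessThan_Suc_atMost intro!: PiM_cong)
  have joint: "(\<integral>\<^sup>+\<omega>. G (\<lambda>i\<in>{..n}. D i \<omega>) \<partial>M) = (\<integral>\<^sup>+y. \<integral>\<^sup>+z. G (y(n := z)) \<partial>\<mu> n \<partial>(\<Pi>\<^sub>M i\<in>{..<n}. \<mu> i))"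
    if G: "G \<in> borel_measurable (\<Pi>\<^sub>M i\<in>{..n}. \<mu> i)" for G :: "(nat \<Rightarrow> 'a) \<Rightarrow> ennreal"
  proof -
    have [measurable]: "(\<lambda>\<omega>. \<lambda>i\<in>{..n}. D i \<omega>) \<in> measurable M (\<Pi>\<^sub>M i\<in>{..n}. borel)"
      by (rule measurable_restrict) (use D_meas in auto)
    have "sets (\<Pi>\<^sub>M i\<in>{..n}. \<mu> i) = sets (\<Pi>\<^sub>M i\<in>{..n}. (borel :: 'a measure))"
      by (intro sets_PiM_cong sets_\<mu> refl)
    then have "(\<integral>\<^sup>+\<omega>. G (\<lambda>i\<in>{..n}. D i \<omega>) \<partial>M)
        = (\<integral>\<^sup>+y. G y \<partial>distr M (\<Pi>\<^sub>M i\<in>{..n}. borel) (\<lambda>\<omega>. \<lambda>i\<in>{..n}. D i \<omega>))"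
      using G by (subst nn_integral_distr) (auto cong: measurable_cong_sets)
    also have "\<dots> = (\<integral>\<^sup>+y. \<integral>\<^sup>+z. G (y(n := z)) \<partial>\<mu> n \<partial>(\<Pi>\<^sub>M i\<in>{..<n}. \<mu> i))"
    proof -
      have ins: "{..n} = insert n {..<n}" by auto
      show ?thesis unfolding distr using G unfolding ins
        by (intro \<mu>.product_nn_integral_insert) auto
    qed
    finally show ?thesis .
  qed
  have restr: "(\<Sum>i<k. (\<lambda>i\<in>{..n}. D i \<omega>) i) = (\<Sum>i<k. D i \<omega>)" if "k \<le> Suc n" for k \<omega>
    using that by (intro sum.cong) auto
  have PiM_sum: "(\<lambda>y. \<Sum>i<k. y i) \<in> borel_measurable (\<Pi>\<^sub>M i\<in>{..n}. \<mu> i)" if "k \<le> Suc n" for k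
    using that by (intro borel_measurable_sum) (auto intro!: measurable_component_singleton)
  have prod_meas: "(\<lambda>y. \<Prod>k\<le>n. \<phi> k (x + (\<Sum>i<k. y i))) \<in> borel_measurable (\<Pi>\<^sub>M i\<in>{..n}. \<mu> i)"
    by (intro borel_measurable_prod_ennreal measurable_compose[OF _ assms(4)] borel_measurable_add PiM_sum) auto
  have heat_eq: "(\<integral>\<^sup>+z. f (w + z) \<partial>\<mu> n) = heat (t (Suc n) - t n) f w" for w
    using brownian_increment_integral[OF bm, of "t n" "t (Suc n)" "\<lambda>z. f (w + z)"] t[of n] tmono[of n] D_meas[of n]
    unfolding \<mu>_def heat_def by (subst nn_integral_distr) (auto simp: D_def)
  have "(\<integral>\<^sup>+\<omega>. ?Q \<omega> * f (x + B (t (Suc n)) \<omega>) \<partial>M)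
      = (\<integral>\<^sup>+\<omega>. ?P (\<lambda>i. D i \<omega>) * f (x + (\<Sum>i<Suc n. D i \<omega>)) \<partial>M)"
    by (rule nn_integral_cong_AE) (use sum_eq in eventually_elim, auto)
  also have "\<dots> = (\<integral>\<^sup>+\<omega>. (\<lambda>y. ?P y * f (x + (\<Sum>i<Suc n. y i))) (\<lambda>i\<in>{..n}. D i \<omega>) \<partial>M)"
    by (intro nn_integral_cong) (simp add: restr le_SucI del: sum.lessThan_Suc restrict_apply cong: prod.cong_simp)
  also have "\<dots> = (\<integral>\<^sup>+y. \<integral>\<^sup>+z. ?P (y(n:=z)) * f (x + (\<Sum>i<Suc n. (y(n:=z)) i)) \<partial>\<mu> n \<partial>(\<Pi>\<^sub>M i\<in>{..<n}. \<mu> i))"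
    by (rule joint) (intro borel_measurable_times_ennreal prod_meas measurable_compose[OF _ assms(5)] borel_measurable_add PiM_sum, auto)
  also have "\<dots> = (\<integral>\<^sup>+y. ?P y * heat (t (Suc n) - t n) f (x + (\<Sum>i<n. y i)) \<partial>(\<Pi>\<^sub>M i\<in>{..<n}. \<mu> i))"
  proof (rule nn_integral_cong)
    fix y :: "nat \<Rightarrow> 'a"
    have *: "(\<Sum>i<k. (y(n:=z)) i) = (\<Sum>i<k. y i)" if "k \<le> n" for k z
      using that by (intro sum.cong) auto
    have "(\<integral>\<^sup>+z. ?P (y(n:=z)) * f (x + (\<Sum>i<Suc n. (y(n:=z)) i)) \<partial>\<mu> n)
        = (\<integral>\<^sup>+z. ?P y * f ((x + (\<Sum>i<n. y i)) + z) \<partial>\<mu> n)"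
      by (intro nn_integral_cong) (simp add: * add.assoc fun_upd_same del: fun_upd_apply cong: prod.cong_simp)
    also have "\<dots> = ?P y * heat (t (Suc n) - t n) f (x + (\<Sum>i<n. y i))"
      unfolding heat_eq[symmetric] by (rule nn_integral_cmult) measurable
    finally show "(\<integral>\<^sup>+z. ?P (y(n:=z)) * f (x + (\<Sum>i<Suc n. (y(n:=z)) i)) \<partial>\<mu> n) = \<dots>" .
  qed
  \<comment> \<open>Integrating over the last coordinate again, in which the integrand is constant, covers \<open>n = 0\<close>,
    where the product over the remaining coordinates is empty.\<close>
  also have "\<dots> = (\<integral>\<^sup>+y. \<integral>\<^sup>+z. ?P (y(n:=z)) * heat (t (Suc n) - t n) f (x + (\<Sum>i<n. (y(n:=z)) i)) \<partial>\<mu> n \<partial>(\<Pi>\<^sub>M i\<in>{..<n}. \<mu> i))"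
  proof (rule nn_integral_cong)
    fix y :: "nat \<Rightarrow> 'a"
    have *: "(\<Sum>i<k. (y(n:=z)) i) = (\<Sum>i<k. y i)" if "k \<le> n" for k z
      using that by (intro sum.cong) auto
    show "?P y * heat (t (Suc n) - t n) f (x + (\<Sum>i<n. y i)) =
      (\<integral>\<^sup>+z. ?P (y(n:=z)) * heat (t (Suc n) - t n) f (x + (\<Sum>i<n. (y(n:=z)) i)) \<partial>\<mu> n)"
      using \<mu>.prob_space[of n] by (simp add: * prob_space.emeasure_space_1[OF \<open>\<And>i. prob_space (\<mu> i)\<close>] del: fun_upd_apply cong: prod.cong_simp)
  qed
  also have "\<dots> = (\<integral>\<^sup>+\<omega>. (\<lambda>y. ?P y * heat (t (Suc n) - t n) f (x + (\<Sum>i<n. y i))) (\<lambda>i\<in>{..n}. D i \<omega>) \<partial>M)"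
    by (rule joint[symmetric]) (intro borel_measurable_times_ennreal prod_meas measurable_compose[OF _ measurable_heat[OF assms(5)]] borel_measurable_add PiM_sum, auto)
  also have "\<dots> = (\<integral>\<^sup>+\<omega>. ?P (\<lambda>i. D i \<omega>) * heat (t (Suc n) - t n) f (x + (\<Sum>i<n. D i \<omega>)) \<partial>M)"
    by (intro nn_integral_cong) (simp add: restr le_SucI del: sum.lessThan_Suc restrict_apply cong: prod.cong_simp)
  also have "\<dots> = (\<integral>\<^sup>+\<omega>. ?Q \<omega> * heat (t (Suc n) - t n) f (x + B (t n) \<omega>) \<partial>M)"
    by (rule nn_integral_cong_AE) (use sum_eq in eventually_elim, auto)
  finally show ?thesis .
qed

text \<open>
  Path properties of a Brownian motion hold almost surely. It is convenient to work with a version for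
  which they hold at every point of the probability space and for every index, negative ones included:
  then \<open>(t, \<omega>) \<mapsto> B t \<omega>\<close> is jointly measurable and Fubini's theorem applies
  without exceptional sets. Independence of increments is kept only through its consequence
  \<open>one_step\<close>.
\<close>

locale brownian_paths = prob_space M for M :: "'w measure" +
  fixes B :: "real \<Rightarrow> 'w \<Rightarrow> 'a::euclidean_space"
  assumes B_measurable: "B t \<in> borel_measurable M"
    and B_nonpos: "t \<le> 0 \<Longrightarrow> B t \<omega> = 0"
    and B_continuous: "continuous_on {0..} (\<lambda>t. B t \<omega>)"
    and increment_integral: "\<lbrakk>0 \<le> s; s < t; f \<in> borel_measurable borel\<rbrakk> \<Longrightarrow>
      (\<integral>\<^sup>+\<omega>. f (B t \<omega> - B s \<omega>) \<partial>M) = (\<integral>\<^sup>+z. ennreal (heat_density (t - s) z) * f z \<partial>lborel)"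
    and one_step: "\<lbrakk>r 0 = 0; \<And>i. i \<le> n \<Longrightarrow> r i < r (Suc i); \<And>k. \<phi> k \<in> borel_measurable borel;
        f \<in> borel_measurable borel\<rbrakk> \<Longrightarrow>
      (\<integral>\<^sup>+\<omega>. (\<Prod>k\<le>n. \<phi> k (x + B (r k) \<omega>)) * f (x + B (r (Suc n)) \<omega>) \<partial>M)
      = (\<integral>\<^sup>+\<omega>. (\<Prod>k\<le>n. \<phi> k (x + B (r k) \<omega>)) * heat (r (Suc n) - r n) f (x + B (r n) \<omega>) \<partial>M)"

lemma brownian_motion_paths:
  fixes B :: "real \<Rightarrow> 'w \<Rightarrow> 'a::euclidean_space"
  assumes bm: "brownian_motion M B"
  obtains B' where "brownian_paths M B'" "AE \<omega> in M. \<forall>t\<ge>0. B' t \<omega> = B t \<omega>"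
proof -
  interpret prob_space M using bm by (simp add: brownian_motion_def)
  have "AE \<omega> in M. B 0 \<omega> = 0 \<and> continuous_on {0..} (\<lambda>t. B t \<omega>)"
    using bm by (auto simp: brownian_motion_def)
  then obtain N where N: "N \<in> null_sets M"
    and good: "\<And>\<omega>. \<omega> \<in> space M - N \<Longrightarrow> B 0 \<omega> = 0 \<and> continuous_on {0..} (\<lambda>t. B t \<omega>)"
    by (auto elim!: AE_E3)
  define B' where "B' t \<omega> = (if \<omega> \<in> space M - N \<and> 0 \<le> t then B t \<omega> else 0)" for t \<omega>
  have eq: "AE \<omega> in M. \<forall>t\<ge>0. B' t \<omega> = B t \<omega>"
    using AE_not_in[OF N] by (auto simp: B'_def)
  have "brownian_paths M B'"
  proof
    fix t
    show "B' t \<in> borel_measurable M"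
    proof (cases "0 \<le> t")
      case True
      then have [measurable]: "B t \<in> borel_measurable M" using bm by (simp add: brownian_motion_def)
      have [measurable]: "N \<in> sets M" using N by auto
      show ?thesis unfolding B'_def[abs_def] using True by measurable
    qed (simp add: B'_def[abs_def])
  next
    fix t \<omega> show "B' t \<omega> = 0" if "t \<le> 0"
      using that good[of \<omega>] by (cases "t = 0") (auto simp: B'_def)
  next
    fix \<omega> show "continuous_on {0..} (\<lambda>t. B' t \<omega>)"
      using good[of \<omega>] by (cases "\<omega> \<in> space M - N") (auto simp: B'_def cong: continuous_on_cong_simp)
  next
    fix s t :: real and f :: "'a \<Rightarrow> ennreal" assume st: "0 \<le> s" "s < t" and f: "f \<in> borel_measurable borel"
    have "(\<integral>\<^sup>+\<omega>. f (B' t \<omega> - B' s \<omega>) \<partial>M) = (\<integral>\<^sup>+\<omega>. f (B t \<omega> - B s \<omega>) \<partial>M)"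
      by (rule nn_integral_cong_AE) (use eq in eventually_elim, use st in auto)
    also have "\<dots> = (\<integral>\<^sup>+z. ennreal (heat_density (t - s) z) * f z \<partial>lborel)"
      by (rule brownian_increment_integral[OF bm st f])
    finally show "(\<integral>\<^sup>+\<omega>. f (B' t \<omega> - B' s \<omega>) \<partial>M) = \<dots>" .
  next
    fix r :: "nat \<Rightarrow> real" and n :: nat and \<phi> :: "nat \<Rightarrow> 'a \<Rightarrow> ennreal" and f :: "'a \<Rightarrow> ennreal" and x
    assume r: "r 0 = 0" "\<And>i. i \<le> n \<Longrightarrow> r i < r (Suc i)"
      and \<phi>: "\<And>k. \<phi> k \<in> borel_measurable borel" and f: "f \<in> borel_measurable borel"
    have r_nonneg: "0 \<le> r i" if "i \<le> Suc n" for i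
      using that by (induction i) (use r in \<open>force+\<close>)
    have "(\<integral>\<^sup>+\<omega>. (\<Prod>k\<le>n. \<phi> k (x + B' (r k) \<omega>)) * f (x + B' (r (Suc n)) \<omega>) \<partial>M)
        = (\<integral>\<^sup>+\<omega>. (\<Prod>k\<le>n. \<phi> k (x + B (r k) \<omega>)) * f (x + B (r (Suc n)) \<omega>) \<partial>M)"
      by (rule nn_integral_cong_AE) (use eq in eventually_elim, use r_nonneg in \<open>auto intro!: arg_cong2[where f="(*)"] prod.cong\<close>)
    also have "\<dots> = (\<integral>\<^sup>+\<omega>. (\<Prod>k\<le>n. \<phi> k (x + B (r k) \<omega>)) * heat (r (Suc n) - r n) f (x + B (r n) \<omega>) \<partial>M)"
      by (rule brownian_one_step[OF bm r \<phi> f])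
    also have "\<dots> = (\<integral>\<^sup>+\<omega>. (\<Prod>k\<le>n. \<phi> k (x + B' (r k) \<omega>)) * heat (r (Suc n) - r n) f (x + B' (r n) \<omega>) \<partial>M)"
      by (rule nn_integral_cong_AE) (use eq in eventually_elim, use r_nonneg in \<open>auto intro!: arg_cong2[where f="(*)"] prod.cong\<close>)
    finally show "(\<integral>\<^sup>+\<omega>. (\<Prod>k\<le>n. \<phi> k (x + B' (r k) \<omega>)) * f (x + B' (r (Suc n)) \<omega>) \<partial>M) = \<dots>" .
  qed
  with eq show ?thesis by (rule that[rotated])
qed

lemma AE_lborel_shift:
  fixes P :: "'a::euclidean_space \<Rightarrow> bool"
  assumes "AE z in lborel. P z"
  shows "AE z in lborel. P (x + z)"
proof -
  have "AE z in distr lborel borel ((+) x). P z"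
    using assms unfolding lborel_distr_plus .
  then show ?thesis
    by (rule AE_distrD[rotated]) simp
qed

lemma AE_lborel_reflect:
  fixes P :: "'a::euclidean_space \<Rightarrow> bool"
  assumes "AE z in lborel. P z"
  shows "AE z in lborel. P (x - z)"
proof -
  have "AE z in distr lborel borel uminus. P (x + z)"
    using AE_lborel_shift[OF assms, of x] unfolding lborel_distr_reflect .
  from AE_distrD[OF _ this] show ?thesis by simp
qed

context brownian_paths
begin

lemma B_0 [simp]: "B 0 \<omega> = 0"
  by (simp add: B_nonpos)

text \<open>
  Continuous paths are limits of their discretisations on grids of mesh \<open>1 / (n + 1)\<close>, and
  a discretised path involves countably many random variables only.
\<close>

lemma measurable_B_pair: "(\<lambda>(t, \<omega>). B t \<omega>) \<in> borel_measurable (borel \<Otimes>\<^sub>M M)"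
proof (rule borel_measurable_LIMSEQ_metric)
  fix n :: nat
  have [measurable]: "B t \<in> borel_measurable M" for t by (rule B_measurable)
  have "(\<lambda>p. B (real_of_int i / real (Suc n)) (snd p)) \<in> borel_measurable (borel \<Otimes>\<^sub>M M)" for i
    by measurable
  moreover have "(\<lambda>p. \<lfloor>fst p * real (Suc n)\<rfloor>) \<in> measurable (borel \<Otimes>\<^sub>M M) (count_space UNIV)"
    by measurable
  ultimately show "(\<lambda>p. B (real_of_int \<lfloor>fst p * real (Suc n)\<rfloor> / real (Suc n)) (snd p)) \<in> borel_measurable (borel \<Otimes>\<^sub>M M)"
    by (rule measurable_compose_countable)
next
  fix p :: "real \<times> 'w"
  obtain t \<omega> where p: "p = (t, \<omega>)" by (cases p)
  define q where "q n = real_of_int \<lfloor>t * real (Suc n)\<rfloor> / real (Suc n)" for n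
  have "\<bar>q n - t\<bar> \<le> 1 / real (Suc n)" for n
  proof -
    have "\<bar>q n - t\<bar> = \<bar>real_of_int \<lfloor>t * real (Suc n)\<rfloor> - t * real (Suc n)\<bar> / real (Suc n)"
      by (simp add: q_def field_simps abs_divide del: of_nat_Suc)
    also have "\<dots> \<le> 1 / real (Suc n)"
      by (intro divide_right_mono) linarith+
    finally show ?thesis .
  qed
  moreover have "(\<lambda>n. 1 / real (Suc n)) \<longlonglongrightarrow> 0" by (rule LIMSEQ_Suc[OF lim_1_over_n])
  ultimately have "(\<lambda>n. q n - t) \<longlonglongrightarrow> 0"
    by (intro Lim_null_comparison[of "\<lambda>n. q n - t" "\<lambda>n. 1 / real (Suc n)"]) auto
  then have q: "q \<longlonglongrightarrow> t" by (simp add: LIM_zero_iff)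
  show "(\<lambda>n. B (real_of_int \<lfloor>fst p * real (Suc n)\<rfloor> / real (Suc n)) (snd p)) \<longlonglongrightarrow> (case p of (t, \<omega>) \<Rightarrow> B t \<omega>)"
  proof (cases "0 \<le> t")
    case True
    then have "q n \<in> {0..}" for n by (simp add: q_def)
    from continuous_on_tendsto_compose[OF B_continuous q _ always_eventually] this True
    show ?thesis by (simp add: p q_def)
  next
    case False
    then have "\<lfloor>t * real (Suc n)\<rfloor> \<le> 0" for n
      by (simp add: floor_le_iff mult_less_0_iff del: of_nat_Suc) (smt (verit) False mult_nonneg_nonpos2 of_nat_0_le_iff mult_minus_left)
    then have "q n \<le> 0" for n by (simp add: q_def divide_le_0_iff del: of_nat_Suc)
    with False show ?thesis by (simp add: p B_nonpos q_def[symmetric] del: of_nat_Suc)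
  qed
qed

lemma measurable_B [measurable (raw)]:
  assumes "f \<in> borel_measurable N" "g \<in> measurable N M"
  shows "(\<lambda>x. B (f x) (g x)) \<in> borel_measurable N"
  using measurable_compose[OF measurable_Pair[OF assms] measurable_B_pair] by simp

lemma AE_increment:
  assumes "0 \<le> s" "s < t" "AE z in lborel. P z"
  shows "AE \<omega> in M. P (B t \<omega> - B s \<omega>)"
proof -
  obtain N where N: "N \<in> null_sets lborel" and P: "\<And>z. z \<notin> N \<Longrightarrow> P z"
    using assms(3) by (auto elim!: AE_E3)
  have [measurable]: "N \<in> sets borel" using N by auto
  have "(\<integral>\<^sup>+\<omega>. indicator N (B t \<omega> - B s \<omega>) \<partial>M) = (\<integral>\<^sup>+z. ennreal (heat_density (t - s) z) * indicator N z \<partial>lborel)"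
    using assms by (intro increment_integral) auto
  also have "\<dots> = 0"
    by (subst nn_integral_0_iff_AE) (use AE_not_in[OF N] in auto)
  finally have "AE \<omega> in M. indicator N (B t \<omega> - B s \<omega>) = (0::ennreal)"
    by (subst (asm) nn_integral_0_iff_AE) auto
  then show ?thesis by eventually_elim (auto simp: indicator_eq_0_iff intro: P)
qed

lemma AE_position:
  assumes "0 < t" "AE z in lborel. P z"
  shows "AE \<omega> in M. P (x + B t \<omega>)"
  using AE_increment[of 0 t "\<lambda>z. P (x + z)"] AE_lborel_shift[OF assms(2)] assms(1) by simp

text \<open>
  At positive times the position has a density, so a Lebesgue null set is visited on a null set of
  times only. Thus changing \<open>V\<close> on a null set does not change the Feynman--Kac functional, at any
  starting point \<open>x\<close>.
\<close>

lemma AE_occupation: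
  assumes "AE z in lborel. P z"
  shows "AE \<omega> in M. AE s in lborel. 0 < s \<longrightarrow> P (x + B s \<omega>)"
proof -
  obtain N where N: "N \<in> null_sets lborel" and P: "\<And>z. z \<notin> N \<Longrightarrow> P z"
    using assms by (auto elim!: AE_E3)
  have [measurable]: "N \<in> sets borel" using N by auto
  interpret L: pair_sigma_finite lborel M ..
  have "AE s in lborel. AE \<omega> in M. 0 < s \<longrightarrow> x + B s \<omega> \<notin> N"
    using AE_position[OF _ AE_not_in[OF N]] by (auto intro!: AE_I2)
  then have "AE \<omega> in M. AE s in lborel. 0 < s \<longrightarrow> x + B s \<omega> \<notin> N"
    by (subst (asm) L.AE_commute) measurable
  then show ?thesis
  proof eventually_elim
    case (elim \<omega>)
    then show ?case by eventually_elim (use P in blast)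
  qed
qed

section \<open>Feynman--Kac operators\<close>

definition kac :: "('a \<Rightarrow> real) \<Rightarrow> real \<Rightarrow> 'a \<Rightarrow> 'w \<Rightarrow> ennreal" where
  "kac V t x \<omega> = exp_minus (\<integral>\<^sup>+s\<in>{0..t}. ennreal (V (x + B s \<omega>)) \<partial>lborel)"

text \<open>
  The Feynman--Kac operator on Borel functions with values in \<open>[0, \<infinity>]\<close>. This class is closed
  under the operator, so that compositions such as \<open>fk V s (fk V t f)\<close> can be written down.
\<close>

definition fk :: "('a \<Rightarrow> real) \<Rightarrow> real \<Rightarrow> ('a \<Rightarrow> ennreal) \<Rightarrow> 'a \<Rightarrow> ennreal" where
  "fk V t f x = (\<integral>\<^sup>+\<omega>. kac V t x \<omega> * f (x + B t \<omega>) \<partial>M)"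

lemma measurable_kac [measurable (raw)]:
  assumes [measurable]: "V \<in> borel_measurable borel" "t \<in> borel_measurable N" "x \<in> borel_measurable N" "w \<in> measurable N M"
  shows "(\<lambda>y. kac V (t y) (x y) (w y)) \<in> borel_measurable N"
proof -
  have "(\<lambda>y. kac V (t y) (x y) (w y))
      = (\<lambda>y. exp_minus (\<integral>\<^sup>+s. ennreal (V (x y + B s (w y))) * (if 0 \<le> s \<and> s \<le> t y then 1 else 0) \<partial>lborel))"
    unfolding kac_def by (intro ext arg_cong[where f=exp_minus] nn_integral_cong) (auto simp: indicator_def)
  also have "\<dots> \<in> borel_measurable N" by measurable
  finally show ?thesis .
qed

lemma measurable_fk [measurable (raw)]:
  assumes [measurable]: "V \<in> borel_measurable borel" "f \<in> borel_measurable borel" "t \<in> borel_measurable N" "x \<in> borel_measurable N"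
  shows "(\<lambda>y. fk V (t y) f (x y)) \<in> borel_measurable N"
  unfolding fk_def by measurable

lemma kac_le_1: "kac V t x \<omega> \<le> 1"
  by (simp add: kac_def exp_minus_le_1)

end

section \<open>Riemann sums and Trotter products\<close>

lemma Riemann_sum_error:
  fixes g :: "real \<Rightarrow> real"
  assumes h: "0 \<le> h" and cont: "continuous_on {a..a + real m * h} g"
    and close: "\<And>k s. k < m \<Longrightarrow> s \<in> {a + real k * h..a + real (Suc k) * h} \<Longrightarrow> \<bar>g s - g (a + real k * h)\<bar> \<le> e"
  shows "\<bar>integral {a..a + real m * h} g - h * (\<Sum>k<m. g (a + real k * h))\<bar> \<le> e * (real m * h)"
  using cont close
proof (induction m)
  case (Suc m)
  define b c where "b = a + real m * h" and "c = a + real (Suc m) * h"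
  have bc: "a \<le> b" "b \<le> c" "c - b = h" using h by (auto simp: b_def c_def algebra_simps)
  have cont: "continuous_on {a..c} g" using Suc.prems by (simp add: c_def)
  have cont': "continuous_on {a..b} g" "continuous_on {b..c} g"
    using bc by (auto intro: continuous_on_subset[OF cont])
  have "\<bar>integral {a..b} g - h * (\<Sum>k<m. g (a + real k * h))\<bar> \<le> e * (real m * h)"
    using Suc.IH cont'(1) Suc.prems(2) by (simp add: b_def)
  moreover have "\<bar>integral {b..c} g - h * g b\<bar> \<le> e * h"
  proof -
    have "integral {b..c} g - h * g b = integral {b..c} (\<lambda>s. g s - g b)"
      using bc cont'(2) by (subst Henstock_Kurzweil_Integration.integral_diff) (auto intro: integrable_continuous_real)
    also have "\<bar>\<dots>\<bar> \<le> e * (c - b)"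
    proof -
      have "norm (integral {b..c} (\<lambda>s. g s - g b)) \<le> e * (c - b)"
        using Suc.prems(2)[of m] unfolding b_def[symmetric] c_def[symmetric]
        by (intro integral_bound bc continuous_intros cont') auto
      then show ?thesis by simp
    qed
    finally show ?thesis using bc by simp
  qed
  moreover have "integral {a..c} g = integral {a..b} g + integral {b..c} g"
    using bc cont by (intro Henstock_Kurzweil_Integration.integral_combine[symmetric]) (auto intro: integrable_continuous_real)
  moreover have "h * (\<Sum>k<Suc m. g (a + real k * h)) = h * (\<Sum>k<m. g (a + real k * h)) + h * g b"
    by (simp add: b_def algebra_simps)
  moreover have "e * (real (Suc m) * h) = e * (real m * h) + e * h"
    by (simp add: algebra_simps)
  ultimately show ?case unfolding c_def[symmetric] by linarith
qed simp

text \<open>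
  Both end points are included in the sum. The surplus term vanishes in the limit, and it makes the
  Trotter products below invariant under reversal of the order of their factors.
\<close>

lemma Riemann_sum_tendsto:
  fixes g :: "real \<Rightarrow> real"
  assumes t: "0 < t" and cont: "continuous_on {a..a + t} g"
  shows "(\<lambda>N. t / real (Suc N) * (\<Sum>k\<le>Suc N. g (a + real k * (t / real (Suc N))))) \<longlonglongrightarrow> integral {a..a + t} g"
proof -
  define h where "h N = t / real (Suc N)" for N
  have h_pos: "0 < h N" and Nh: "real (Suc N) * h N = t" for N
    using t by (simp_all add: h_def del: of_nat_Suc)
  have h0: "h \<longlonglongrightarrow> 0"
    unfolding h_def using tendsto_mult[OF tendsto_const[of t] LIMSEQ_Suc[OF lim_1_over_n]] by simp
  have "(\<lambda>N. h N * (\<Sum>k<Suc N. g (a + real k * h N))) \<longlonglongrightarrow> integral {a..a + t} g"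
  proof (rule LIMSEQ_I)
    fix e :: real assume e: "0 < e"
    define e' where "e' = e / (2 * t)"
    have e': "0 < e'" using e t by (simp add: e'_def)
    have "uniformly_continuous_on {a..a + t} g"
      using cont by (intro compact_uniformly_continuous) auto
    then obtain d where d: "0 < d" "\<And>s s'. s \<in> {a..a+t} \<Longrightarrow> s' \<in> {a..a+t} \<Longrightarrow> \<bar>s' - s\<bar> < d \<Longrightarrow> \<bar>g s' - g s\<bar> < e'"
      using e' unfolding uniformly_continuous_on_def dist_real_def by metis
    from h0 d(1) have "eventually (\<lambda>N. h N < d) sequentially" by (rule order_tendstoD)
    then obtain N0 where N0: "\<And>N. N0 \<le> N \<Longrightarrow> h N < d" by (auto simp: eventually_sequentially)
    show "\<exists>N0. \<forall>N\<ge>N0. norm (h N * (\<Sum>k<Suc N. g (a + real k * h N)) - integral {a..a + t} g) < e"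
    proof (intro exI allI impI)
      fix N assume N: "N0 \<le> N"
      have "\<bar>integral {a..a + real (Suc N) * h N} g - h N * (\<Sum>k<Suc N. g (a + real k * h N))\<bar> \<le> e' * (real (Suc N) * h N)"
      proof (rule Riemann_sum_error)
        show "0 \<le> h N" using h_pos[of N] by simp
        show "continuous_on {a..a + real (Suc N) * h N} g" unfolding Nh by (rule cont)
        fix k s assume k: "k < Suc N" and s: "s \<in> {a + real k * h N..a + real (Suc k) * h N}"
        have "real (Suc k) * h N \<le> real (Suc N) * h N"
          using k h_pos[of N] by (intro mult_right_mono) auto
        moreover have "a + real k * h N \<le> a + real (Suc k) * h N"
          using h_pos[of N] by (auto simp: algebra_simps)
        moreover have "0 \<le> real k * h N"
          using h_pos[of N] by simp
        then have "a \<le> s" "a \<le> a + real k * h N" using s unfolding atLeastAtMost_iff by linarith+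
        moreover have "s - (a + real k * h N) \<le> h N"
          using s by (simp add: algebra_simps)
        ultimately show "\<bar>g s - g (a + real k * h N)\<bar> \<le> e'"
          using s N0[OF N] unfolding Nh atLeastAtMost_iff by (intro less_imp_le d(2)) (unfold atLeastAtMost_iff, linarith+)
      qed
      then show "norm (h N * (\<Sum>k<Suc N. g (a + real k * h N)) - integral {a..a + t} g) < e"
        unfolding Nh using e t by (simp add: e'_def abs_minus_commute)
    qed
  qed
  moreover have "(\<lambda>N. h N * g (a + t)) \<longlonglongrightarrow> 0 * g (a + t)"
    by (intro tendsto_mult h0 tendsto_const)
  ultimately have "(\<lambda>N. h N * (\<Sum>k<Suc N. g (a + real k * h N)) + h N * g (a + t)) \<longlonglongrightarrow> integral {a..a + t} g + 0 * g (a + t)"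
    by (rule tendsto_add)
  moreover have "h N * (\<Sum>k<Suc N. g (a + real k * h N)) + h N * g (a + t) = h N * (\<Sum>k\<le>Suc N. g (a + real k * h N))" for N
    using Nh[of N] by (simp add: lessThan_Suc_atMost[symmetric] distrib_left del: of_nat_Suc)
  ultimately show ?thesis by (simp add: h_def)
qed

context brownian_paths
begin

definition weight :: "('a \<Rightarrow> real) \<Rightarrow> real \<Rightarrow> 'a \<Rightarrow> ennreal" where
  "weight V h z = ennreal (exp (- h * V z))"

lemma measurable_weight [measurable]:
  assumes [measurable]: "V \<in> borel_measurable borel"
  shows "weight V h \<in> borel_measurable borel"
  unfolding weight_def[abs_def] by measurable

text \<open>One factor of the Lie--Trotter product: multiply by \<open>exp (- h V)\<close>, then diffuse for time \<open>h\<close>.\<close>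

definition trotter_step :: "('a \<Rightarrow> real) \<Rightarrow> real \<Rightarrow> ('a \<Rightarrow> ennreal) \<Rightarrow> 'a \<Rightarrow> ennreal" where
  "trotter_step V h f = heat h (\<lambda>z. weight V h z * f z)"

lemma measurable_trotter_step [measurable]:
  assumes [measurable]: "V \<in> borel_measurable borel" "f \<in> borel_measurable borel"
  shows "trotter_step V h f \<in> borel_measurable borel"
  unfolding trotter_step_def by measurable

lemma measurable_trotter_power [measurable]:
  assumes [measurable]: "V \<in> borel_measurable borel" and f: "f \<in> borel_measurable borel"
  shows "(trotter_step V h ^^ m) f \<in> borel_measurable borel"
  by (induction m) (use f in auto)

text \<open>The Markov property, applied once for each grid point, starting with the last one.\<close>

lemma discrete_formula:
  assumes [measurable]: "V \<in> borel_measurable borel" "f \<in> borel_measurable borel" and h: "0 < h"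
  shows "(\<integral>\<^sup>+\<omega>. (\<Prod>k\<le>m. weight V h (x + B (real k * h) \<omega>)) * f (x + B (real m * h) \<omega>) \<partial>M)
       = weight V h x * (trotter_step V h ^^ m) f x"
  using assms(2)
proof (induction m arbitrary: f)
  case 0
  then show ?case by (simp add: emeasure_space_1)
next
  case (Suc m)
  note [measurable] = Suc.prems
  have "(\<integral>\<^sup>+\<omega>. (\<Prod>k\<le>Suc m. weight V h (x + B (real k * h) \<omega>)) * f (x + B (real (Suc m) * h) \<omega>) \<partial>M)
      = (\<integral>\<^sup>+\<omega>. (\<Prod>k\<le>m. weight V h (x + B (real k * h) \<omega>)) * (\<lambda>z. weight V h z * f z) (x + B (real (Suc m) * h) \<omega>) \<partial>M)"
    by (simp add: mult_ac)
  also have "\<dots> = (\<integral>\<^sup>+\<omega>. (\<Prod>k\<le>m. weight V h (x + B (real k * h) \<omega>)) * heat (real (Suc m) * h - real m * h) (\<lambda>z. weight V h z * f z) (x + B (real m * h) \<omega>) \<partial>M)"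
    by (rule one_step[of "\<lambda>k. real k * h" m "\<lambda>_. weight V h"]) (use h in auto)
  also have "\<dots> = (\<integral>\<^sup>+\<omega>. (\<Prod>k\<le>m. weight V h (x + B (real k * h) \<omega>)) * trotter_step V h f (x + B (real m * h) \<omega>) \<partial>M)"
    by (simp add: trotter_step_def algebra_simps)
  also have "\<dots> = weight V h x * (trotter_step V h ^^ m) (trotter_step V h f) x"
    by (rule Suc.IH) measurable
  finally show ?case by (simp add: funpow_swap1)
qed

text \<open>
  With \<open>W\<close> the multiplication by the weight and \<open>P\<close> the heat operator this says that \<open>W (P W)\<^sup>m\<close> is
  symmetric, which is clear since \<open>W\<close> and \<open>P\<close> are and the word is a palindrome.
\<close>

lemma trotter_power_symmetric:
  assumes [measurable]: "V \<in> borel_measurable borel" "f \<in> borel_measurable borel" "g \<in> borel_measurable borel"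
  shows "(\<integral>\<^sup>+x. g x * (weight V h x * (trotter_step V h ^^ m) f x) \<partial>lborel)
       = (\<integral>\<^sup>+x. (weight V h x * (trotter_step V h ^^ m) g x) * f x \<partial>lborel)"
  using assms(2)
proof (induction m arbitrary: f)
  case (Suc m)
  note [measurable] = Suc.prems
  define G where "G x = weight V h x * (trotter_step V h ^^ m) g x" for x
  have [measurable]: "G \<in> borel_measurable borel" unfolding G_def by measurable
  have "(\<integral>\<^sup>+x. g x * (weight V h x * (trotter_step V h ^^ Suc m) f x) \<partial>lborel)
      = (\<integral>\<^sup>+x. G x * trotter_step V h f x \<partial>lborel)"
    unfolding G_def by (subst Suc.IH[symmetric]) (auto simp: funpow_swap1)
  also have "\<dots> = (\<integral>\<^sup>+x. heat h G x * (weight V h x * f x) \<partial>lborel)"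
    unfolding trotter_step_def by (rule heat_symmetric) measurable
  also have "\<dots> = (\<integral>\<^sup>+x. (weight V h x * (trotter_step V h ^^ Suc m) g x) * f x \<partial>lborel)"
    by (simp add: trotter_step_def G_def[abs_def] mult_ac)
  finally show ?case .
qed (simp add: mult_ac)

text \<open>
  The semigroup law before the limit: a path on \<open>[0, s + t]\<close> is sampled with mesh \<open>h\<close> up to time \<open>s\<close>
  and with mesh \<open>h'\<close> afterwards, and the Markov property removes the sample points after \<open>s\<close>.
\<close>

lemma discrete_semigroup:
  assumes [measurable]: "V \<in> borel_measurable borel" "f \<in> borel_measurable borel"
    and h: "0 < h" "0 < h'" and s: "s = real m * h"
  shows "(\<integral>\<^sup>+\<omega>. (\<Prod>k\<le>m. weight V h (x + B (real k * h) \<omega>)) *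
             (\<Prod>k\<le>j. weight V h' (x + B (s + real k * h') \<omega>)) * f (x + B (s + real j * h') \<omega>) \<partial>M)
       = (\<integral>\<^sup>+\<omega>. (\<Prod>k\<le>m. weight V h (x + B (real k * h) \<omega>)) *
             (weight V h' (x + B s \<omega>) * (trotter_step V h' ^^ j) f (x + B s \<omega>)) \<partial>M)"
proof -
  define r where "r i = (if i \<le> m then real i * h else s + real (i - m) * h')" for i
  \<comment> \<open>Time \<open>s\<close> is a sample point of both grids and therefore carries both weights.\<close>
  define \<phi> where "\<phi> i = (if i < m then weight V h else if i = m then (\<lambda>z. weight V h z * weight V h' z) else weight V h')" for i
  have [measurable]: "\<phi> i \<in> borel_measurable borel" for i unfolding \<phi>_def by simp
  have r_add: "r (m + i) = s + real i * h'" for i by (auto simp: r_def s)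
  have r_mono: "r i < r (Suc i)" for i
  proof -
    consider "Suc i \<le> m" | "i = m" | "m < i" by linarith
    then show ?thesis
    proof cases
      case 3
      then have "real (Suc i - m) = real (i - m) + 1" by simp
      with 3 h show ?thesis by (simp add: r_def algebra_simps)
    qed (use h in \<open>auto simp: r_def s\<close>)
  qed
  have prod0: "(\<Prod>k\<le>m. \<phi> k (x + B (r k) \<omega>)) = (\<Prod>k\<le>m. weight V h (x + B (real k * h) \<omega>)) * weight V h' (x + B s \<omega>)" for \<omega>
  proof -
    have "(\<Prod>k<m. \<phi> k (x + B (r k) \<omega>)) = (\<Prod>k<m. weight V h (x + B (real k * h) \<omega>))"
      by (intro prod.cong) (auto simp: \<phi>_def r_def)
    moreover have split: "(\<Prod>k\<le>m. F k) = F m * (\<Prod>k<m. F k)" for F :: "nat \<Rightarrow> ennreal"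
      by (cases m) (simp_all add: lessThan_Suc_atMost mult.commute)
    moreover have "\<phi> m (x + B (r m) \<omega>) = weight V h (x + B (real m * h) \<omega>) * weight V h' (x + B s \<omega>)"
      by (simp add: \<phi>_def r_def s)
    ultimately show ?thesis
      unfolding split by (simp only: mult_ac)
  qed
  have prod: "(\<Prod>k\<le>m+j. \<phi> k (x + B (r k) \<omega>))
      = (\<Prod>k\<le>m. weight V h (x + B (real k * h) \<omega>)) * (\<Prod>k\<le>j. weight V h' (x + B (s + real k * h') \<omega>))" for \<omega> j
  proof (induction j)
    case (Suc j)
    have "\<phi> (Suc (m + j)) = weight V h'" by (simp add: \<phi>_def)
    with Suc r_add[of "Suc j"] show ?case by (simp add: mult_ac)
  qed (simp add: prod0)
  have "(\<integral>\<^sup>+\<omega>. (\<Prod>k\<le>m+j. \<phi> k (x + B (r k) \<omega>)) * f (x + B (r (m + j)) \<omega>) \<partial>M)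
      = (\<integral>\<^sup>+\<omega>. (\<Prod>k\<le>m. \<phi> k (x + B (r k) \<omega>)) * (trotter_step V h' ^^ j) f (x + B s \<omega>) \<partial>M)"
    using assms(2)
  proof (induction j arbitrary: f)
    case 0
    then show ?case by (simp add: r_add[of 0, simplified])
  next
    case (Suc j)
    note [measurable] = Suc.prems
    have "(\<integral>\<^sup>+\<omega>. (\<Prod>k\<le>m+Suc j. \<phi> k (x + B (r k) \<omega>)) * f (x + B (r (m + Suc j)) \<omega>) \<partial>M)
        = (\<integral>\<^sup>+\<omega>. (\<Prod>k\<le>m+j. \<phi> k (x + B (r k) \<omega>)) * (\<lambda>z. weight V h' z * f z) (x + B (r (Suc (m + j))) \<omega>) \<partial>M)"
      by (simp add: \<phi>_def mult_ac)
    also have "\<dots> = (\<integral>\<^sup>+\<omega>. (\<Prod>k\<le>m+j. \<phi> k (x + B (r k) \<omega>)) * heat (r (Suc (m + j)) - r (m + j)) (\<lambda>z. weight V h' z * f z) (x + B (r (m + j)) \<omega>) \<partial>M)"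
      by (rule one_step) (auto simp: r_mono, simp add: r_def)
    also have "r (Suc (m + j)) - r (m + j) = h'"
      using r_add[of "Suc j"] r_add[of j] by (simp add: distrib_right)
    also have "(\<integral>\<^sup>+\<omega>. (\<Prod>k\<le>m+j. \<phi> k (x + B (r k) \<omega>)) * heat h' (\<lambda>z. weight V h' z * f z) (x + B (r (m + j)) \<omega>) \<partial>M)
       = (\<integral>\<^sup>+\<omega>. (\<Prod>k\<le>m. \<phi> k (x + B (r k) \<omega>)) * (trotter_step V h' ^^ j) (trotter_step V h' f) (x + B s \<omega>) \<partial>M)"
      unfolding trotter_step_def[symmetric] by (rule Suc.IH) measurable
    finally show ?case by (simp add: funpow_swap1)
  qed
  then show ?thesis unfolding prod prod0 r_add by (simp add: mult_ac)
qed

lemma continuous_along_path: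
  fixes V :: "'a \<Rightarrow> real"
  assumes "continuous_on UNIV V" "S \<subseteq> {0..}"
  shows "continuous_on S (\<lambda>s. V (x + B s \<omega>))"
  by (intro continuous_on_compose2[OF assms(1)] continuous_intros continuous_on_subset[OF B_continuous assms(2)]) auto

lemma nn_integral_continuous_path:
  fixes V :: "'a \<Rightarrow> real"
  assumes V: "continuous_on UNIV V" "\<And>z. 0 \<le> V z" and a: "0 \<le> a" and \<omega>: "\<omega> \<in> space M"
  shows "(\<integral>\<^sup>+s\<in>{a..b}. ennreal (V (x + B s \<omega>)) \<partial>lborel) = ennreal (integral {a..b} (\<lambda>s. V (x + B s \<omega>)))"
proof -
  have [measurable]: "V \<in> borel_measurable borel" using V(1) by (rule borel_measurable_continuous_onI)
  have "(\<integral>\<^sup>+s. ennreal (indicator {a..b} s * V (x + B s \<omega>)) \<partial>lborel) = ennreal (integral {a..b} (\<lambda>s. V (x + B s \<omega>)))"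
  proof (rule nn_integral_has_integral_lborel)
    show "(\<lambda>s. indicator {a..b} s * V (x + B s \<omega>)) \<in> borel_measurable borel"
      using \<omega> by measurable
    have "((\<lambda>s. V (x + B s \<omega>)) has_integral integral {a..b} (\<lambda>s. V (x + B s \<omega>))) {a..b}"
      using a by (intro integrable_integral integrable_continuous_real continuous_along_path V) auto
    then show "((\<lambda>s. indicator {a..b} s * V (x + B s \<omega>)) has_integral integral {a..b} (\<lambda>s. V (x + B s \<omega>))) UNIV"
      by (subst (asm) has_integral_restrict_UNIV[symmetric]) (simp add: indicator_def of_bool_def if_distrib[of "\<lambda>c. c * _"] cong: if_cong)
  qed (use V in auto)
  then show ?thesis
    by (simp add: ennreal_mult' V(2) ennreal_indicator mult_ac)
qed

lemma kac_continuous: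
  fixes V :: "'a \<Rightarrow> real"
  assumes V: "continuous_on UNIV V" "\<And>z. 0 \<le> V z" and \<omega>: "\<omega> \<in> space M"
  shows "kac V t x \<omega> = ennreal (exp (- integral {0..t} (\<lambda>s. V (x + B s \<omega>))))"
  unfolding kac_def using assms
  by (subst nn_integral_continuous_path) (auto intro!: exp_minus_ennreal Henstock_Kurzweil_Integration.integral_nonneg integrable_continuous_real continuous_along_path)

lemma weight_product_tendsto:
  fixes V :: "'a \<Rightarrow> real"
  assumes V: "continuous_on UNIV V" and "0 \<le> a" "0 < t"
  shows "(\<lambda>N. \<Prod>k\<le>Suc N. weight V (t / real (Suc N)) (x + B (a + real k * (t / real (Suc N))) \<omega>))
     \<longlonglongrightarrow> ennreal (exp (- integral {a..a + t} (\<lambda>s. V (x + B s \<omega>))))"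
proof -
  have "(\<Prod>k\<le>m. weight V h (x + B (a + real k * h) \<omega>)) = ennreal (exp (- (h * (\<Sum>k\<le>m. V (x + B (a + real k * h) \<omega>)))))" for h m
    unfolding weight_def by (simp add: prod_ennreal exp_sum[symmetric] sum_distrib_left sum_negf)
  moreover have "(\<lambda>N. ennreal (exp (- (t / real (Suc N) * (\<Sum>k\<le>Suc N. V (x + B (a + real k * (t / real (Suc N))) \<omega>))))))
     \<longlonglongrightarrow> ennreal (exp (- integral {a..a + t} (\<lambda>s. V (x + B s \<omega>))))"
    using assms by (intro tendsto_ennrealI tendsto_exp tendsto_minus Riemann_sum_tendsto continuous_along_path) auto
  ultimately show ?thesis by (simp only:)
qed

end

section \<open>Semigroup law and symmetry\<close>

lemma prod_ennreal_le_1: "(\<And>k. k \<in> A \<Longrightarrow> F k \<le> (1::ennreal)) \<Longrightarrow> prod F A \<le> 1"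
  by (induction A rule: infinite_finite_induct) (auto intro: mult_le_one)

lemma nn_integral_bounded_convergence:
  fixes u :: "nat \<Rightarrow> 'b \<Rightarrow> ennreal"
  assumes "prob_space M" and [measurable]: "\<And>i. u i \<in> borel_measurable M" "u' \<in> borel_measurable M"
    and "\<And>i \<omega>. \<omega> \<in> space M \<Longrightarrow> u i \<omega> \<le> ennreal K" and "AE \<omega> in M. (\<lambda>i. u i \<omega>) \<longlonglongrightarrow> u' \<omega>"
  shows "(\<lambda>i. \<integral>\<^sup>+\<omega>. u i \<omega> \<partial>M) \<longlonglongrightarrow> (\<integral>\<^sup>+\<omega>. u' \<omega> \<partial>M)"
  using assms(4,5) prob_space.emeasure_space_1[OF assms(1)]
  by (intro nn_integral_dominated_convergence[where w="\<lambda>_. ennreal K"]) auto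

lemma tendsto_mult_bounded_ennreal:
  fixes f g :: "nat \<Rightarrow> ennreal"
  assumes "f \<longlonglongrightarrow> a" "g \<longlonglongrightarrow> b" "a \<noteq> \<top>" "b \<noteq> \<top>"
  shows "(\<lambda>n. f n * g n) \<longlonglongrightarrow> a * b"
  using assms by (intro tendsto_mult_ennreal) auto

context brownian_paths
begin

lemma weight_le_1: "0 \<le> V z \<Longrightarrow> 0 \<le> h \<Longrightarrow> weight V h z \<le> 1"
  by (simp add: weight_def)

lemma fk_le_const:
  assumes "\<And>z. f z \<le> ennreal K"
  shows "fk V t f x \<le> ennreal K"
proof -
  have "fk V t f x \<le> (\<integral>\<^sup>+\<omega>. 1 * ennreal K \<partial>M)"
    unfolding fk_def by (intro nn_integral_mono mult_mono kac_le_1 assms) auto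
  then show ?thesis by (simp add: emeasure_space_1)
qed

definition trotter :: "('a \<Rightarrow> real) \<Rightarrow> real \<Rightarrow> nat \<Rightarrow> ('a \<Rightarrow> ennreal) \<Rightarrow> 'a \<Rightarrow> ennreal" where
  "trotter V t N f x = weight V (t / real (Suc N)) x * (trotter_step V (t / real (Suc N)) ^^ Suc N) f x"

lemma measurable_trotter [measurable]:
  assumes [measurable]: "V \<in> borel_measurable borel" "f \<in> borel_measurable borel"
  shows "trotter V t N f \<in> borel_measurable borel"
  unfolding trotter_def[abs_def] by measurable

lemma trotter_eq:
  assumes [measurable]: "V \<in> borel_measurable borel" "f \<in> borel_measurable borel" and t: "0 < t"
  shows "trotter V t N f x = (\<integral>\<^sup>+\<omega>. (\<Prod>k\<le>Suc N. weight V (t / real (Suc N)) (x + B (real k * (t / real (Suc N))) \<omega>)) * f (x + B t \<omega>) \<partial>M)"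
proof -
  have *: "real (Suc N) * (t / real (Suc N)) = t" by (simp del: of_nat_Suc)
  show ?thesis
    using discrete_formula[OF assms(1,2), of "t / real (Suc N)" x "Suc N"] t
    unfolding trotter_def * by simp
qed

lemma trotter_le_const:
  assumes [measurable]: "V \<in> borel_measurable borel" "f \<in> borel_measurable borel" and "0 < t" "\<And>z. 0 \<le> V z" "\<And>z. f z \<le> ennreal K"
  shows "trotter V t N f x \<le> ennreal K"
proof -
  have "trotter V t N f x \<le> (\<integral>\<^sup>+\<omega>. 1 * ennreal K \<partial>M)"
    unfolding trotter_eq[OF assms(1-3)] using assms
    by (intro nn_integral_mono mult_mono prod_ennreal_le_1 weight_le_1) auto
  then show ?thesis by (simp add: emeasure_space_1)
qed

lemma trotter_tendsto:
  assumes V: "continuous_on UNIV V" "\<And>z. 0 \<le> V z" and [measurable]: "f \<in> borel_measurable borel"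
    and f: "\<And>z. f z \<le> ennreal K" and t: "0 < t"
  shows "(\<lambda>N. trotter V t N f x) \<longlonglongrightarrow> fk V t f x"
proof -
  let ?P = "\<lambda>N \<omega>. \<Prod>k\<le>Suc N. weight V (t / real (Suc N)) (x + B (real k * (t / real (Suc N))) \<omega>)"
  have [measurable]: "V \<in> borel_measurable borel" using V(1) by (rule borel_measurable_continuous_onI)
  have f_fin: "f z \<noteq> \<top>" for z using f[of z] by (auto simp: top_unique)
  show ?thesis
    unfolding trotter_eq[OF \<open>V \<in> borel_measurable borel\<close> assms(3) t] fk_def
  proof (rule nn_integral_bounded_convergence[OF prob_space_axioms, where K=K])
    fix N \<omega>
    have "?P N \<omega> * f (x + B t \<omega>) \<le> 1 * ennreal K"
      using V t by (intro mult_mono prod_ennreal_le_1 weight_le_1 f) auto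
    then show "?P N \<omega> * f (x + B t \<omega>) \<le> ennreal K" by simp
  next
    show "AE \<omega> in M. (\<lambda>N. ?P N \<omega> * f (x + B t \<omega>)) \<longlonglongrightarrow> kac V t x \<omega> * f (x + B t \<omega>)"
    proof (rule AE_I2)
      fix \<omega> assume "\<omega> \<in> space M"
      then show "(\<lambda>N. ?P N \<omega> * f (x + B t \<omega>)) \<longlonglongrightarrow> kac V t x \<omega> * f (x + B t \<omega>)"
        using weight_product_tendsto[OF V(1), of 0 t x \<omega>] t f_fin
        by (intro tendsto_mult_bounded_ennreal tendsto_const) (simp_all add: kac_continuous[OF V])
    qed
  qed measurable
qed

text \<open>
  Both sides of \<open>discrete_semigroup\<close> converge. On the right, the inner Trotter
  product and the outer weights depend on the same \<open>N\<close>; dominated convergence under the expectation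
  allows both to converge at once.
\<close>

lemma fk_add_continuous:
  assumes V: "continuous_on UNIV V" "\<And>z. 0 \<le> V z" and [measurable]: "f \<in> borel_measurable borel"
    and f: "\<And>z. f z \<le> ennreal K" and t: "0 < t" and s: "0 < s"
  shows "fk V (s + t) f x = fk V s (fk V t f) x"
proof -
  have [measurable]: "V \<in> borel_measurable borel" using V(1) by (rule borel_measurable_continuous_onI)
  have f_fin: "f z \<noteq> \<top>" for z using f[of z] by (auto simp: top_unique)
  have fk_fin: "fk V t f z \<noteq> \<top>" for z using fk_le_const[of f K V t z, OF f] by (auto simp: top_unique)
  define P where "P N \<omega> = (\<Prod>k\<le>Suc N. weight V (s / real (Suc N)) (x + B (real k * (s / real (Suc N))) \<omega>))" for N \<omega>
  define Q where "Q N \<omega> = (\<Prod>k\<le>Suc N. weight V (t / real (Suc N)) (x + B (s + real k * (t / real (Suc N))) \<omega>))" for N \<omega>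
  have [measurable]: "P N \<in> borel_measurable M" "Q N \<in> borel_measurable M" for N
    unfolding P_def[abs_def] Q_def[abs_def] by measurable
  have P1: "P N \<omega> \<le> 1" for N \<omega> unfolding P_def using V s by (intro prod_ennreal_le_1 weight_le_1) auto
  have Q1: "Q N \<omega> \<le> 1" for N \<omega> unfolding Q_def using V t by (intro prod_ennreal_le_1 weight_le_1) auto
  have P_lim: "(\<lambda>N. P N \<omega>) \<longlonglongrightarrow> kac V s x \<omega>" if "\<omega> \<in> space M" for \<omega>
    using weight_product_tendsto[OF V(1), of 0 s x \<omega>] s that by (simp add: P_def kac_continuous[OF V])
  have PQ_lim: "(\<lambda>N. P N \<omega> * Q N \<omega>) \<longlonglongrightarrow> kac V (s + t) x \<omega>" if \<omega>: "\<omega> \<in> space M" for \<omega>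
  proof -
    let ?v = "\<lambda>r. V (x + B r \<omega>)"
    have "(\<lambda>N. P N \<omega> * Q N \<omega>) \<longlonglongrightarrow> ennreal (exp (- integral {0..s} ?v)) * ennreal (exp (- integral {s..s+t} ?v))"
      unfolding P_def Q_def
      using weight_product_tendsto[OF V(1), of 0 s x \<omega>] weight_product_tendsto[OF V(1), of s t x \<omega>] s t
      by (intro tendsto_mult_bounded_ennreal) auto
    also have "ennreal (exp (- integral {0..s} ?v)) * ennreal (exp (- integral {s..s+t} ?v)) = kac V (s + t) x \<omega>"
    proof -
      have "integral {0..s} ?v + integral {s..s+t} ?v = integral {0..s+t} ?v"
        using s t by (intro Henstock_Kurzweil_Integration.integral_combine integrable_continuous_real continuous_along_path V) auto
      then show ?thesis
        by (simp add: kac_continuous[OF V \<omega>] ennreal_mult[symmetric] exp_add[symmetric])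
    qed
    finally show ?thesis .
  qed
  have *: "real (Suc N) * (u / real (Suc N)) = u" for u N by (simp del: of_nat_Suc)
  have "(\<integral>\<^sup>+\<omega>. P N \<omega> * Q N \<omega> * f (x + B (s + t) \<omega>) \<partial>M) = (\<integral>\<^sup>+\<omega>. P N \<omega> * trotter V t N f (x + B s \<omega>) \<partial>M)" for N
    using discrete_semigroup[of V f "s / real (Suc N)" "t / real (Suc N)" s "Suc N" x "Suc N"] s t
    unfolding * P_def Q_def trotter_def by simp
  moreover have "(\<lambda>N. \<integral>\<^sup>+\<omega>. P N \<omega> * Q N \<omega> * f (x + B (s + t) \<omega>) \<partial>M) \<longlonglongrightarrow> fk V (s + t) f x"
    unfolding fk_def
  proof (rule nn_integral_bounded_convergence[OF prob_space_axioms, where K=K])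
    fix N \<omega>
    have "P N \<omega> * Q N \<omega> * f (x + B (s + t) \<omega>) \<le> 1 * 1 * ennreal K"
      by (intro mult_mono P1 Q1 f) auto
    then show "P N \<omega> * Q N \<omega> * f (x + B (s + t) \<omega>) \<le> ennreal K" by simp
  next
    show "AE \<omega> in M. (\<lambda>N. P N \<omega> * Q N \<omega> * f (x + B (s + t) \<omega>)) \<longlonglongrightarrow> kac V (s + t) x \<omega> * f (x + B (s + t) \<omega>)"
      using PQ_lim f_fin by (intro AE_I2 tendsto_mult_bounded_ennreal tendsto_const) (simp_all add: kac_continuous[OF V])
  qed measurable
  moreover have "(\<lambda>N. \<integral>\<^sup>+\<omega>. P N \<omega> * trotter V t N f (x + B s \<omega>) \<partial>M) \<longlonglongrightarrow> fk V s (fk V t f) x"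
    unfolding fk_def[of V s]
  proof (rule nn_integral_bounded_convergence[OF prob_space_axioms, where K=K])
    fix N \<omega>
    have "P N \<omega> * trotter V t N f (x + B s \<omega>) \<le> 1 * ennreal K"
      using V f t by (intro mult_mono P1 trotter_le_const) auto
    then show "P N \<omega> * trotter V t N f (x + B s \<omega>) \<le> ennreal K" by simp
  next
    show "AE \<omega> in M. (\<lambda>N. P N \<omega> * trotter V t N f (x + B s \<omega>)) \<longlonglongrightarrow> kac V s x \<omega> * fk V t f (x + B s \<omega>)"
      using P_lim fk_fin trotter_tendsto[OF V assms(3) f t]
      by (intro AE_I2 tendsto_mult_bounded_ennreal) (simp_all add: kac_continuous[OF V])
  qed measurable
  ultimately show ?thesis
    by (metis (no_types, lifting) LIMSEQ_unique ext)
qed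

lemma trotter_symmetric:
  assumes [measurable]: "V \<in> borel_measurable borel" "f \<in> borel_measurable borel" "g \<in> borel_measurable borel"
  shows "(\<integral>\<^sup>+x. g x * trotter V t N f x \<partial>lborel) = (\<integral>\<^sup>+x. trotter V t N g x * f x \<partial>lborel)"
  unfolding trotter_def by (rule trotter_power_symmetric) measurable

text \<open>
  A continuous majorant \<open>c\<close> is bounded along each path on \<open>[0, t]\<close>, which gives a dominating
  constant although the potentials need not be bounded.
\<close>

lemma kac_tendsto:
  assumes [measurable]: "\<And>k. V k \<in> borel_measurable borel" "W \<in> borel_measurable borel"
    and c: "continuous_on UNIV c" and V: "\<And>k z. V k z \<le> c z" and lim: "AE z in lborel. (\<lambda>k. V k z) \<longlonglongrightarrow> W z"
  shows "AE \<omega> in M. (\<lambda>k. kac (V k) t x \<omega>) \<longlonglongrightarrow> kac W t x \<omega>"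
  using AE_occupation[OF lim, of x] AE_space
proof eventually_elim
  case (elim \<omega>)
  note \<omega>[measurable] = elim(2)
  have "bounded ((\<lambda>s. c (x + B s \<omega>)) ` {0..t})"
    by (intro compact_imp_bounded compact_continuous_image continuous_along_path c) auto
  then obtain K where "\<forall>y\<in>(\<lambda>s. c (x + B s \<omega>)) ` {0..t}. norm y \<le> K"
    unfolding bounded_iff by blast
  then have K: "\<bar>c (x + B s \<omega>)\<bar> \<le> K" if "s \<in> {0..t}" for s
    using that by (metis image_eqI real_norm_def)
  have dom: "(\<integral>\<^sup>+s. ennreal K * indicator {0..t} s \<partial>lborel) < \<infinity>"
    by (simp add: nn_integral_cmult ennreal_mult_less_top emeasure_lborel_Icc_eq)
  have le: "ennreal (U (x + B s \<omega>)) * indicator {0..t} s \<le> ennreal K * indicator {0..t} s" if "\<And>z. U z \<le> c z" for U s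
    using K[of s] that[of "x + B s \<omega>"] by (auto simp: indicator_def intro!: ennreal_leI)
  have conv: "AE s in lborel. (\<lambda>k. ennreal (V k (x + B s \<omega>)) * indicator {0..t} s) \<longlonglongrightarrow> ennreal (W (x + B s \<omega>)) * indicator {0..t} s"
    using elim(1) AE_lborel_singleton[of 0]
  proof eventually_elim
    case (elim s)
    then show ?case by (auto simp: indicator_def intro!: tendsto_ennrealI)
  qed
  have "(\<lambda>k. \<integral>\<^sup>+s\<in>{0..t}. ennreal (V k (x + B s \<omega>)) \<partial>lborel) \<longlonglongrightarrow> (\<integral>\<^sup>+s\<in>{0..t}. ennreal (W (x + B s \<omega>)) \<partial>lborel)"
    using conv dom by (intro nn_integral_dominated_convergence[where w="\<lambda>s. ennreal K * indicator {0..t} s"]) (auto intro!: le V)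
  moreover have "(\<integral>\<^sup>+s\<in>{0..t}. ennreal (W (x + B s \<omega>)) \<partial>lborel) < \<infinity>"
  proof -
    have "(\<integral>\<^sup>+s\<in>{0..t}. ennreal (W (x + B s \<omega>)) \<partial>lborel) \<le> (\<integral>\<^sup>+s. ennreal K * indicator {0..t} s \<partial>lborel)"
    proof (rule nn_integral_mono_AE)
      show "AE s in lborel. ennreal (W (x + B s \<omega>)) * indicator {0..t} s \<le> ennreal K * indicator {0..t} s"
        using conv by eventually_elim (rule LIMSEQ_le_const2, auto intro: le V)
    qed
    with dom show ?thesis by (rule le_less_trans[rotated])
  qed
  ultimately show ?case unfolding kac_def by (rule exp_minus_tendsto)
qed

lemma fk_tendsto:
  assumes [measurable]: "\<And>k. V k \<in> borel_measurable borel" "W \<in> borel_measurable borel"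
    "\<And>k. f k \<in> borel_measurable borel" "g \<in> borel_measurable borel"
    and c: "continuous_on UNIV c" and V: "\<And>k z. V k z \<le> c z" and lim: "AE z in lborel. (\<lambda>k. V k z) \<longlonglongrightarrow> W z"
    and f: "\<And>k z. f k z \<le> ennreal K" "\<And>z. (\<lambda>k. f k z) \<longlonglongrightarrow> g z"
  shows "(\<lambda>k. fk (V k) t (f k) x) \<longlonglongrightarrow> fk W t g x"
  unfolding fk_def
proof (rule nn_integral_bounded_convergence[OF prob_space_axioms, where K=K])
  fix k \<omega>
  have "kac (V k) t x \<omega> * f k (x + B t \<omega>) \<le> 1 * ennreal K"
    by (intro mult_mono kac_le_1 f) auto
  then show "kac (V k) t x \<omega> * f k (x + B t \<omega>) \<le> ennreal K" by simp
next
  have g: "g z \<le> ennreal K" for z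
    using f by (intro LIMSEQ_le_const2[OF f(2)]) auto
  have "kac W t x \<omega> \<noteq> \<top>" for \<omega> using kac_le_1[of W t x \<omega>] by (auto simp: top_unique)
  moreover have "g z \<noteq> \<top>" for z using g[of z] by (auto simp: top_unique)
  ultimately have "(\<lambda>k. kac (V k) t x \<omega>) \<longlonglongrightarrow> kac W t x \<omega> \<longrightarrow>
      (\<lambda>k. kac (V k) t x \<omega> * f k (x + B t \<omega>)) \<longlonglongrightarrow> kac W t x \<omega> * g (x + B t \<omega>)" for \<omega>
    by (intro impI tendsto_mult_bounded_ennreal f) auto
  with kac_tendsto[OF assms(1,2) c V lim, of t x]
  show "AE \<omega> in M. (\<lambda>k. kac (V k) t x \<omega> * f k (x + B t \<omega>)) \<longlonglongrightarrow> kac W t x \<omega> * g (x + B t \<omega>)"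
    by (rule AE_mp[OF _ AE_I2])
qed measurable

end

text \<open>
  Lebesgue measurable functions are almost everywhere limits of continuous ones. Clipping
  the approximants between \<open>0\<close> and \<open>c\<close> makes them potentials to which \<open>kac_tendsto\<close> applies.
\<close>

lemma continuous_approximation:
  fixes V c :: "'a::euclidean_space \<Rightarrow> real"
  assumes "V \<in> borel_measurable borel" "continuous_on UNIV c" "\<And>z. 0 \<le> V z" "\<And>z. V z \<le> c z"
  obtains W where "\<And>k. continuous_on UNIV (W k)" "\<And>k z. 0 \<le> W k z" "\<And>k z. W k z \<le> c z"
    "AE z in lborel. (\<lambda>k. W k z) \<longlonglongrightarrow> V z"
proof -
  have "V \<in> borel_measurable lebesgue" using assms(1) by (intro measurable_completion) simp
  then have "V measurable_on UNIV"
    by (rule lebesgue_measurable_imp_measurable_on_real) simp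
  then obtain N g where N: "negligible N" and g: "\<And>n. continuous_on UNIV (g n)" "\<And>x. x \<notin> N \<Longrightarrow> (\<lambda>n. g n x) \<longlonglongrightarrow> V x"
    unfolding measurable_on_def by auto
  define W where "W k z = max 0 (min (g k z) (c z))" for k z
  show ?thesis
  proof
    show "continuous_on UNIV (W k)" for k unfolding W_def by (intro continuous_intros g assms)
    show "0 \<le> W k z" "W k z \<le> c z" for k z
      using order_trans[OF assms(3,4), of z] by (auto simp: W_def)
    have "N \<in> null_sets lebesgue" using N by (simp add: negligible_iff_null_sets)
    then have "AE z in lebesgue. z \<notin> N" by (rule AE_not_in)
    then have "AE z in lborel. z \<notin> N" by (simp add: AE_completion_iff)
    then show "AE z in lborel. (\<lambda>k. W k z) \<longlonglongrightarrow> V z"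
    proof eventually_elim
      case (elim z)
      have "(\<lambda>k. W k z) \<longlonglongrightarrow> max 0 (min (V z) (c z))"
        unfolding W_def by (intro tendsto_max tendsto_min g elim tendsto_const)
      then show ?case using assms(3,4)[of z] by simp
    qed
  qed
qed

context brownian_paths
begin

lemma fk_add:
  fixes V c :: "'a \<Rightarrow> real"
  assumes V: "V \<in> borel_measurable borel" "\<And>z. 0 \<le> V z" and c: "continuous_on UNIV c" "\<And>z. V z \<le> c z"
    and f: "f \<in> borel_measurable borel" "\<And>z. f z \<le> ennreal K" and st: "0 < s" "0 < t"
  shows "fk V (s + t) f x = fk V s (fk V t f) x"
proof -
  obtain W where W: "\<And>k. continuous_on UNIV (W k)" "\<And>k z. 0 \<le> W k z" "\<And>k z. W k z \<le> c z"
    "AE z in lborel. (\<lambda>k. W k z) \<longlonglongrightarrow> V z"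
    using continuous_approximation[OF V(1) c(1) V(2) c(2)] by blast
  have [measurable]: "W k \<in> borel_measurable borel" for k using W(1) by (rule borel_measurable_continuous_onI)
  note [measurable] = V(1) f(1)
  have "(\<lambda>k. fk (W k) (s + t) f x) \<longlonglongrightarrow> fk V (s + t) f x"
    by (rule fk_tendsto[OF _ _ _ _ c(1) W(3,4) f(2)]) auto
  moreover have "(\<lambda>k. fk (W k) s (fk (W k) t f) x) \<longlonglongrightarrow> fk V s (fk V t f) x"
    by (rule fk_tendsto[OF _ _ _ _ c(1) W(3,4) fk_le_const[OF f(2)]])
       (auto intro!: fk_tendsto[OF _ _ _ _ c(1) W(3,4) f(2)])
  moreover have "fk (W k) (s + t) f x = fk (W k) s (fk (W k) t f) x" for k
    by (rule fk_add_continuous[OF W(1,2) f st(2,1)])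
  ultimately show ?thesis by (simp add: LIMSEQ_unique)
qed

text \<open>
  Both passages to the limit use Fatou's lemma on the left, where no integrable majorant is at hand,
  and dominated convergence with majorant \<open>f\<close> on the right. Hence an inequality, which is all that
  is needed to bound the \<open>L\<^sup>1\<close> norm of \<open>fk V t f\<close> by means of \<open>fk V t 1\<close>.
\<close>

lemma fk_symmetric_le:
  fixes V c :: "'a \<Rightarrow> real"
  assumes V: "V \<in> borel_measurable borel" "\<And>z. 0 \<le> V z" and c: "continuous_on UNIV c" "\<And>z. V z \<le> c z"
    and f: "f \<in> borel_measurable borel" "\<And>z. f z \<le> ennreal K" "(\<integral>\<^sup>+x. f x \<partial>lborel) < \<infinity>" and t: "0 < t"
  shows "(\<integral>\<^sup>+x. fk V t f x \<partial>lborel) \<le> (\<integral>\<^sup>+x. fk V t (\<lambda>_. 1) x * f x \<partial>lborel)"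
proof -
  obtain W where W: "\<And>k. continuous_on UNIV (W k)" "\<And>k z. 0 \<le> W k z" "\<And>k z. W k z \<le> c z"
    "AE z in lborel. (\<lambda>k. W k z) \<longlonglongrightarrow> V z"
    using continuous_approximation[OF V(1) c(1) V(2) c(2)] by blast
  have [measurable]: "W k \<in> borel_measurable borel" for k using W(1) by (rule borel_measurable_continuous_onI)
  note [measurable] = V(1) f(1)
  have f_fin: "f z \<noteq> \<top>" for z using f(2)[of z] by (auto simp: top_unique)
  have fatou: "(\<integral>\<^sup>+x. F' x \<partial>lborel) \<le> (\<integral>\<^sup>+x. G' x * f x \<partial>lborel)"
    if [measurable]: "\<And>n. F n \<in> borel_measurable borel" "F' \<in> borel_measurable borel" "\<And>n. G n \<in> borel_measurable borel" "G' \<in> borel_measurable borel"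
    and lim: "\<And>x. (\<lambda>n. F n x) \<longlonglongrightarrow> F' x" "\<And>x. (\<lambda>n. G n x) \<longlonglongrightarrow> G' x"
    and G1: "\<And>n x. G n x \<le> 1" and le: "\<And>n. (\<integral>\<^sup>+x. F n x \<partial>lborel) \<le> (\<integral>\<^sup>+x. G n x * f x \<partial>lborel)"
    for F G :: "nat \<Rightarrow> 'a \<Rightarrow> ennreal" and F' G'
  proof -
    have G'1: "G' x \<le> 1" for x by (rule LIMSEQ_le_const2[OF lim(2)]) (auto intro: G1)
    have G'_fin: "G' x \<noteq> \<top>" for x using G'1[of x] by (auto simp: top_unique)
    have "(\<integral>\<^sup>+x. F' x \<partial>lborel) = (\<integral>\<^sup>+x. liminf (\<lambda>n. F n x) \<partial>lborel)"
      by (intro nn_integral_cong lim_imp_Liminf[symmetric] trivial_limit_sequentially lim(1))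
    also have "\<dots> \<le> liminf (\<lambda>n. \<integral>\<^sup>+x. F n x \<partial>lborel)"
      by (rule nn_integral_liminf) auto
    also have "\<dots> \<le> liminf (\<lambda>n. \<integral>\<^sup>+x. G n x * f x \<partial>lborel)"
      by (intro Liminf_mono always_eventually allI le)
    also have "\<dots> = (\<integral>\<^sup>+x. G' x * f x \<partial>lborel)"
    proof (intro lim_imp_Liminf trivial_limit_sequentially nn_integral_dominated_convergence[where w=f])
      show "AE x in lborel. G n x * f x \<le> f x" for n
        using mult_right_mono[OF G1, of "f _"] by auto
      show "AE x in lborel. (\<lambda>n. G n x * f x) \<longlonglongrightarrow> G' x * f x"
        by (intro AE_I2 tendsto_mult_bounded_ennreal lim tendsto_const G'_fin f_fin)
    qed (use f in auto)
    finally show ?thesis .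
  qed
  have one: "(\<lambda>_. 1) \<in> borel_measurable borel" "\<And>z. (1::ennreal) \<le> ennreal 1" by auto
  have cont: "(\<integral>\<^sup>+x. fk (W k) t f x \<partial>lborel) \<le> (\<integral>\<^sup>+x. fk (W k) t (\<lambda>_. 1) x * f x \<partial>lborel)" for k
  proof (rule fatou)
    show "(\<lambda>n. trotter (W k) t n f x) \<longlonglongrightarrow> fk (W k) t f x" for x
      by (rule trotter_tendsto[OF W(1,2) f(1,2) t])
    show "(\<lambda>n. trotter (W k) t n (\<lambda>_. 1) x) \<longlonglongrightarrow> fk (W k) t (\<lambda>_. 1) x" for x
      by (rule trotter_tendsto[OF W(1,2) one t])
    show "trotter (W k) t n (\<lambda>_. 1) x \<le> 1" for n x
      using trotter_le_const[of "W k" "\<lambda>_. 1" t 1 n x] W t by simp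
    show "(\<integral>\<^sup>+x. trotter (W k) t n f x \<partial>lborel) \<le> (\<integral>\<^sup>+x. trotter (W k) t n (\<lambda>_. 1) x * f x \<partial>lborel)" for n
      using trotter_symmetric[of "W k" f "\<lambda>_. 1" t n] by simp
  qed auto
  show ?thesis
  proof (rule fatou)
    show "(\<lambda>k. fk (W k) t f x) \<longlonglongrightarrow> fk V t f x" for x
      by (rule fk_tendsto[OF _ _ _ _ c(1) W(3,4) f(2)]) auto
    show "(\<lambda>k. fk (W k) t (\<lambda>_. 1) x) \<longlonglongrightarrow> fk V t (\<lambda>_. 1) x" for x
      by (rule fk_tendsto[OF _ _ _ _ c(1) W(3,4) one(2)]) auto
    show "fk (W k) t (\<lambda>_. 1) x \<le> 1" for k x
      using fk_le_const[of "\<lambda>_. 1" 1] by simp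
  qed (auto intro: cont)
qed

lemma fk_0 [simp]: "fk V 0 f x = f x"
proof -
  have "(\<integral>\<^sup>+s\<in>{0..0::real}. g s \<partial>lborel) = 0" for g :: "real \<Rightarrow> ennreal"
    by (subst nn_integral_cong_AE[where v="\<lambda>_. 0"]) (use AE_lborel_singleton[of "0::real"] in eventually_elim, auto)
  then show ?thesis by (simp add: fk_def kac_def emeasure_space_1)
qed

end

section \<open>One-variable estimates\<close>

text \<open>
  The radii \<open>rho\<close> and \<open>sigma\<close> are suprema that need not be attained and may be infinite. A Gaussian
  bound for every admissible radius passes to the supremum by continuity.
\<close>

lemma exp_minus_Sup_bound:
  assumes k: "0 < k" and C: "0 \<le> C" and ne: "0 \<le> q" "P q"
    and bound: "\<And>r. 0 \<le> r \<Longrightarrow> P r \<Longrightarrow> p \<le> ennreal (C * exp (- (r\<^sup>2 / k)))"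
  shows "p \<le> ennreal C * exp_minus ((Sup {ennreal r | r. 0 \<le> r \<and> P r})\<^sup>2 / ennreal k)"
proof (cases "Sup {ennreal r | r. 0 \<le> r \<and> P r}")
  case (real R)
  have "p \<le> ennreal (C * exp (- ((max 0 (R - 1 / real (Suc n)))\<^sup>2 / k)))" for n
  proof (cases "R - 1 / real (Suc n) \<le> 0")
    case True
    have "p \<le> ennreal (C * exp (- (q\<^sup>2 / k)))" by (rule bound) fact+
    also have "\<dots> \<le> ennreal C"
      using k C by (intro ennreal_leI mult_left_le) auto
    finally show ?thesis using True by (simp add: max_def)
  next
    case False
    moreover have "0 < 1 / real (Suc n)" by simp
    ultimately have "0 < R" by linarith
    then have "ennreal (R - 1 / real (Suc n)) < Sup {ennreal r | r. 0 \<le> r \<and> P r}"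
      unfolding real(2) by (intro ennreal_lessI) auto
    then obtain r where r: "0 \<le> r" "P r" "ennreal (R - 1 / real (Suc n)) < ennreal r"
      unfolding less_Sup_iff by auto
    then have "R - 1 / real (Suc n) \<le> r" using False by (simp add: ennreal_less_iff del: of_nat_Suc)
    then have "(max 0 (R - 1 / real (Suc n)))\<^sup>2 \<le> r\<^sup>2"
      using r by (intro power_mono) auto
    then have "exp (- (r\<^sup>2 / k)) \<le> exp (- ((max 0 (R - 1 / real (Suc n)))\<^sup>2 / k))"
      using k by (simp add: divide_right_mono)
    then show ?thesis
      using C by (intro order_trans[OF bound[OF r(1,2)]] ennreal_leI mult_left_mono) auto
  qed
  moreover have "(\<lambda>n. ennreal (C * exp (- ((max 0 (R - 1 / real (Suc n)))\<^sup>2 / k)))) \<longlonglongrightarrow> ennreal (C * exp (- ((max 0 (R - 0))\<^sup>2 / k)))"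
    using k by (intro tendsto_ennrealI tendsto_mult tendsto_exp tendsto_minus tendsto_divide tendsto_power tendsto_max tendsto_diff tendsto_const LIMSEQ_Suc[OF lim_1_over_n]) auto
  ultimately have "p \<le> ennreal (C * exp (- ((max 0 (R - 0))\<^sup>2 / k)))"
    by (intro LIMSEQ_le_const) auto
  also have "\<dots> = ennreal C * exp_minus ((ennreal R)\<^sup>2 / ennreal k)"
    using real(1) k C by (simp add: ennreal_power divide_ennreal exp_minus_ennreal ennreal_mult)
  finally show ?thesis using real(2) by simp
next
  case top
  have "p \<le> ennreal (C * exp (- ((real n)\<^sup>2 / k)))" for n
  proof -
    have "ennreal (real n) < Sup {ennreal r | r. 0 \<le> r \<and> P r}"
      unfolding top by simp
    then obtain r where r: "0 \<le> r" "P r" "ennreal (real n) < ennreal r"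
      unfolding less_Sup_iff by auto
    then have "real n \<le> r" by (simp add: ennreal_less_iff del: ennreal_of_nat_eq_real_of_nat)
    then have "(real n)\<^sup>2 \<le> r\<^sup>2"
      by (intro power_mono) auto
    then have "exp (- (r\<^sup>2 / k)) \<le> exp (- ((real n)\<^sup>2 / k))"
      using k by (simp add: divide_right_mono)
    then show ?thesis
      using C by (intro order_trans[OF bound[OF r(1,2)]] ennreal_leI mult_left_mono) auto
  qed
  moreover have "(\<lambda>n. C * exp (- ((real n)\<^sup>2 / k))) \<longlonglongrightarrow> C * 0"
  proof (intro tendsto_mult tendsto_const filterlim_compose[OF exp_at_bot])
    have "filterlim (\<lambda>n. (real n)\<^sup>2) at_top sequentially"
      by (intro filterlim_pow_at_top filterlim_real_sequentially) auto
    then have "filterlim (\<lambda>n. (1 / k) * (real n)\<^sup>2) at_top sequentially"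
      using k by (intro filterlim_tendsto_pos_mult_at_top[OF tendsto_const]) auto
    then show "filterlim (\<lambda>n. - ((real n)\<^sup>2 / k)) at_bot sequentially"
      by (simp add: filterlim_uminus_at_bot)
  qed
  from tendsto_ennrealI[OF this] have "(\<lambda>n. ennreal (C * exp (- ((real n)\<^sup>2 / k)))) \<longlonglongrightarrow> 0" by simp
  ultimately have "p \<le> 0" by (intro LIMSEQ_le_const) auto
  then show ?thesis by simp
qed

lemma measurable_antimono_interval:
  fixes F :: "real \<Rightarrow> ennreal"
  assumes "\<And>s t. a \<le> s \<Longrightarrow> s \<le> t \<Longrightarrow> F t \<le> F s" "\<And>s. F s \<le> 1"
  shows "(\<lambda>s. F s * indicator {a..} s) \<in> borel_measurable borel"
proof -
  define f where "f s = - enn2real (F (max a s))" for s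
  have fin: "F s < \<top>" for s using assms(2)[of s] by (rule le_less_trans) simp
  have "mono f"
    unfolding f_def by (intro monoI le_imp_neg_le enn2real_mono assms fin) auto
  then have [measurable]: "f \<in> borel_measurable borel" by (rule borel_measurable_mono)
  have "(\<lambda>s. F s * indicator {a..} s) = (\<lambda>s. ennreal (- f s) * indicator {a..} s)"
    using fin by (auto simp: f_def indicator_def fun_eq_iff max_def)
  also have "\<dots> \<in> borel_measurable borel" by measurable
  finally show ?thesis .
qed

text \<open>The layer cake formula for \<open>(w / v) powr a\<close>, cut off at \<open>1\<close>.\<close>

lemma powr_le_layers:
  assumes v: "0 < v" and w: "0 \<le> w" and a: "0 < a"
  shows "ennreal (w powr a) \<le> ennreal (v powr a) *
    (1 + (\<integral>\<^sup>+u\<in>{1..}. ennreal (a * u powr (a - 1)) * (if u * v < w then 1 else 0) \<partial>lborel))"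
proof (cases "v < w")
  case True
  define q where "q = w / v"
  have q: "1 < q" using True v by (simp add: q_def)
  have "ennreal (q powr a - 1) = ennreal (q powr a - 1 powr a)" by simp
  also have "\<dots> = (\<integral>\<^sup>+u. ennreal (a * u powr (a - 1)) * indicator {1..q} u \<partial>lborel)"
    using q a by (intro nn_integral_FTC_Icc[symmetric]) (auto intro!: derivative_eq_intros)
  also have "\<dots> = (\<integral>\<^sup>+u\<in>{1..}. ennreal (a * u powr (a - 1)) * (if u * v < w then 1 else 0) \<partial>lborel)"
  proof (rule nn_integral_cong_AE)
    show "AE u in lborel. ennreal (a * u powr (a - 1)) * indicator {1..q} u = ennreal (a * u powr (a - 1)) * (if u * v < w then 1 else 0) * indicator {1..} u"
      using AE_lborel_singleton[of q]
    proof eventually_elim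
      case (elim u)
      then have "u \<le> q \<longleftrightarrow> u * v < w" using v by (auto simp: q_def field_simps)
      then show ?case by (auto simp: indicator_def)
    qed
  qed
  finally have "(\<integral>\<^sup>+u\<in>{1..}. ennreal (a * u powr (a - 1)) * (if u * v < w then 1 else 0) \<partial>lborel) = ennreal (q powr a - 1)" ..
  moreover have "1 + ennreal (q powr a - 1) = ennreal (q powr a)"
    using q a by (subst ennreal_1[symmetric], subst ennreal_plus[symmetric]) (auto intro: ge_one_powr_ge_zero)
  ultimately have *: "1 + (\<integral>\<^sup>+u\<in>{1..}. ennreal (a * u powr (a - 1)) * (if u * v < w then 1 else 0) \<partial>lborel) = ennreal (q powr a)"
    by (simp only:)
  have "w powr a = v powr a * q powr a"
    using v w by (simp add: q_def powr_divide)
  then show ?thesis unfolding * by (simp add: ennreal_mult)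
next
  case False
  then have "ennreal (w powr a) \<le> ennreal (v powr a) * 1"
    using w a by (auto intro!: ennreal_leI powr_mono2)
  also have "\<dots> \<le> ennreal (v powr a) * (1 + (\<integral>\<^sup>+u\<in>{1..}. ennreal (a * u powr (a - 1)) * (if u * v < w then 1 else 0) \<partial>lborel))"
    by (intro mult_left_mono) auto
  finally show ?thesis .
qed

text \<open>
  If \<open>w = v / q\<close> with \<open>1 \<le> q \<le> v\<close>, then \<open>exp (- t w) = exp (- t v / q)\<close>, and the integral runs over the derivative of
  \<open>s \<mapsto> exp (- t v / s)\<close> from \<open>1\<close> to \<open>q\<close>. The layers stop at \<open>s = v\<close>, as does the integral
  in the definition of \<open>I\<close>; values \<open>w < 1\<close> are covered by the middle term.
\<close>

lemma exp_le_layers: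
  assumes t: "0 < t" and v: "1 \<le> v" and w: "0 \<le> w"
  shows "ennreal (exp (- t * w)) \<le> ennreal (exp (- t * v)) + (if w < 1 then 1 else 0) +
    (\<integral>\<^sup>+s\<in>{1..v}. ennreal (t * v / s\<^sup>2 * exp (- t * v / s)) * (if w < v / s then 1 else 0) \<partial>lborel)"
proof -
  consider "w < 1" | "v \<le> w" | "1 \<le> w" "w < v" by linarith
  then show ?thesis
  proof cases
    case 1
    have "ennreal (exp (- t * w)) \<le> 1" using t w by simp
    moreover have "1 \<le> X + 1 + Y" for X Y :: ennreal
      by (metis add.assoc add.commute le_iff_add)
    ultimately have "ennreal (exp (- t * w)) \<le> X + 1 + Y" for X Y by (rule order_trans)
    then show ?thesis unfolding if_P[OF 1] .
  next
    case 2
    then have "ennreal (exp (- t * w)) \<le> ennreal (exp (- t * v))" using t by simp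
    then show ?thesis by (auto intro!: add_increasing2)
  next
    case 3
    define q where "q = v / w"
    have q: "1 < q" "q \<le> v" "v / q = w" using 3 v by (auto simp: q_def field_simps)
    have "ennreal (exp (- t * w) - exp (- t * v)) = ennreal (exp (- t * v / q) - exp (- t * v / 1))"
      using q(3) by (simp flip: q(3))
    also have "\<dots> = (\<integral>\<^sup>+s. ennreal (t * v / s\<^sup>2 * exp (- t * v / s)) * indicator {1..q} s \<partial>lborel)"
      using q t v by (intro nn_integral_FTC_Icc[symmetric])
        (auto intro!: derivative_eq_intros simp: power2_eq_square field_simps)
    also have "\<dots> = (\<integral>\<^sup>+s\<in>{1..v}. ennreal (t * v / s\<^sup>2 * exp (- t * v / s)) * (if w < v / s then 1 else 0) \<partial>lborel)"
    proof (rule nn_integral_cong_AE)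
      show "AE s in lborel. ennreal (t * v / s\<^sup>2 * exp (- t * v / s)) * indicator {1..q} s
          = ennreal (t * v / s\<^sup>2 * exp (- t * v / s)) * (if w < v / s then 1 else 0) * indicator {1..v} s"
        using AE_lborel_singleton[of q]
      proof eventually_elim
        case (elim s)
        have "s \<le> q \<longleftrightarrow> w < v / s" if "1 \<le> s"
          using that elim 3 by (auto simp: q_def field_simps)
        then show ?case using q by (auto simp: indicator_def)
      qed
    qed
    finally have *: "(\<integral>\<^sup>+s\<in>{1..v}. ennreal (t * v / s\<^sup>2 * exp (- t * v / s)) * (if w < v / s then 1 else 0) \<partial>lborel)
      = ennreal (exp (- t * w) - exp (- t * v))" ..
    have "exp (- t * v) \<le> exp (- t * w)" using t 3 by simp
    then have "ennreal (exp (- t * w)) = ennreal (exp (- t * v)) + ennreal (exp (- t * w) - exp (- t * v))"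
      by (simp flip: ennreal_plus)
    then show ?thesis unfolding * using 3 by simp
  qed
qed

text \<open>
  Jensen's inequality, proved with the tangent of the exponential at the mean: integrate
  \<open>exp (- A) * (1 + A - t * q s) \<le> exp (- t * q s)\<close> over \<open>[0, t]\<close>, \<open>A\<close> being the integral of \<open>q\<close>. It replaces the
  whole path by its positions at single times, whose laws are Gaussian.
\<close>

lemma exp_minus_integral_le_average:
  fixes q :: "real \<Rightarrow> real"
  assumes t: "0 < t" and [measurable]: "q \<in> borel_measurable borel" and q: "\<And>s. 0 \<le> q s"
  shows "exp_minus (\<integral>\<^sup>+s\<in>{0..t}. ennreal (q s) \<partial>lborel)
    \<le> ennreal (1 / t) * (\<integral>\<^sup>+s\<in>{0..t}. ennreal (exp (- t * q s)) \<partial>lborel)"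
proof (cases "\<integral>\<^sup>+s\<in>{0..t}. ennreal (q s) \<partial>lborel")
  case (real A)
  define X where "X = (\<integral>\<^sup>+s\<in>{0..t}. ennreal (exp (- t * q s)) \<partial>lborel)"
  have len: "(\<integral>\<^sup>+s. indicator {0..t} s \<partial>lborel) = ennreal t" using t by simp
  have tangent: "exp (- A) * (1 + A) \<le> exp (- t * q s) + exp (- A) * t * q s" for s
  proof -
    have "1 + (A - t * q s) \<le> exp (A - t * q s)" by (rule exp_ge_add_one_self)
    then have "exp (- A) * (1 + (A - t * q s)) \<le> exp (- A) * exp (A - t * q s)"
      by (intro mult_left_mono) auto
    also have "\<dots> = exp (- t * q s)" by (simp add: exp_add[symmetric])
    finally show ?thesis by (simp add: algebra_simps)
  qed
  have "ennreal (exp (- A) * (1 + A) * t) = (\<integral>\<^sup>+s. ennreal (exp (- A) * (1 + A)) * indicator {0..t} s \<partial>lborel)"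
    using real(1) t by (simp add: nn_integral_cmult ennreal_mult[symmetric])
  also have "\<dots> \<le> (\<integral>\<^sup>+s. ennreal (exp (- t * q s)) * indicator {0..t} s + ennreal (exp (- A) * t) * (ennreal (q s) * indicator {0..t} s) \<partial>lborel)"
    using tangent t q by (intro nn_integral_mono) (auto simp: indicator_def ennreal_mult[symmetric] ennreal_plus[symmetric] simp del: ennreal_plus intro!: ennreal_leI)
  also have "\<dots> = X + ennreal (exp (- A) * t) * ennreal A"
    unfolding X_def real(2)[symmetric] by (subst nn_integral_add) (auto simp: nn_integral_cmult)
  finally have *: "ennreal (exp (- A) * (1 + A) * t) \<le> X + ennreal (exp (- A) * t * A)"
    using real(1) t by (simp add: ennreal_mult[symmetric])
  have "ennreal (exp (- A)) \<le> ennreal (1 / t) * X"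
  proof (cases X)
    case (real x)
    have "exp (- A) * (1 + A) * t \<le> x + exp (- A) * t * A"
      using * real \<open>0 \<le> A\<close> t by (simp add: ennreal_plus[symmetric] del: ennreal_plus)
    then have "exp (- A) \<le> 1 / t * x" using t by (simp add: field_simps)
    then show ?thesis using real t by (simp add: ennreal_mult[symmetric] ennreal_leI)
  qed (use t in \<open>simp add: ennreal_mult_top\<close>)
  then show ?thesis unfolding real(2) X_def using real(1) by (simp add: exp_minus_ennreal)
qed simp

lemma nn_integral_Gamma_scaled:
  assumes b: "0 < b" and v: "0 < v"
  shows "(\<integral>\<^sup>+t\<in>{0<..}. ennreal (t powr (b - 1) * exp (- v * t)) \<partial>lborel) = ennreal (Gamma b * v powr (- b))"
proof -
  have "ennreal (Gamma b) = (\<integral>\<^sup>+t. ennreal (indicator {0..} t * t powr (b - 1) / exp t) \<partial>lborel)"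
    by (rule Gamma_conv_nn_integral_real[OF b])
  also have "\<dots> = ennreal \<bar>v\<bar> * (\<integral>\<^sup>+t. ennreal (indicator {0..} (0 + v * t) * (0 + v * t) powr (b - 1) / exp (0 + v * t)) \<partial>lborel)"
    using v by (intro nn_integral_real_affine) auto
  also have "\<dots> = ennreal v * (\<integral>\<^sup>+t. ennreal (v powr (b - 1)) * (ennreal (t powr (b - 1) * exp (- v * t)) * indicator {0<..} t) \<partial>lborel)"
    using v b by (intro arg_cong2[where f="(*)"] nn_integral_cong)
      (auto simp: indicator_def zero_le_mult_iff powr_mult exp_minus field_simps ennreal_mult[symmetric])
  also have "\<dots> = ennreal (v powr b) * (\<integral>\<^sup>+t\<in>{0<..}. ennreal (t powr (b - 1) * exp (- v * t)) \<partial>lborel)"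
    using v by (subst nn_integral_cmult) (auto simp: mult.assoc[symmetric] ennreal_mult[symmetric] powr_diff)
  finally have "ennreal (v powr (- b)) * ennreal (Gamma b) = ennreal (v powr (- b)) * (ennreal (v powr b) * (\<integral>\<^sup>+t\<in>{0<..}. ennreal (t powr (b - 1) * exp (- v * t)) \<partial>lborel))"
    by simp
  also have "\<dots> = (\<integral>\<^sup>+t\<in>{0<..}. ennreal (t powr (b - 1) * exp (- v * t)) \<partial>lborel)"
    using v by (simp add: mult.assoc[symmetric] ennreal_mult[symmetric] powr_add[symmetric])
  finally show ?thesis using b by (simp add: ennreal_mult[symmetric] Gamma_real_nonneg mult.commute)
qed

text \<open>The value is \<open>1 / b\<close>; the cruder constant comes for free from the Gamma integral.\<close>

lemma nn_integral_powr_unit_le: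
  assumes b: "0 < b"
  shows "(\<integral>\<^sup>+t\<in>{0<..1}. ennreal (t powr (b - 1)) \<partial>lborel) \<le> ennreal (exp 1 * Gamma b)"
proof -
  have "(\<integral>\<^sup>+t\<in>{0<..1}. ennreal (t powr (b - 1)) \<partial>lborel)
     \<le> (\<integral>\<^sup>+t. ennreal (exp 1) * (ennreal (t powr (b - 1) * exp (- 1 * t)) * indicator {0<..} t) \<partial>lborel)"
  proof (rule nn_integral_mono)
    fix t :: real
    have "t powr (b - 1) * 1 \<le> t powr (b - 1) * exp (1 - t)" if "t \<le> 1"
      using that by (intro mult_left_mono) auto
    then show "ennreal (t powr (b - 1)) * indicator {0<..1} t \<le> ennreal (exp 1) * (ennreal (t powr (b - 1) * exp (- 1 * t)) * indicator {0<..} t)"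
      by (auto simp: indicator_def ennreal_mult[symmetric] exp_diff exp_minus field_simps intro!: ennreal_leI)
  qed
  also have "\<dots> = ennreal (exp 1) * ennreal (Gamma b * 1 powr (- b))"
    using nn_integral_Gamma_scaled[OF b, of 1] by (subst nn_integral_cmult) auto
  finally show ?thesis using b by (simp add: ennreal_mult Gamma_real_nonneg)
qed

context brownian_paths
begin

section \<open>Gaussian tails and the functions rho and sigma\<close>

lemma nn_integral_heat_density:
  assumes "0 < h" shows "(\<integral>\<^sup>+z. ennreal (heat_density h (z::'a)) \<partial>lborel) = 1"
  using increment_integral[of 0 h "\<lambda>_. 1"] assms by (simp add: emeasure_space_1)

text \<open>
  For \<open>t - r \<le> 1\<close> the exponent \<open>3/8\<close> stays below \<open>1 / (2 (t - r))\<close>, and what remains of the Gaussian is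
  at least as concentrated as the heat kernel at time \<open>4 (t - r)\<close>. The choice leaves room above the
  exponent \<open>1/4\<close> in the growth condition and in the tail bound for \<open>sigma\<close>.
\<close>

lemma increment_exp_square:
  assumes "0 \<le> r" "r < t" "t \<le> 1"
  shows "(\<integral>\<^sup>+\<omega>. ennreal (exp (3/8 * (norm (B t \<omega> - B r \<omega>))\<^sup>2)) \<partial>M) \<le> ennreal (2 ^ DIM('a))"
proof -
  define h where "h = t - r"
  have h: "0 < h" "h \<le> 1" using assms by (auto simp: h_def)
  have pw: "heat_density h z * exp (3/8 * (norm z)\<^sup>2) \<le> 2 ^ DIM('a) * heat_density (4 * h) z" for z :: 'a
  proof -
    have "(4::real) powr (- real DIM('a) / 2) = (2 powr 2) powr (- real DIM('a) / 2)" by simp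
    also have "\<dots> = 1 / 2 ^ DIM('a)"
      unfolding powr_powr by (simp add: powr_minus powr_realpow field_simps)
    finally have "(2 * pi * (4 * h)) powr (- real DIM('a) / 2) = (2 * pi * h) powr (- real DIM('a) / 2) / 2 ^ DIM('a)"
      using h powr_mult[of "2 * pi * h" 4 "- real DIM('a) / 2"] by (simp add: mult_ac)
    then have scale: "2 ^ DIM('a) * heat_density (4 * h) z = (2 * pi * h) powr (- real DIM('a) / 2) * exp (- (norm z)\<^sup>2 / (2 * (4 * h)))"
      by (simp add: heat_density_def)
    have "(norm z)\<^sup>2 * h \<le> (norm z)\<^sup>2 * 1" using h by (intro mult_left_mono) auto
    then have "3/8 * (norm z)\<^sup>2 \<le> 3/8 * (norm z)\<^sup>2 / h"
      using h by (simp add: field_simps)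
    then have "- (norm z)\<^sup>2 / (2 * h) + 3/8 * (norm z)\<^sup>2 \<le> - (norm z)\<^sup>2 / (2 * (4 * h))"
      using h by (simp add: field_simps)
    then have "(2 * pi * h) powr (- real DIM('a) / 2) * exp (- (norm z)\<^sup>2 / (2 * h) + 3/8 * (norm z)\<^sup>2)
        \<le> (2 * pi * h) powr (- real DIM('a) / 2) * exp (- (norm z)\<^sup>2 / (2 * (4 * h)))"
      by (intro mult_left_mono) auto
    then show ?thesis
      unfolding scale by (simp only: heat_density_def exp_add mult.assoc)
  qed
  have "(\<integral>\<^sup>+\<omega>. ennreal (exp (3/8 * (norm (B t \<omega> - B r \<omega>))\<^sup>2)) \<partial>M)
      = (\<integral>\<^sup>+z. ennreal (heat_density h (z::'a)) * ennreal (exp (3/8 * (norm z)\<^sup>2)) \<partial>lborel)"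
    unfolding h_def using assms by (intro increment_integral) auto
  also have "\<dots> \<le> (\<integral>\<^sup>+z. ennreal (2 ^ DIM('a)) * ennreal (heat_density (4 * h) (z::'a)) \<partial>lborel)"
    using pw by (intro nn_integral_mono) (auto simp: ennreal_mult[symmetric] intro!: ennreal_leI)
  also have "\<dots> = ennreal (2 ^ DIM('a))"
    using nn_integral_heat_density[of "4 * h"] h by (subst nn_integral_cmult) auto
  finally show ?thesis .
qed

lemma increment_exp_linear:
  fixes b :: 'a
  assumes "0 \<le> r" "r < t" "norm b = 1"
  shows "(\<integral>\<^sup>+\<omega>. ennreal (exp (l * ((B t \<omega> - B r \<omega>) \<bullet> b))) \<partial>M) = ennreal (exp (l\<^sup>2 * (t - r) / 2))"
proof -
  define h where "h = t - r"
  have h: "0 < h" using assms by (auto simp: h_def)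
  have bb: "b \<bullet> b = 1" using assms(3) by (simp add: dot_square_norm)
  have pw: "heat_density h z * exp (l * (z \<bullet> b)) = exp (l\<^sup>2 * h / 2) * heat_density h (z + - (l * h) *\<^sub>R b)" for z :: 'a
  proof -
    have "(norm (z + - (l * h) *\<^sub>R b))\<^sup>2 = (norm z)\<^sup>2 - 2 * (l * h) * (z \<bullet> b) + (l * h)\<^sup>2"
      unfolding power2_norm_eq_inner by (simp add: inner_diff_left inner_diff_right bb inner_commute power2_eq_square algebra_simps)
    then have "- (norm z)\<^sup>2 / (2 * h) + l * (z \<bullet> b) = l\<^sup>2 * h / 2 + - (norm (z + - (l * h) *\<^sub>R b))\<^sup>2 / (2 * h)"
      using h by (simp add: field_simps power2_eq_square)
    then have "exp (- (norm z)\<^sup>2 / (2 * h)) * exp (l * (z \<bullet> b)) = exp (l\<^sup>2 * h / 2) * exp (- (norm (z + - (l * h) *\<^sub>R b))\<^sup>2 / (2 * h))"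
      by (simp only: exp_add[symmetric])
    then show ?thesis by (simp add: heat_density_def mult_ac)
  qed
  have "(\<integral>\<^sup>+\<omega>. ennreal (exp (l * ((B t \<omega> - B r \<omega>) \<bullet> b))) \<partial>M)
      = (\<integral>\<^sup>+z. ennreal (heat_density h (z::'a)) * ennreal (exp (l * (z \<bullet> b))) \<partial>lborel)"
    unfolding h_def using assms by (intro increment_integral) auto
  also have "\<dots> = (\<integral>\<^sup>+z. ennreal (exp (l\<^sup>2 * h / 2)) * ennreal (heat_density h ((z::'a) + - (l * h) *\<^sub>R b)) \<partial>lborel)"
    by (intro nn_integral_cong) (simp only: pw ennreal_mult[symmetric] heat_density_nonneg exp_ge_zero)
  also have "\<dots> = ennreal (exp (l\<^sup>2 * h / 2)) * (\<integral>\<^sup>+z. ennreal (heat_density h (z::'a)) \<partial>lborel)"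
    by (subst nn_integral_cmult, simp, subst nn_integral_lborel_shift) auto
  finally show ?thesis using nn_integral_heat_density[OF h] by (simp add: h_def)
qed

text \<open>Chernoff's bound with the exponential moment of order \<open>l\<close>, optimal for \<open>t - r = 1\<close>.\<close>

lemma increment_tail_direction:
  fixes b :: 'a
  assumes "0 \<le> r" "r < t" "t \<le> 1" "norm b = 1" "0 \<le> l"
  shows "emeasure M {\<omega>\<in>space M. l \<le> (B t \<omega> - B r \<omega>) \<bullet> b} \<le> ennreal (exp (- (l\<^sup>2 / 2)))"
proof -
  let ?A = "{\<omega>\<in>space M. l \<le> (B t \<omega> - B r \<omega>) \<bullet> b}"
  have "emeasure M ?A
      = (\<integral>\<^sup>+\<omega>. indicator ?A \<omega> \<partial>M)"
    by (rule nn_integral_indicator[symmetric]) measurable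
  also have "\<dots> \<le> (\<integral>\<^sup>+\<omega>. ennreal (exp (- l\<^sup>2)) * ennreal (exp (l * ((B t \<omega> - B r \<omega>) \<bullet> b))) \<partial>M)"
  proof (rule nn_integral_mono)
    fix \<omega>
    have "1 \<le> exp (- l\<^sup>2) * exp (l * x)" if "l \<le> x" for x
      using mult_left_mono[OF that \<open>0 \<le> l\<close>] by (simp add: exp_add[symmetric] power2_eq_square)
    then show "indicator ?A \<omega> \<le> ennreal (exp (- l\<^sup>2)) * ennreal (exp (l * ((B t \<omega> - B r \<omega>) \<bullet> b)))"
      by (auto simp: indicator_def ennreal_mult[symmetric])
  qed
  also have "\<dots> = ennreal (exp (- l\<^sup>2) * exp (l\<^sup>2 * (t - r) / 2))"
    using assms by (subst nn_integral_cmult) (auto simp: increment_exp_linear ennreal_mult)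
  also have "\<dots> \<le> ennreal (exp (- (l\<^sup>2 / 2)))"
  proof (rule ennreal_leI)
    have "l\<^sup>2 * (t - r) \<le> l\<^sup>2 * 1" using assms by (intro mult_left_mono) auto
    then show "exp (- l\<^sup>2) * exp (l\<^sup>2 * (t - r) / 2) \<le> exp (- (l\<^sup>2 / 2))"
      unfolding exp_add[symmetric] by simp
  qed
  finally show ?thesis .
qed

text \<open>
  If the norm is at least \<open>R\<close>, one of the \<open>d\<close> coordinates has modulus at least \<open>R / sqrt d\<close>. The
  exponent \<open>R\<^sup>2 / (2 d)\<close>, half of which appears in the definition of \<open>I\<close>, is better than the
  one in \<open>increment_tail_dimension_free\<close> if \<open>d = 1\<close>, where a quadratic exponential moment cannot give it.
\<close>

lemma increment_tail_coordinates:
  assumes "0 \<le> r" "r < t" "t \<le> 1" "0 \<le> R"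
  shows "measure M {\<omega>\<in>space M. R \<le> norm (B t \<omega> - B r \<omega>)} \<le> 2 * real DIM('a) * exp (- (R\<^sup>2 / (2 * real DIM('a))))"
proof -
  define l where "l = R / sqrt (real DIM('a))"
  have l: "0 \<le> l" "l\<^sup>2 = R\<^sup>2 / real DIM('a)" using assms by (auto simp: l_def power_divide)
  let ?A = "\<lambda>b. {\<omega>\<in>space M. l \<le> (B t \<omega> - B r \<omega>) \<bullet> b}"
  let ?S = "Basis \<union> uminus ` (Basis :: 'a set)"
  have cover: "{\<omega>\<in>space M. R \<le> norm (B t \<omega> - B r \<omega>)} \<subseteq> (\<Union>b\<in>?S. ?A b)"
  proof safe
    fix \<omega> assume \<omega>: "\<omega> \<in> space M" and R: "R \<le> norm (B t \<omega> - B r \<omega>)"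
    define D where "D = B t \<omega> - B r \<omega>"
    have "\<exists>b\<in>Basis. l \<le> \<bar>D \<bullet> b\<bar>"
    proof (rule ccontr)
      assume "\<not> ?thesis"
      then have "\<And>b. b \<in> Basis \<Longrightarrow> (D \<bullet> b)\<^sup>2 < l\<^sup>2"
        using l(1) by (metis abs_le_square_iff abs_of_nonneg not_le)
      then have "(\<Sum>b\<in>Basis. (D \<bullet> b)\<^sup>2) < (\<Sum>b\<in>(Basis::'a set). l\<^sup>2)"
        by (intro sum_strict_mono) auto
      also have "\<dots> = R\<^sup>2" by (simp add: l(2))
      also have "(\<Sum>b\<in>Basis. (D \<bullet> b)\<^sup>2) = (norm D)\<^sup>2"
        unfolding power2_norm_eq_inner by (subst euclidean_inner) (simp add: power2_eq_square)
      finally have "(norm D)\<^sup>2 < R\<^sup>2" .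
      moreover have "R\<^sup>2 \<le> (norm D)\<^sup>2" using R assms(4) by (auto simp: D_def intro: power_mono)
      ultimately show False by simp
    qed
    then obtain b where "b \<in> Basis" "l \<le> D \<bullet> b \<or> l \<le> D \<bullet> (- b)" by (auto simp: abs_real_def split: if_splits)
    then show "\<omega> \<in> (\<Union>b\<in>?S. ?A b)" using \<omega> unfolding D_def by blast
  qed
  have "emeasure M {\<omega>\<in>space M. R \<le> norm (B t \<omega> - B r \<omega>)} \<le> emeasure M (\<Union>b\<in>?S. ?A b)"
    by (intro emeasure_mono cover sets.finite_UN) auto
  also have "\<dots> \<le> (\<Sum>b\<in>?S. emeasure M (?A b))"
    by (intro emeasure_subadditive_finite) auto
  also have "\<dots> \<le> (\<Sum>b\<in>?S. ennreal (exp (- (l\<^sup>2 / 2))))"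
    using assms l by (intro sum_mono increment_tail_direction) auto
  also have "\<dots> = of_nat (card ?S) * ennreal (exp (- (l\<^sup>2 / 2)))" by simp
  also have "\<dots> \<le> of_nat (2 * DIM('a)) * ennreal (exp (- (l\<^sup>2 / 2)))"
  proof -
    have "card ?S \<le> card (Basis :: 'a set) + card (uminus ` (Basis :: 'a set))" by (rule card_Un_le)
    also have "\<dots> \<le> 2 * DIM('a)" using card_image_le[of "Basis :: 'a set" uminus] by simp
    finally show ?thesis by (intro mult_right_mono of_nat_mono) auto
  qed
  also have "\<dots> = ennreal (2 * real DIM('a) * exp (- (R\<^sup>2 / (2 * real DIM('a)))))"
    by (simp add: l(2) ennreal_of_nat_eq_real_of_nat[symmetric] ennreal_mult mult_ac ennreal_mult')
  finally show ?thesis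
    by (subst (asm) emeasure_eq_measure) (simp add: ennreal_le_iff)
qed

lemma increment_tail_dimension_free:
  assumes "0 \<le> r" "r < t" "t \<le> 1" "0 \<le> R"
  shows "measure M {\<omega>\<in>space M. R \<le> norm (B t \<omega> - B r \<omega>)} \<le> 2 ^ DIM('a) * exp (- (R\<^sup>2 / 4))"
proof -
  let ?A = "{\<omega>\<in>space M. R \<le> norm (B t \<omega> - B r \<omega>)}"
  have "emeasure M ?A
      = (\<integral>\<^sup>+\<omega>. indicator ?A \<omega> \<partial>M)"
    by (rule nn_integral_indicator[symmetric]) measurable
  also have "\<dots> \<le> (\<integral>\<^sup>+\<omega>. ennreal (exp (- (R\<^sup>2 / 4))) * ennreal (exp (3/8 * (norm (B t \<omega> - B r \<omega>))\<^sup>2)) \<partial>M)"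
  proof (rule nn_integral_mono)
    fix \<omega>
    have "1 \<le> exp (- (R\<^sup>2 / 4)) * exp (3/8 * x\<^sup>2)" if "R \<le> x" for x
    proof -
      have "R\<^sup>2 \<le> x\<^sup>2" using that assms by (intro power_mono) auto
      with zero_le_power2[of R] have "0 \<le> - (R\<^sup>2 / 4) + 3/8 * x\<^sup>2" by linarith
      then show ?thesis by (simp only: exp_add[symmetric] one_le_exp_iff)
    qed
    then show "indicator ?A \<omega> \<le> ennreal (exp (- (R\<^sup>2 / 4))) * ennreal (exp (3/8 * (norm (B t \<omega> - B r \<omega>))\<^sup>2))"
      by (auto simp: indicator_def ennreal_mult[symmetric])
  qed
  also have "\<dots> = ennreal (exp (- (R\<^sup>2 / 4))) * (\<integral>\<^sup>+\<omega>. ennreal (exp (3/8 * (norm (B t \<omega> - B r \<omega>))\<^sup>2)) \<partial>M)"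
    by (rule nn_integral_cmult) measurable
  also have "\<dots> \<le> ennreal (exp (- (R\<^sup>2 / 4))) * ennreal (2 ^ DIM('a))"
    using assms by (intro mult_left_mono increment_exp_square) auto
  also have "\<dots> = ennreal (2 ^ DIM('a) * exp (- (R\<^sup>2 / 4)))"
    by (subst ennreal_mult[symmetric]) (simp_all add: mult.commute)
  finally show ?thesis
    by (subst (asm) emeasure_eq_measure) (simp add: ennreal_le_iff)
qed

text \<open>
  Null sets are not charged by the law of the increment, so \<open>Q\<close> can only hold outside the ball, that
  is, if the increment is longer than \<open>R\<close>.
\<close>

lemma prob_increment_le:
  assumes [measurable]: "Measurable.pred borel Q" and "0 \<le> r" "r < t" "AE z in lborel. z \<in> cball y R \<longrightarrow> \<not> Q z"
  shows "measure M {\<omega>\<in>space M. Q (y - (B t \<omega> - B r \<omega>))} \<le> measure M {\<omega>\<in>space M. R \<le> norm (B t \<omega> - B r \<omega>)}"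
proof (rule finite_measure_mono_AE)
  have "AE \<omega> in M. y - (B t \<omega> - B r \<omega>) \<in> cball y R \<longrightarrow> \<not> Q (y - (B t \<omega> - B r \<omega>))"
    using AE_increment[OF assms(2,3) AE_lborel_reflect[OF assms(4)]] .
  then show "AE \<omega> in M. \<omega> \<in> {\<omega>\<in>space M. Q (y - (B t \<omega> - B r \<omega>))} \<longrightarrow> \<omega> \<in> {\<omega>\<in>space M. R \<le> norm (B t \<omega> - B r \<omega>)}"
    by eventually_elim (auto simp: dist_norm not_le)
qed measurable

lemma AE_cball_0:
  fixes y :: "'b::euclidean_space"
  shows "AE z in lborel. z \<in> cball y 0 \<longrightarrow> Q z"
  using AE_lborel_singleton[of y] by eventually_elim auto

text \<open>
  Square roots of probabilities are estimated, because the joint probability of two events will be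
  bounded by the geometric mean of their probabilities. The denominator \<open>8\<close> is twice the \<open>4\<close> of
  \<open>increment_tail_dimension_free\<close>.
\<close>

lemma prob_above_le_sigma:
  assumes [measurable]: "V \<in> borel_measurable borel" and "0 < t" "t \<le> 1"
  shows "ennreal (sqrt (measure M {\<omega>\<in>space M. u * V y < V (y - B t \<omega>)} / 2 ^ DIM('a)))
    \<le> exp_minus ((sigma V y u)\<^sup>2 / 8)"
proof -
  let ?P = "measure M {\<omega>\<in>space M. u * V y < V (y - B t \<omega>)}"
  have "ennreal (sqrt (?P / 2 ^ DIM('a)))
    \<le> ennreal 1 * exp_minus ((Sup {ennreal r |r. 0 \<le> r \<and> (AE z in lborel. z \<in> cball y r \<longrightarrow> V z \<le> u * V y)})\<^sup>2 / ennreal 8)"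
  proof (rule exp_minus_Sup_bound[where q=0])
    fix r assume r: "0 \<le> r" "AE z in lborel. z \<in> cball y r \<longrightarrow> V z \<le> u * V y"
    have "measure M {\<omega>\<in>space M. u * V y < V (y - (B t \<omega> - B 0 \<omega>))} \<le> measure M {\<omega>\<in>space M. r \<le> norm (B t \<omega> - B 0 \<omega>)}"
      by (rule prob_increment_le) (use assms r in \<open>auto simp: not_less\<close>)
    also have "\<dots> \<le> 2 ^ DIM('a) * exp (- (r\<^sup>2 / 4))"
      using assms r by (intro increment_tail_dimension_free) auto
    finally have "sqrt (?P / 2 ^ DIM('a)) \<le> sqrt (exp (- (r\<^sup>2 / 4)))"
      by (intro real_sqrt_le_mono) (simp add: field_simps)
    also have "\<dots> = exp (- (r\<^sup>2 / 8))"
      by (rule real_sqrt_unique) (simp_all add: power2_eq_square exp_add[symmetric])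
    finally show "ennreal (sqrt (?P / 2 ^ DIM('a))) \<le> ennreal (1 * exp (- (r\<^sup>2 / 8)))"
      by (simp add: ennreal_leI)
  qed (rule AE_cball_0 | simp)+
  then show ?thesis by (simp add: sigma_def AE_completion_iff)
qed

text \<open>The exponential factor in the integrand of \<open>I_fun\<close>.\<close>

definition rho_weight :: "('a \<Rightarrow> real) \<Rightarrow> 'a \<Rightarrow> real \<Rightarrow> ennreal" where
  "rho_weight V y s = exp_minus ((rho V y s)\<^sup>2 / of_nat (4 * DIM('a)))"

lemma prob_below_le_rho:
  assumes [measurable]: "V \<in> borel_measurable borel" and "0 \<le> r" "r < t" "t \<le> 1"
  shows "ennreal (sqrt (measure M {\<omega>\<in>space M. V (y - (B t \<omega> - B r \<omega>)) < V y / s} / (2 * real DIM('a)))) \<le> rho_weight V y s"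
proof -
  let ?P = "measure M {\<omega>\<in>space M. V (y - (B t \<omega> - B r \<omega>)) < V y / s}"
  have "ennreal (sqrt (?P / (2 * real DIM('a))))
    \<le> ennreal 1 * exp_minus ((Sup {ennreal r |r. 0 \<le> r \<and> (AE z in lborel. z \<in> cball y r \<longrightarrow> V y / s \<le> V z)})\<^sup>2 / ennreal (4 * real DIM('a)))"
  proof (rule exp_minus_Sup_bound[where q=0])
    fix R assume R: "0 \<le> R" "AE z in lborel. z \<in> cball y R \<longrightarrow> V y / s \<le> V z"
    have "?P \<le> measure M {\<omega>\<in>space M. R \<le> norm (B t \<omega> - B r \<omega>)}"
      by (rule prob_increment_le) (use assms R in \<open>auto simp: not_less\<close>)
    also have "\<dots> \<le> 2 * real DIM('a) * exp (- (R\<^sup>2 / (2 * real DIM('a))))"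
      using assms R by (intro increment_tail_coordinates) auto
    finally have "sqrt (?P / (2 * real DIM('a))) \<le> sqrt (exp (- (R\<^sup>2 / (2 * real DIM('a)))))"
      by (intro real_sqrt_le_mono) (simp add: pos_divide_le_eq mult.commute)
    also have "\<dots> = exp (- (R\<^sup>2 / (4 * real DIM('a))))"
      by (rule real_sqrt_unique) (simp_all add: power2_eq_square exp_add[symmetric] field_simps)
    finally show "ennreal (sqrt (?P / (2 * real DIM('a)))) \<le> ennreal (1 * exp (- (R\<^sup>2 / (4 * real DIM('a)))))"
      by (simp add: ennreal_leI)
  qed (rule AE_cball_0 | simp)+
  moreover have "ennreal (4 * real DIM('a)) = of_nat (4 * DIM('a))"
    by (simp add: ennreal_of_nat_eq_real_of_nat[symmetric] ennreal_mult)
  ultimately show ?thesis by (simp add: rho_def rho_weight_def AE_completion_iff)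
qed

lemma rho_weight_antimono:
  assumes "0 \<le> V y" "0 < s" "s \<le> s'"
  shows "rho_weight V y s' \<le> rho_weight V y s"
proof -
  have "V y / s' \<le> V y / s" using assms by (intro divide_left_mono) auto
  then have "AE z in lebesgue. z \<in> cball y r \<longrightarrow> V y / s' \<le> V z" if "AE z in lebesgue. z \<in> cball y r \<longrightarrow> V y / s \<le> V z" for r
    using that by (rule_tac AE_mp[OF that]) (auto intro!: AE_I2)
  then have "rho V y s \<le> rho V y s'"
    unfolding rho_def by (intro Sup_subset_mono) blast
  then show ?thesis
    unfolding rho_weight_def by (intro exp_minus_antimono divide_right_mono_ennreal power_mono) auto
qed

lemma measurable_rho_weight:
  assumes "0 \<le> V y"
  shows "(\<lambda>s. rho_weight V y s * indicator {1..} s) \<in> borel_measurable borel"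
  using assms by (intro measurable_antimono_interval rho_weight_antimono) (auto simp: rho_weight_def exp_minus_le_1)

section \<open>Points at which the potential is at least one\<close>

text \<open>
  The adjoint of \<open>fk V t\<close> with respect to Lebesgue measure (see \<open>fk_dual\<close>): the path is started at
  \<open>y - B t\<close>, hence ends at \<open>y\<close>.
\<close>

definition fk_adj :: "('a \<Rightarrow> real) \<Rightarrow> real \<Rightarrow> ('a \<Rightarrow> ennreal) \<Rightarrow> 'a \<Rightarrow> ennreal" where
  "fk_adj V t F y = (\<integral>\<^sup>+\<omega>. kac V t (y - B t \<omega>) \<omega> * F (y - B t \<omega>) \<partial>M)"

lemma measurable_fk_adj [measurable (raw)]:
  assumes [measurable]: "V \<in> borel_measurable borel" "F \<in> borel_measurable borel" "t \<in> borel_measurable N" "y \<in> borel_measurable N"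
  shows "(\<lambda>z. fk_adj V (t z) F (y z)) \<in> borel_measurable N"
  unfolding fk_adj_def by measurable

text \<open>
  By the layer cake formula the moment is an integral over \<open>u\<close> of the probabilities that \<open>A\<close>
  occurs and \<open>y - B t\<close> lies in the layer \<open>{V > u V y}\<close>. Estimating them by geometric means produces
  \<open>J\<close> and retains the factor \<open>sqrt (P A)\<close>, through which the damping will enter.
\<close>

lemma weighted_moment:
  assumes [measurable]: "V \<in> borel_measurable borel" and V: "\<And>z. 0 \<le> V z" and t: "0 < t" "t \<le> 1"
    and v: "0 < V y" and a: "0 < a" and C: "0 \<le> C"
    and J: "(\<integral>\<^sup>+u\<in>{1..}. ennreal (u powr (a - 1)) * exp_minus ((sigma V y u)\<^sup>2 / 8) \<partial>lborel) \<le> ennreal C"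
    and A[measurable]: "A \<in> sets M"
  shows "(\<integral>\<^sup>+\<omega>. ennreal (V (y - B t \<omega>) powr a) * indicator A \<omega> \<partial>M)
    \<le> ennreal (V y powr a * (1 + a * sqrt (2 ^ DIM('a)) * C) * sqrt (measure M A))"
proof -
  define v where "v = V y"
  let ?E = "\<lambda>u. {\<omega>\<in>space M. u * v < V (y - B t \<omega>)}"
  define p where "p u = measure M (?E u)" for u
  have "p u = enn2real (\<integral>\<^sup>+\<omega>. (if u * v < V (y - B t \<omega>) then 1 else 0) \<partial>M)" for u
  proof -
    have "(\<integral>\<^sup>+\<omega>. (if u * v < V (y - B t \<omega>) then 1 else 0) \<partial>M) = (\<integral>\<^sup>+\<omega>. indicator (?E u) \<omega> \<partial>M)"
      by (intro nn_integral_cong) (auto simp: indicator_def)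
    also have "\<dots> = emeasure M (?E u)"
      by (rule nn_integral_indicator) measurable
    finally show ?thesis by (simp add: p_def measure_def)
  qed
  then have "p = (\<lambda>u. enn2real (\<integral>\<^sup>+\<omega>. (if u * v < V (y - B t \<omega>) then 1 else 0) \<partial>M))" by auto
  then have [measurable]: "p \<in> borel_measurable borel" by simp
  let ?g = "\<lambda>u. ennreal (a * u powr (a - 1))"
  let ?L = "\<lambda>\<omega>. \<integral>\<^sup>+u\<in>{1..}. ?g u * (if u * v < V (y - B t \<omega>) then 1 else 0) \<partial>lborel"
  define q where "q = sqrt (measure M A)"
  have q: "0 \<le> q" "measure M A \<le> q"
  proof -
    show "0 \<le> q" by (simp add: q_def)
    have "measure M A * measure M A \<le> measure M A * 1" by (intro mult_left_mono) auto
    then show "measure M A \<le> q" unfolding q_def by (intro real_le_rsqrt) (simp add: power2_eq_square)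
  qed
  have joint: "(\<integral>\<^sup>+\<omega>. (if u * v < V (y - B t \<omega>) then 1 else 0) * indicator A \<omega> \<partial>M)
      \<le> ennreal (q * sqrt (2 ^ DIM('a))) * ennreal (sqrt (p u / 2 ^ DIM('a)))" for u
  proof -
    have "(\<integral>\<^sup>+\<omega>. (if u * v < V (y - B t \<omega>) then 1 else 0) * indicator A \<omega> \<partial>M)
        = (\<integral>\<^sup>+\<omega>. indicator (A \<inter> ?E u) \<omega> \<partial>M)"
      using sets.sets_into_space[OF A] by (intro nn_integral_cong) (auto simp: indicator_def)
    also have "\<dots> = emeasure M (A \<inter> ?E u)"
      by (rule nn_integral_indicator) measurable
    also have "\<dots> = ennreal (measure M (A \<inter> ?E u))"
      by (rule emeasure_eq_measure)
    also have "\<dots> \<le> ennreal (q * sqrt (p u))"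
    proof (rule ennreal_leI)
      let ?m = "measure M (A \<inter> ?E u)"
      have "?m \<le> measure M A" "?m \<le> p u"
        unfolding p_def by (auto intro!: finite_measure_mono)
      then have "?m * ?m \<le> measure M A * p u" by (intro mult_mono) auto
      then show "?m \<le> q * sqrt (p u)"
        unfolding q_def real_sqrt_mult[symmetric] by (intro real_le_rsqrt) (simp add: power2_eq_square)
    qed
    also have "q * sqrt (p u) = q * sqrt (2 ^ DIM('a)) * sqrt (p u / 2 ^ DIM('a))"
      by (simp add: real_sqrt_divide)
    finally show ?thesis using q by (simp add: ennreal_mult p_def)
  qed
  have "(\<integral>\<^sup>+\<omega>. ennreal (V (y - B t \<omega>) powr a) * indicator A \<omega> \<partial>M)
     \<le> (\<integral>\<^sup>+\<omega>. ennreal (v powr a) * (1 + ?L \<omega>) * indicator A \<omega> \<partial>M)"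
    using v V a by (intro nn_integral_mono mult_right_mono powr_le_layers) (auto simp: v_def)
  also have "\<dots> = ennreal (v powr a) * (\<integral>\<^sup>+\<omega>. indicator A \<omega> + ?L \<omega> * indicator A \<omega> \<partial>M)"
    by (subst nn_integral_cmult[symmetric]) (auto simp: algebra_simps)
  also have "(\<integral>\<^sup>+\<omega>. indicator A \<omega> + ?L \<omega> * indicator A \<omega> \<partial>M)
     = emeasure M A + (\<integral>\<^sup>+\<omega>. ?L \<omega> * indicator A \<omega> \<partial>M)"
    by (subst nn_integral_add) auto
  also have "(\<integral>\<^sup>+\<omega>. ?L \<omega> * indicator A \<omega> \<partial>M)
     = (\<integral>\<^sup>+\<omega>. \<integral>\<^sup>+u. ?g u * indicator {1..} u * ((if u * v < V (y - B t \<omega>) then 1 else 0) * indicator A \<omega>) \<partial>lborel \<partial>M)"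
    by (intro nn_integral_cong, subst nn_integral_multc[symmetric]) (auto simp: mult_ac)
  also have "\<dots> = (\<integral>\<^sup>+u. \<integral>\<^sup>+\<omega>. ?g u * indicator {1..} u * ((if u * v < V (y - B t \<omega>) then 1 else 0) * indicator A \<omega>) \<partial>M \<partial>lborel)"
  proof -
    interpret L: pair_sigma_finite M lborel ..
    show ?thesis by (rule L.Fubini'[symmetric]) measurable
  qed
  also have "\<dots> = (\<integral>\<^sup>+u. ?g u * indicator {1..} u * (\<integral>\<^sup>+\<omega>. (if u * v < V (y - B t \<omega>) then 1 else 0) * indicator A \<omega> \<partial>M) \<partial>lborel)"
    by (intro nn_integral_cong nn_integral_cmult) measurable
  also have "\<dots> \<le> (\<integral>\<^sup>+u. ?g u * indicator {1..} u * (ennreal (q * sqrt (2 ^ DIM('a))) * ennreal (sqrt (p u / 2 ^ DIM('a)))) \<partial>lborel)"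
    by (intro nn_integral_mono mult_left_mono joint) auto
  also have "\<dots> = ennreal (a * (q * sqrt (2 ^ DIM('a)))) * (\<integral>\<^sup>+u\<in>{1..}. ennreal (u powr (a - 1)) * ennreal (sqrt (p u / 2 ^ DIM('a))) \<partial>lborel)"
    using a q by (subst nn_integral_cmult[symmetric]) (auto simp: ennreal_mult mult_ac intro!: nn_integral_cong)
  also have "\<dots> \<le> ennreal (a * (q * sqrt (2 ^ DIM('a)))) * (\<integral>\<^sup>+u\<in>{1..}. ennreal (u powr (a - 1)) * exp_minus ((sigma V y u)\<^sup>2 / 8) \<partial>lborel)"
    unfolding p_def v_def using t by (intro mult_left_mono nn_integral_mono mult_right_mono prob_above_le_sigma) auto
  also have "\<dots> \<le> ennreal (a * (q * sqrt (2 ^ DIM('a)))) * ennreal C"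
    by (intro mult_left_mono J) auto
  finally have "(\<integral>\<^sup>+\<omega>. ennreal (V (y - B t \<omega>) powr a) * indicator A \<omega> \<partial>M)
    \<le> ennreal (v powr a) * (emeasure M A + ennreal (a * (q * sqrt (2 ^ DIM('a)))) * ennreal C)"
    by (simp add: add_left_mono mult_left_mono)
  also have "\<dots> \<le> ennreal (v powr a) * (ennreal q + ennreal (a * (q * sqrt (2 ^ DIM('a)))) * ennreal C)"
    unfolding emeasure_eq_measure using q by (intro mult_left_mono add_right_mono ennreal_leI) auto
  also have "\<dots> = ennreal (v powr a * (1 + a * sqrt (2 ^ DIM('a)) * C) * q)"
    using a q C by (simp add: ennreal_mult[symmetric] ennreal_plus[symmetric] algebra_simps del: ennreal_plus)
  finally show ?thesis by (simp add: v_def q_def)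
qed

end

text \<open>
  For \<open>1 \<le> V y\<close> the truncations in \<open>I_fun\<close> and \<open>J_fun\<close> disappear: \<open>min 1 (V y powr a)\<close> is \<open>1\<close> and
  \<open>max 1 (V y)\<close> is \<open>V y\<close>.
\<close>

locale large_value = brownian_paths M B for M :: "'w measure" and B :: "real \<Rightarrow> 'w \<Rightarrow> 'a::euclidean_space" +
  fixes V :: "'a \<Rightarrow> real" and a C :: real and y :: 'a
  assumes V_measurable [measurable]: "V \<in> borel_measurable borel" and V_nonneg: "\<And>z. 0 \<le> V z"
    and a_pos: "0 < a" and C_nonneg: "0 \<le> C" and V_ge_1: "1 \<le> V y"
    and J: "(\<integral>\<^sup>+u\<in>{1..}. ennreal (u powr (a - 1)) * exp_minus ((sigma V y u)\<^sup>2 / 8) \<partial>lborel) \<le> ennreal C"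
    and I: "(\<integral>\<^sup>+s\<in>{1..V y}. ennreal (s powr (a - 1)) * rho_weight V y s \<partial>lborel) \<le> ennreal C"
begin

text \<open>
  Monotonicity of \<open>rho\<close>, and with it measurability, is only guaranteed on \<open>s > 0\<close>, whence the cut-off.
\<close>

definition rho_profile :: "real \<Rightarrow> ennreal" where
  "rho_profile s = rho_weight V y s * indicator {1..} s"

lemma measurable_rho_profile [measurable]: "rho_profile \<in> borel_measurable borel"
  unfolding rho_profile_def[abs_def] by (rule measurable_rho_weight[OF V_nonneg])

definition moment_const :: real where "moment_const = 1 + a * sqrt (2 ^ DIM('a)) * C"

lemma moment_const_pos: "0 < moment_const"
  using a_pos C_nonneg unfolding moment_const_def by (intro add_pos_nonneg) auto

lemma moment_on_event:
  assumes "0 < t" "t \<le> 1" "A \<in> sets M"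
  shows "(\<integral>\<^sup>+\<omega>. ennreal (V (y - B t \<omega>) powr a) * indicator A \<omega> \<partial>M)
    \<le> ennreal (V y powr a * moment_const) * ennreal (sqrt (measure M A))"
proof -
  have "V y powr a * moment_const \<ge> 0" using moment_const_pos by simp
  with weighted_moment[OF V_measurable V_nonneg assms(1,2) _ a_pos C_nonneg J assms(3)] V_ge_1
  show ?thesis by (simp add: moment_const_def ennreal_mult)
qed

definition rho_const :: real where "rho_const = sqrt (2 * real DIM('a))"

lemma rho_const_pos: "0 < rho_const" by (simp add: rho_const_def)

text \<open>
  A majorant of the damping in time: \<open>fk_adj\<close> of \<open>V powr a\<close> at \<open>y\<close> is at most a multiple of
  \<open>V y powr a * envelope t\<close>. The three terms belong to those of \<open>exp_le_layers\<close>.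
\<close>

definition envelope :: "real \<Rightarrow> ennreal" where
  "envelope t = ennreal (exp (- t * V y)) + ennreal rho_const * rho_weight V y (V y) +
    (\<integral>\<^sup>+s\<in>{1..V y}. ennreal (t * V y / s\<^sup>2 * exp (- t * V y / s)) * (ennreal rho_const * rho_weight V y s) \<partial>lborel)"

lemma moment_below:
  assumes "0 \<le> r" "r < t" "t \<le> 1"
  shows "(\<integral>\<^sup>+\<omega>. (if V (y - (B t \<omega> - B r \<omega>)) < V y / s then 1 else 0) * ennreal (V (y - B t \<omega>) powr a) \<partial>M)
    \<le> ennreal (V y powr a * moment_const) * (ennreal rho_const * rho_weight V y s)"
proof -
  let ?A = "{\<omega>\<in>space M. V (y - (B t \<omega> - B r \<omega>)) < V y / s}"
  have "(\<integral>\<^sup>+\<omega>. (if V (y - (B t \<omega> - B r \<omega>)) < V y / s then 1 else 0) * ennreal (V (y - B t \<omega>) powr a) \<partial>M)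
      = (\<integral>\<^sup>+\<omega>. ennreal (V (y - B t \<omega>) powr a) * indicator ?A \<omega> \<partial>M)"
    by (intro nn_integral_cong) (auto simp: indicator_def)
  also have "\<dots> \<le> ennreal (V y powr a * moment_const) * ennreal (sqrt (measure M ?A))"
    using assms by (intro moment_on_event) auto
  also have "sqrt (measure M ?A) = rho_const * sqrt (measure M ?A / (2 * real DIM('a)))"
    by (simp add: rho_const_def real_sqrt_divide real_sqrt_mult)
  also have "ennreal \<dots> = ennreal rho_const * ennreal (sqrt (measure M ?A / (2 * real DIM('a))))"
    using rho_const_pos by (simp add: ennreal_mult)
  also have "\<dots> \<le> ennreal rho_const * rho_weight V y s"
    using assms by (intro mult_left_mono prob_below_le_rho) auto
  finally show ?thesis by (simp add: mult_left_mono)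
qed

text \<open>
  The path that ends at \<open>y\<close> at time \<open>t\<close> is at \<open>y - (B t - B r)\<close> at time \<open>r\<close> and starts at \<open>y - B t\<close>. The bound does not depend on \<open>r\<close>, so that it survives the average
  over \<open>r\<close> which Jensen's inequality introduces.
\<close>

lemma moment_damped:
  assumes r: "0 \<le> r" "r < t" and t: "t \<le> 1"
  shows "(\<integral>\<^sup>+\<omega>. ennreal (exp (- t * V (y - (B t \<omega> - B r \<omega>)))) * ennreal (V (y - B t \<omega>) powr a) \<partial>M)
    \<le> ennreal (V y powr a * moment_const) * envelope t"
proof -
  let ?Y = "\<lambda>\<omega>. y - (B t \<omega> - B r \<omega>)" and ?W = "\<lambda>\<omega>. ennreal (V (y - B t \<omega>) powr a)"
    and ?K = "ennreal (V y powr a * moment_const)"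
    and ?w = "\<lambda>s. ennreal (t * V y / s\<^sup>2 * exp (- t * V y / s))"
  have "(\<integral>\<^sup>+\<omega>. ennreal (exp (- t * V (?Y \<omega>))) * ?W \<omega> \<partial>M)
     \<le> (\<integral>\<^sup>+\<omega>. (ennreal (exp (- t * V y)) + (if V (?Y \<omega>) < 1 then 1 else 0) +
          (\<integral>\<^sup>+s\<in>{1..V y}. ?w s * (if V (?Y \<omega>) < V y / s then 1 else 0) \<partial>lborel)) * ?W \<omega> \<partial>M)"
    using r V_ge_1 V_nonneg by (intro nn_integral_mono mult_right_mono exp_le_layers) auto
  also have "\<dots> = (\<integral>\<^sup>+\<omega>. ennreal (exp (- t * V y)) * ?W \<omega> \<partial>M) + (\<integral>\<^sup>+\<omega>. (if V (?Y \<omega>) < 1 then 1 else 0) * ?W \<omega> \<partial>M)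
       + (\<integral>\<^sup>+\<omega>. (\<integral>\<^sup>+s\<in>{1..V y}. ?w s * (if V (?Y \<omega>) < V y / s then 1 else 0) \<partial>lborel) * ?W \<omega> \<partial>M)"
    unfolding distrib_right by (subst nn_integral_add, simp, simp, subst nn_integral_add) auto
  also have "(\<integral>\<^sup>+\<omega>. ennreal (exp (- t * V y)) * ?W \<omega> \<partial>M) \<le> ?K * ennreal (exp (- t * V y))"
  proof -
    have "(\<integral>\<^sup>+\<omega>. ?W \<omega> \<partial>M) = (\<integral>\<^sup>+\<omega>. ?W \<omega> * indicator (space M) \<omega> \<partial>M)"
      by (intro nn_integral_cong) auto
    also have "\<dots> \<le> ?K"
      using moment_on_event[of t "space M"] r t by (simp add: prob_space)
    finally show ?thesis
      by (subst nn_integral_cmult) (auto simp: mult.commute[of "ennreal (exp _)"] intro!: mult_right_mono)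
  qed
  also have "(\<integral>\<^sup>+\<omega>. (if V (?Y \<omega>) < 1 then 1 else 0) * ?W \<omega> \<partial>M) \<le> ?K * (ennreal rho_const * rho_weight V y (V y))"
    using moment_below[OF r t, of "V y"] V_ge_1 by simp
  also have "(\<integral>\<^sup>+\<omega>. (\<integral>\<^sup>+s\<in>{1..V y}. ?w s * (if V (?Y \<omega>) < V y / s then 1 else 0) \<partial>lborel) * ?W \<omega> \<partial>M)
     = (\<integral>\<^sup>+\<omega>. \<integral>\<^sup>+s. ?w s * indicator {1..V y} s * ((if V (?Y \<omega>) < V y / s then 1 else 0) * ?W \<omega>) \<partial>lborel \<partial>M)"
    by (intro nn_integral_cong, subst nn_integral_multc[symmetric]) (auto simp: mult_ac)
  also have "\<dots> = (\<integral>\<^sup>+s. \<integral>\<^sup>+\<omega>. ?w s * indicator {1..V y} s * ((if V (?Y \<omega>) < V y / s then 1 else 0) * ?W \<omega>) \<partial>M \<partial>lborel)"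
  proof -
    interpret L: pair_sigma_finite M lborel ..
    show ?thesis by (rule L.Fubini'[symmetric]) measurable
  qed
  also have "\<dots> = (\<integral>\<^sup>+s. ?w s * indicator {1..V y} s * (\<integral>\<^sup>+\<omega>. (if V (?Y \<omega>) < V y / s then 1 else 0) * ?W \<omega> \<partial>M) \<partial>lborel)"
    by (intro nn_integral_cong nn_integral_cmult) measurable
  also have "\<dots> \<le> (\<integral>\<^sup>+s. ?w s * indicator {1..V y} s * (?K * (ennreal rho_const * rho_profile s)) \<partial>lborel)"
  proof (rule nn_integral_mono)
    fix s
    show "?w s * indicator {1..V y} s * (\<integral>\<^sup>+\<omega>. (if V (?Y \<omega>) < V y / s then 1 else 0) * ?W \<omega> \<partial>M)
      \<le> ?w s * indicator {1..V y} s * (?K * (ennreal rho_const * rho_profile s))"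
      using moment_below[OF r t, of s] by (auto simp: rho_profile_def indicator_def intro!: mult_left_mono)
  qed
  also have "\<dots> = ?K * (\<integral>\<^sup>+s. ?w s * indicator {1..V y} s * (ennreal rho_const * rho_profile s) \<partial>lborel)"
    by (subst nn_integral_cmult[symmetric]) (auto simp: mult_ac)
  also have "(\<integral>\<^sup>+s. ?w s * indicator {1..V y} s * (ennreal rho_const * rho_profile s) \<partial>lborel)
     = (\<integral>\<^sup>+s\<in>{1..V y}. ?w s * (ennreal rho_const * rho_weight V y s) \<partial>lborel)"
    by (intro nn_integral_cong) (auto simp: rho_profile_def indicator_def)
  finally show ?thesis
    unfolding envelope_def distrib_left by (simp add: add_mono)
qed

lemma fk_adj_le_envelope:
  assumes t: "0 < t" "t \<le> 1"
  shows "fk_adj V t (\<lambda>x. ennreal (V x powr a)) y \<le> ennreal (V y powr a * moment_const) * envelope t"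
proof -
  let ?W = "\<lambda>\<omega>. ennreal (V (y - B t \<omega>) powr a)" and ?K = "ennreal (V y powr a * moment_const) * envelope t"
  have "fk_adj V t (\<lambda>x. ennreal (V x powr a)) y
     \<le> (\<integral>\<^sup>+\<omega>. ennreal (1 / t) * (\<integral>\<^sup>+r\<in>{0..t}. ennreal (exp (- t * V (y - B t \<omega> + B r \<omega>))) \<partial>lborel) * ?W \<omega> \<partial>M)"
    unfolding fk_adj_def kac_def using V_nonneg t
  proof (intro nn_integral_mono mult_right_mono exp_minus_integral_le_average)
    fix \<omega> assume [measurable]: "\<omega> \<in> space M"
    show "(\<lambda>s. V (y - B t \<omega> + B s \<omega>)) \<in> borel_measurable borel" by measurable
  qed auto
  also have "\<dots> = (\<integral>\<^sup>+\<omega>. \<integral>\<^sup>+r. ennreal (1 / t) * indicator {0..t} r * (ennreal (exp (- t * V (y - (B t \<omega> - B r \<omega>)))) * ?W \<omega>) \<partial>lborel \<partial>M)"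
  proof (intro nn_integral_cong)
    fix \<omega> assume [measurable]: "\<omega> \<in> space M"
    show "ennreal (1 / t) * (\<integral>\<^sup>+r\<in>{0..t}. ennreal (exp (- t * V (y - B t \<omega> + B r \<omega>))) \<partial>lborel) * ?W \<omega>
      = (\<integral>\<^sup>+r. ennreal (1 / t) * indicator {0..t} r * (ennreal (exp (- t * V (y - (B t \<omega> - B r \<omega>)))) * ?W \<omega>) \<partial>lborel)"
      by (subst nn_integral_cmult[symmetric], measurable, subst nn_integral_multc[symmetric], measurable)
         (auto simp: mult_ac algebra_simps intro!: nn_integral_cong)
  qed
  also have "\<dots> = (\<integral>\<^sup>+r. \<integral>\<^sup>+\<omega>. ennreal (1 / t) * indicator {0..t} r * (ennreal (exp (- t * V (y - (B t \<omega> - B r \<omega>)))) * ?W \<omega>) \<partial>M \<partial>lborel)"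
  proof -
    interpret L: pair_sigma_finite M lborel ..
    show ?thesis by (rule L.Fubini'[symmetric]) measurable
  qed
  also have "\<dots> = (\<integral>\<^sup>+r. ennreal (1 / t) * indicator {0..t} r * (\<integral>\<^sup>+\<omega>. ennreal (exp (- t * V (y - (B t \<omega> - B r \<omega>)))) * ?W \<omega> \<partial>M) \<partial>lborel)"
    by (intro nn_integral_cong nn_integral_cmult) measurable
  also have "\<dots> \<le> (\<integral>\<^sup>+r. ennreal (1 / t) * ?K * indicator {0..t} r \<partial>lborel)"
  proof (rule nn_integral_mono_AE)
    show "AE r in lborel. ennreal (1 / t) * indicator {0..t} r * (\<integral>\<^sup>+\<omega>. ennreal (exp (- t * V (y - (B t \<omega> - B r \<omega>)))) * ?W \<omega> \<partial>M)
      \<le> ennreal (1 / t) * ?K * indicator {0..t} r"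
      using AE_lborel_singleton[of t]
    proof eventually_elim
      case (elim r)
      then show ?case using moment_damped[of r t] t by (auto simp: indicator_def intro!: mult_left_mono)
    qed
  qed
  also have "\<dots> = ennreal (1 / t) * ennreal t * ?K"
    using t by (subst nn_integral_cmult) (auto simp: mult_ac)
  also have "\<dots> = ?K" using t by (simp add: ennreal_mult[symmetric])
  finally show ?thesis .
qed

text \<open>
  The weight decreases in \<open>s\<close>, so \<open>I\<close> is at least its value at the end point \<open>V y\<close> times the integral
  of \<open>s powr (a - 1)\<close>, that is \<open>(V y powr a - 1) / a\<close>. Since \<open>rho V y (V y)\<close> is the largest radius
  on which \<open>1 \<le> V\<close>, this bounds the size of \<open>V y\<close> by the distance to the set \<open>{V < 1}\<close>.
\<close>

lemma rho_weight_at_value: "ennreal (V y powr a) * rho_weight V y (V y) \<le> ennreal (a * C + 1)"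
proof -
  have e1: "rho_weight V y (V y) \<le> 1" by (simp add: rho_weight_def exp_minus_le_1)
  have "ennreal (V y powr a - 1) * rho_weight V y (V y) = ennreal (V y powr a - 1 powr a) * rho_weight V y (V y)" by simp
  also have "ennreal (V y powr a - 1 powr a) = (\<integral>\<^sup>+s. ennreal (a * s powr (a - 1)) * indicator {1..V y} s \<partial>lborel)"
    using V_ge_1 a_pos by (intro nn_integral_FTC_Icc[symmetric]) (auto intro!: derivative_eq_intros)
  also have "\<dots> * rho_weight V y (V y) = (\<integral>\<^sup>+s. ennreal (a * s powr (a - 1)) * indicator {1..V y} s * rho_weight V y (V y) \<partial>lborel)"
    by (rule nn_integral_multc[symmetric]) measurable
  also have "\<dots> \<le> (\<integral>\<^sup>+s. ennreal a * (ennreal (s powr (a - 1)) * rho_profile s * indicator {1..V y} s) \<partial>lborel)"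
    using a_pos V_nonneg by (intro nn_integral_mono) (auto simp: rho_profile_def indicator_def ennreal_mult mult.assoc intro!: mult_left_mono rho_weight_antimono)
  also have "\<dots> = ennreal a * (\<integral>\<^sup>+s. ennreal (s powr (a - 1)) * rho_profile s * indicator {1..V y} s \<partial>lborel)"
    by (rule nn_integral_cmult) measurable
  also have "(\<integral>\<^sup>+s. ennreal (s powr (a - 1)) * rho_profile s * indicator {1..V y} s \<partial>lborel)
     = (\<integral>\<^sup>+s\<in>{1..V y}. ennreal (s powr (a - 1)) * rho_weight V y s \<partial>lborel)"
    by (intro nn_integral_cong) (auto simp: rho_profile_def indicator_def)
  also have "ennreal a * \<dots> \<le> ennreal a * ennreal C" by (intro mult_left_mono I) auto
  finally have *: "ennreal (V y powr a - 1) * rho_weight V y (V y) \<le> ennreal (a * C)"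
    using a_pos C_nonneg by (simp add: ennreal_mult)
  have "1 \<le> V y powr a" using V_ge_1 a_pos by (simp add: ge_one_powr_ge_zero)
  then have "ennreal (V y powr a) = ennreal (V y powr a - 1) + 1"
    by (simp add: ennreal_plus[symmetric] ennreal_1[symmetric] del: ennreal_plus ennreal_1)
  then have "ennreal (V y powr a) * rho_weight V y (V y) = ennreal (V y powr a - 1) * rho_weight V y (V y) + rho_weight V y (V y)"
    by (simp add: distrib_right)
  also have "\<dots> \<le> ennreal (a * C) + 1" by (intro add_mono * e1)
  finally show ?thesis using a_pos C_nonneg by (simp add: ennreal_plus)
qed

text \<open>
  Under \<open>t powr (a - 1) dt\<close> the first term becomes \<open>Gamma a * V y powr (- a)\<close>, the second is
  \<open>rho_weight_at_value\<close>, and in the third \<open>\<integral> t powr a * (V y / s\<^sup>2) * exp (- t V y / s) dt\<close> equals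
  \<open>Gamma (a + 1) * V y powr (- a) * s powr (a - 1)\<close>, which leaves exactly the integral \<open>I\<close>.
\<close>

lemma envelope_time_integral:
  "ennreal (V y powr a) * (\<integral>\<^sup>+t\<in>{0<..1}. ennreal (t powr (a - 1)) * envelope t \<partial>lborel)
   \<le> ennreal (Gamma a + rho_const * (a * C + 1) * exp 1 * Gamma a + rho_const * Gamma (a + 1) * C)"
proof -
  define v where "v = V y"
  have v: "1 \<le> v" using V_ge_1 by (simp add: v_def)
  let ?w = "\<lambda>t s. ennreal (t * v / s\<^sup>2 * exp (- t * v / s))"
  have env: "envelope t = ennreal (exp (- t * v)) + ennreal rho_const * rho_weight V y v
      + (\<integral>\<^sup>+s. ?w t s * (ennreal rho_const * rho_profile s) * indicator {1..v} s \<partial>lborel)" for t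
    unfolding envelope_def rho_profile_def v_def by (intro arg_cong2[where f="(+)"] refl nn_integral_cong) (auto simp: indicator_def)
  let ?X1 = "(\<integral>\<^sup>+t\<in>{0<..1}. ennreal (t powr (a - 1)) * ennreal (exp (- t * v)) \<partial>lborel)"
  let ?X2 = "(\<integral>\<^sup>+t\<in>{0<..1}. ennreal (t powr (a - 1)) * (ennreal rho_const * rho_weight V y v) \<partial>lborel)"
  let ?X3 = "(\<integral>\<^sup>+t\<in>{0<..1}. ennreal (t powr (a - 1)) * (\<integral>\<^sup>+s. ?w t s * (ennreal rho_const * rho_profile s) * indicator {1..v} s \<partial>lborel) \<partial>lborel)"
  have split: "(\<integral>\<^sup>+t\<in>{0<..1}. ennreal (t powr (a - 1)) * envelope t \<partial>lborel)
     = ?X1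
     + ?X2
     + ?X3"
    unfolding env distrib_left distrib_right by (subst nn_integral_add, simp, simp, subst nn_integral_add) auto
  have b1: "ennreal (v powr a) * ?X1 \<le> ennreal (Gamma a)"
  proof -
    have "?X1
       \<le> (\<integral>\<^sup>+t\<in>{0<..}. ennreal (t powr (a - 1) * exp (- v * t)) \<partial>lborel)"
      by (intro nn_integral_mono) (auto simp: indicator_def ennreal_mult[symmetric] mult_ac)
    also have "\<dots> = ennreal (Gamma a * v powr (- a))"
      using a_pos v by (intro nn_integral_Gamma_scaled) auto
    finally have "ennreal (v powr a) * ?X1
      \<le> ennreal (v powr a) * ennreal (Gamma a * v powr (- a))" by (intro mult_left_mono) auto
    also have "\<dots> = ennreal (Gamma a)"
      using v a_pos by (simp add: ennreal_mult'[symmetric] powr_minus field_simps)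
    finally show ?thesis .
  qed
  have b2: "ennreal (v powr a) * ?X2
     \<le> ennreal (rho_const * (a * C + 1) * exp 1 * Gamma a)"
  proof -
    have "?X2
       = ennreal rho_const * rho_weight V y v * (\<integral>\<^sup>+t\<in>{0<..1}. ennreal (t powr (a - 1)) \<partial>lborel)"
      by (subst nn_integral_cmult[symmetric]) (auto simp: mult_ac)
    also have "ennreal (v powr a) * \<dots> = (ennreal (v powr a) * rho_weight V y v) * (ennreal rho_const * (\<integral>\<^sup>+t\<in>{0<..1}. ennreal (t powr (a - 1)) \<partial>lborel))"
      by (simp only: mult_ac)
    also have "\<dots> \<le> ennreal (a * C + 1) * (ennreal rho_const * ennreal (exp 1 * Gamma a))"
      using a_pos by (intro mult_mono rho_weight_at_value[folded v_def] nn_integral_powr_unit_le order_refl) auto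
    also have "\<dots> = ennreal (rho_const * (a * C + 1) * exp 1 * Gamma a)"
    proof -
      have "rho_const * (a * C + 1) * exp 1 * Gamma a = (a * C + 1) * (rho_const * (exp 1 * Gamma a))" by simp
      then show ?thesis
        using a_pos C_nonneg rho_const_pos by (simp only: ennreal_mult Gamma_real_nonneg add_nonneg_nonneg mult_nonneg_nonneg less_imp_le exp_ge_zero zero_le_one)
    qed
    finally show ?thesis .
  qed
  have b3: "ennreal (v powr a) * ?X3
     \<le> ennreal (rho_const * Gamma (a + 1) * C)"
  proof -
    have "?X3
      = (\<integral>\<^sup>+t. \<integral>\<^sup>+s. ennreal (t powr (a - 1)) * indicator {0<..1} t * (?w t s * (ennreal rho_const * rho_profile s) * indicator {1..v} s) \<partial>lborel \<partial>lborel)"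
      by (intro nn_integral_cong, subst nn_integral_cmult) (auto simp: mult_ac)
    also have "\<dots> = (\<integral>\<^sup>+s. \<integral>\<^sup>+t. ennreal (t powr (a - 1)) * indicator {0<..1} t * (?w t s * (ennreal rho_const * rho_profile s) * indicator {1..v} s) \<partial>lborel \<partial>lborel)"
      by (rule lborel_pair.Fubini') measurable
    also have "\<dots> \<le> (\<integral>\<^sup>+s. ennreal (rho_const * Gamma (a + 1) * v powr (- a)) * (ennreal (s powr (a - 1)) * rho_profile s * indicator {1..v} s) \<partial>lborel)"
    proof (rule nn_integral_mono)
      fix s :: real
      show "(\<integral>\<^sup>+t. ennreal (t powr (a - 1)) * indicator {0<..1} t * (?w t s * (ennreal rho_const * rho_profile s) * indicator {1..v} s) \<partial>lborel)
        \<le> ennreal (rho_const * Gamma (a + 1) * v powr (- a)) * (ennreal (s powr (a - 1)) * rho_profile s * indicator {1..v} s)"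
      proof (cases "s \<in> {1..v}")
        case True
        have "(\<integral>\<^sup>+t. ennreal (t powr (a - 1)) * indicator {0<..1} t * (?w t s * (ennreal rho_const * rho_profile s) * indicator {1..v} s) \<partial>lborel)
          \<le> (\<integral>\<^sup>+t. ennreal (rho_const * v / s\<^sup>2) * rho_profile s * (ennreal (t powr (a + 1 - 1) * exp (- (v / s) * t)) * indicator {0<..} t) \<partial>lborel)"
        proof (rule nn_integral_mono)
          fix t :: real
          have "t powr (a - 1) * (t * v / s\<^sup>2 * exp (- t * v / s)) * rho_const = rho_const * v / s\<^sup>2 * (t powr (a + 1 - 1) * exp (- (v / s) * t))" if "0 < t"
            using that by (simp add: powr_diff mult_ac)
          then have key: "ennreal (t powr (a - 1)) * ?w t s * ennreal rho_const = ennreal (rho_const * v / s\<^sup>2) * ennreal (t powr (a + 1 - 1) * exp (- (v / s) * t))" if "0 < t"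
            using that v rho_const_pos by (simp only: ennreal_mult[symmetric] powr_ge_zero mult_nonneg_nonneg exp_ge_zero divide_nonneg_nonneg zero_le_power2 less_imp_le order_trans[OF zero_le_one])
          show "ennreal (t powr (a - 1)) * indicator {0<..1} t * (?w t s * (ennreal rho_const * rho_profile s) * indicator {1..v} s)
            \<le> ennreal (rho_const * v / s\<^sup>2) * rho_profile s * (ennreal (t powr (a + 1 - 1) * exp (- (v / s) * t)) * indicator {0<..} t)"
          proof (cases "0 < t \<and> t \<le> 1")
            case t: True
            then have "ennreal (t powr (a - 1)) * indicator {0<..1} t * (?w t s * (ennreal rho_const * rho_profile s) * indicator {1..v} s)
                = (ennreal (t powr (a - 1)) * ?w t s * ennreal rho_const) * rho_profile s"
              using True by (simp only: mult_ac indicator_simps greaterThanAtMost_iff simp_thms) simp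
            also have "\<dots> = (ennreal (rho_const * v / s\<^sup>2) * ennreal (t powr (a + 1 - 1) * exp (- (v / s) * t))) * rho_profile s"
              using key t by simp
            also have "\<dots> = ennreal (rho_const * v / s\<^sup>2) * rho_profile s * (ennreal (t powr (a + 1 - 1) * exp (- (v / s) * t)) * indicator {0<..} t)"
              using t by (simp only: mult_ac indicator_simps greaterThan_iff simp_thms) simp
            finally show ?thesis by simp
          qed auto
        qed
        also have "\<dots> = ennreal (rho_const * v / s\<^sup>2) * rho_profile s * ennreal (Gamma (a + 1) * (v / s) powr (- (a + 1)))"
          using True v a_pos by (subst nn_integral_cmult, simp, subst nn_integral_Gamma_scaled) auto
        also have "\<dots> = ennreal (rho_const * v / s\<^sup>2 * (Gamma (a + 1) * (v / s) powr (- (a + 1)))) * rho_profile s"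
          using v rho_const_pos a_pos by (subst ennreal_mult) (auto simp: mult_ac Gamma_real_nonneg)
        also have "rho_const * v / s\<^sup>2 * (Gamma (a + 1) * (v / s) powr (- (a + 1))) = rho_const * Gamma (a + 1) * v powr (- a) * s powr (a - 1)"
        proof -
          have s: "0 < s" using True by simp
          have "v / s\<^sup>2 * (v / s) powr (- (a + 1)) = v powr (- a) * s powr (a - 1)"
            using v s by (simp add: powr_divide powr_minus powr_add powr_diff power2_eq_square field_simps)
          then have "rho_const * Gamma (a + 1) * (v / s\<^sup>2 * (v / s) powr (- (a + 1))) = rho_const * Gamma (a + 1) * (v powr (- a) * s powr (a - 1))"
            by simp
          then show ?thesis by (simp only: mult_ac times_divide_eq_right times_divide_eq_left)
        qed
        finally show ?thesis
          using True rho_const_pos a_pos by (simp add: ennreal_mult Gamma_real_nonneg mult.assoc)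
      qed simp
    qed
    also have "\<dots> = ennreal (rho_const * Gamma (a + 1) * v powr (- a)) * (\<integral>\<^sup>+s. ennreal (s powr (a - 1)) * rho_profile s * indicator {1..v} s \<partial>lborel)"
      by (rule nn_integral_cmult) measurable
    also have "(\<integral>\<^sup>+s. ennreal (s powr (a - 1)) * rho_profile s * indicator {1..v} s \<partial>lborel) = (\<integral>\<^sup>+s\<in>{1..V y}. ennreal (s powr (a - 1)) * rho_weight V y s \<partial>lborel)"
      unfolding rho_profile_def v_def by (intro nn_integral_cong) (auto simp: indicator_def)
    also have "ennreal (rho_const * Gamma (a + 1) * v powr (- a)) * \<dots> \<le> ennreal (rho_const * Gamma (a + 1) * v powr (- a)) * ennreal C"
      by (intro mult_left_mono I) auto
    finally have "ennreal (v powr a) * ?X3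
       \<le> ennreal (v powr a) * (ennreal (rho_const * Gamma (a + 1) * v powr (- a)) * ennreal C)"
      by (intro mult_left_mono) auto
    also have "\<dots> = ennreal (rho_const * Gamma (a + 1) * C)"
      using v a_pos C_nonneg rho_const_pos by (simp add: ennreal_mult[symmetric] Gamma_real_nonneg powr_minus field_simps)
    finally show ?thesis .
  qed
  have "ennreal (v powr a) * (\<integral>\<^sup>+t\<in>{0<..1}. ennreal (t powr (a - 1)) * envelope t \<partial>lborel)
     \<le> ennreal (Gamma a) + ennreal (rho_const * (a * C + 1) * exp 1 * Gamma a) + ennreal (rho_const * Gamma (a + 1) * C)"
    unfolding split distrib_left[of "ennreal (v powr a)"] by (intro add_mono b1 b2 b3)
  also have "\<dots> = ennreal (Gamma a + rho_const * (a * C + 1) * exp 1 * Gamma a + rho_const * Gamma (a + 1) * C)"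
    using a_pos C_nonneg rho_const_pos by (simp add: ennreal_plus Gamma_real_nonneg)
  finally show ?thesis by (simp add: v_def)
qed

lemma measurable_envelope: "envelope \<in> borel_measurable borel"
proof -
  have "envelope = (\<lambda>t. ennreal (exp (- t * V y)) + ennreal rho_const * rho_weight V y (V y)
      + (\<integral>\<^sup>+s. ennreal (t * V y / s\<^sup>2 * exp (- t * V y / s)) * (ennreal rho_const * rho_profile s) * indicator {1..V y} s \<partial>lborel))"
    unfolding envelope_def[abs_def] rho_profile_def by (intro ext arg_cong2[where f="(+)"] refl nn_integral_cong) (auto simp: indicator_def)
  also have "\<dots> \<in> borel_measurable borel" by measurable
  finally show ?thesis .
qed

lemma fk_adj_time_integral:
  "(\<integral>\<^sup>+t\<in>{0<..1}. ennreal (t powr (a - 1)) * fk_adj V t (\<lambda>x. ennreal (V x powr a)) y \<partial>lborel)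
   \<le> ennreal (moment_const * (Gamma a + rho_const * (a * C + 1) * exp 1 * Gamma a + rho_const * Gamma (a + 1) * C))"
proof -
  note [measurable] = measurable_envelope
  have "(\<integral>\<^sup>+t\<in>{0<..1}. ennreal (t powr (a - 1)) * fk_adj V t (\<lambda>x. ennreal (V x powr a)) y \<partial>lborel)
     \<le> (\<integral>\<^sup>+t\<in>{0<..1}. ennreal (t powr (a - 1)) * (ennreal (V y powr a * moment_const) * envelope t) \<partial>lborel)"
    using fk_adj_le_envelope by (intro nn_integral_mono) (auto simp: indicator_def intro!: mult_left_mono)
  also have "\<dots> = ennreal moment_const * (ennreal (V y powr a) * (\<integral>\<^sup>+t\<in>{0<..1}. ennreal (t powr (a - 1)) * envelope t \<partial>lborel))"
    using moment_const_pos
    by (simp add: mult.assoc[symmetric] ennreal_mult[symmetric], subst nn_integral_cmult[symmetric])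
       (auto simp: ennreal_mult mult_ac)
  also have "\<dots> \<le> ennreal moment_const * ennreal (Gamma a + rho_const * (a * C + 1) * exp 1 * Gamma a + rho_const * Gamma (a + 1) * C)"
    by (intro mult_left_mono envelope_time_integral) auto
  finally show ?thesis using moment_const_pos by (simp add: ennreal_mult')
qed

end

context brownian_paths
begin

section \<open>All points\<close>

text \<open>For a fixed path, translate the starting point: \<open>y = x + B t\<close>.\<close>

lemma fk_dual:
  assumes [measurable]: "V \<in> borel_measurable borel" "F \<in> borel_measurable borel" "g \<in> borel_measurable borel"
  shows "(\<integral>\<^sup>+x. F x * fk V t g x \<partial>lborel) = (\<integral>\<^sup>+y. fk_adj V t F y * g y \<partial>lborel)"
proof -
  interpret L: pair_sigma_finite lborel M ..
  have "(\<integral>\<^sup>+x. F x * fk V t g x \<partial>lborel) = (\<integral>\<^sup>+x. \<integral>\<^sup>+\<omega>. F x * (kac V t x \<omega> * g (x + B t \<omega>)) \<partial>M \<partial>lborel)"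
    unfolding fk_def by (intro nn_integral_cong nn_integral_cmult[symmetric]) measurable
  also have "\<dots> = (\<integral>\<^sup>+\<omega>. \<integral>\<^sup>+x. F x * (kac V t x \<omega> * g (x + B t \<omega>)) \<partial>lborel \<partial>M)"
    by (rule L.Fubini'[symmetric]) measurable
  also have "\<dots> = (\<integral>\<^sup>+\<omega>. \<integral>\<^sup>+y. kac V t (y - B t \<omega>) \<omega> * F (y - B t \<omega>) * g y \<partial>lborel \<partial>M)"
  proof (rule nn_integral_cong)
    fix \<omega> assume [measurable]: "\<omega> \<in> space M"
    show "(\<integral>\<^sup>+x. F x * (kac V t x \<omega> * g (x + B t \<omega>)) \<partial>lborel) = (\<integral>\<^sup>+y. kac V t (y - B t \<omega>) \<omega> * F (y - B t \<omega>) * g y \<partial>lborel)"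
      using nn_integral_lborel_shift[of "\<lambda>y. kac V t (y - B t \<omega>) \<omega> * F (y - B t \<omega>) * g y" "B t \<omega>"]
      by (simp add: mult_ac)
  qed
  also have "\<dots> = (\<integral>\<^sup>+y. \<integral>\<^sup>+\<omega>. kac V t (y - B t \<omega>) \<omega> * F (y - B t \<omega>) * g y \<partial>M \<partial>lborel)"
    by (rule L.Fubini') measurable
  also have "\<dots> = (\<integral>\<^sup>+y. fk_adj V t F y * g y \<partial>lborel)"
    unfolding fk_adj_def by (intro nn_integral_cong nn_integral_multc) measurable
  finally show ?thesis .
qed

text \<open>Growth that the heat kernel dominates is harmless even if the damping factor is estimated by \<open>1\<close>.\<close>

lemma fk_adj_le_Gaussian:
  assumes t: "0 < t" "t \<le> 1" and K: "0 \<le> K"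
    and F: "AE z in lborel. F z \<le> ennreal (K * exp (3/8 * (norm (y - z))\<^sup>2))"
  shows "fk_adj V t F y \<le> ennreal (K * 2 ^ DIM('a))"
proof -
  have "AE \<omega> in M. F (y - (B t \<omega> - B 0 \<omega>)) \<le> ennreal (K * exp (3/8 * (norm (y - (y - (B t \<omega> - B 0 \<omega>))))\<^sup>2))"
    using t by (intro AE_increment AE_lborel_reflect F) auto
  then have "AE \<omega> in M. kac V t (y - B t \<omega>) \<omega> * F (y - B t \<omega>) \<le> ennreal K * ennreal (exp (3/8 * (norm (B t \<omega> - B 0 \<omega>))\<^sup>2))"
  proof eventually_elim
    case (elim \<omega>)
    then have "kac V t (y - B t \<omega>) \<omega> * F (y - B t \<omega>) \<le> 1 * ennreal (K * exp (3/8 * (norm (B t \<omega>))\<^sup>2))"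
      by (intro mult_mono kac_le_1) auto
    then show ?case using K by (simp add: ennreal_mult)
  qed
  then have "fk_adj V t F y \<le> (\<integral>\<^sup>+\<omega>. ennreal K * ennreal (exp (3/8 * (norm (B t \<omega> - B 0 \<omega>))\<^sup>2)) \<partial>M)"
    unfolding fk_adj_def by (rule nn_integral_mono_AE)
  also have "\<dots> = ennreal K * (\<integral>\<^sup>+\<omega>. ennreal (exp (3/8 * (norm (B t \<omega> - B 0 \<omega>))\<^sup>2)) \<partial>M)"
    by (rule nn_integral_cmult) measurable
  also have "\<dots> \<le> ennreal K * ennreal (2 ^ DIM('a))"
    using t by (intro mult_left_mono increment_exp_square) auto
  finally show ?thesis using K by (simp add: ennreal_mult)
qed

lemma fk_adj_time_integral_Gaussian:
  assumes a: "0 < a" and K: "0 \<le> K"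
    and F: "AE z in lborel. F z \<le> ennreal (K * exp (3/8 * (norm (y - z))\<^sup>2))"
  shows "(\<integral>\<^sup>+t\<in>{0<..1}. ennreal (t powr (a - 1)) * fk_adj V t F y \<partial>lborel) \<le> ennreal (K * 2 ^ DIM('a) * (exp 1 * Gamma a))"
proof -
  have "(\<integral>\<^sup>+t\<in>{0<..1}. ennreal (t powr (a - 1)) * fk_adj V t F y \<partial>lborel)
     \<le> (\<integral>\<^sup>+t. ennreal (K * 2 ^ DIM('a)) * (ennreal (t powr (a - 1)) * indicator {0<..1} t) \<partial>lborel)"
    using fk_adj_le_Gaussian[OF _ _ K F] by (intro nn_integral_mono) (auto simp: indicator_def mult.commute[of "ennreal (K * _)"] intro!: mult_left_mono)
  also have "\<dots> \<le> ennreal (K * 2 ^ DIM('a)) * ennreal (exp 1 * Gamma a)"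
    using a by (subst nn_integral_cmult) (auto intro!: mult_left_mono nn_integral_powr_unit_le)
  finally show ?thesis using a K by (simp add: ennreal_mult Gamma_real_nonneg)
qed

text \<open>
  By definition of \<open>rho\<close> the potential is at least \<open>1\<close> almost everywhere on balls around \<open>z\<close> of radius
  less than \<open>rho V z (V z)\<close>, so \<open>V y < 1\<close> forces \<open>y\<close> to be at least that far from \<open>z\<close>; then
  \<open>rho_weight_at_value\<close> limits \<open>V z\<close>.
\<close>

lemma far_from_small_values:
  assumes "large_value M B V a C z"
  shows "AE y in lborel. V y < 1 \<longrightarrow> V z powr a \<le> (a * C + 1) * exp ((norm (y - z))\<^sup>2 / (4 * real DIM('a)))"
proof -
  interpret large_value M B V a C z by fact
  let ?A = "{ennreal r |r. 0 \<le> r \<and> (AE y in lborel. y \<in> cball z r \<longrightarrow> 1 \<le> V y)}"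
  have "?A \<noteq> {}" using AE_cball_0[of z "\<lambda>y. 1 \<le> V y"] by blast
  from ennreal_Sup_countable_SUP[OF this] obtain f :: "nat \<Rightarrow> ennreal"
    where f: "range f \<subseteq> ?A" "Sup ?A = (SUP n. f n)" by blast
  have rho: "rho V z (V z) = Sup ?A"
    using V_ge_1 by (simp add: rho_def AE_completion_iff)
  have "AE y in lborel. V y < 1 \<longrightarrow> f n \<le> ennreal (norm (y - z))" for n
  proof -
    obtain r where r: "f n = ennreal r" "0 \<le> r" "AE y in lborel. y \<in> cball z r \<longrightarrow> 1 \<le> V y"
      using f(1) by blast
    from r(3) show ?thesis
      by eventually_elim (auto simp: r(1) dist_norm norm_minus_commute not_le intro!: ennreal_leI)
  qed
  then have "AE y in lborel. \<forall>n. V y < 1 \<longrightarrow> f n \<le> ennreal (norm (y - z))" by (subst AE_all_countable) simp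
  then show ?thesis
  proof eventually_elim
    case (elim y)
    show ?case
    proof
      assume "V y < 1"
      with elim have "rho V z (V z) \<le> ennreal (norm (y - z))"
        unfolding rho f(2) by (auto intro: SUP_least)
      then have "exp_minus ((ennreal (norm (y - z)))\<^sup>2 / of_nat (4 * DIM('a))) \<le> rho_weight V z (V z)"
        unfolding rho_weight_def by (intro exp_minus_antimono divide_right_mono_ennreal power_mono) auto
      also have "(ennreal (norm (y - z)))\<^sup>2 / of_nat (4 * DIM('a)) = ennreal ((norm (y - z))\<^sup>2 / (4 * real DIM('a)))"
        unfolding ennreal_of_nat_eq_real_of_nat by (simp add: ennreal_power divide_ennreal)
      finally have "ennreal (exp (- ((norm (y - z))\<^sup>2 / (4 * real DIM('a))))) \<le> rho_weight V z (V z)"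
        by (simp add: exp_minus_ennreal)
      then have "ennreal (V z powr a) * ennreal (exp (- ((norm (y - z))\<^sup>2 / (4 * real DIM('a))))) \<le> ennreal (a * C + 1)"
        using rho_weight_at_value by (meson mult_left_mono order_trans zero_le)
      then have "V z powr a * exp (- ((norm (y - z))\<^sup>2 / (4 * real DIM('a)))) \<le> a * C + 1"
        using a_pos C_nonneg by (simp add: ennreal_mult[symmetric] ennreal_le_iff del: ennreal_plus)
      then show "V z powr a \<le> (a * C + 1) * exp ((norm (y - z))\<^sup>2 / (4 * real DIM('a)))"
        by (simp add: exp_minus field_simps)
    qed
  qed
qed

lemma fk_adj_time_integral_bounded:
  assumes V[measurable]: "V \<in> borel_measurable borel" and V0: "\<And>z. 0 \<le> V z"
    and a: "0 < a" and C1: "0 < C1" and growth: "\<And>z. V z \<le> C1 * exp ((norm z)\<^sup>2 / (4 * a))"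
    and F: "compact F" and C: "0 \<le> C"
    and IJ: "AE x in lborel. x \<notin> F \<longrightarrow> J_fun a V x \<le> ennreal C \<and> I_fun a V x \<le> ennreal C"
  shows "\<exists>K\<ge>0. AE y in lborel. (\<integral>\<^sup>+t\<in>{0<..1}. ennreal (t powr (a - 1)) * fk_adj V t (\<lambda>x. ennreal (V x powr a)) y \<partial>lborel) \<le> ennreal K"
proof -
  let ?T = "\<lambda>y. \<integral>\<^sup>+t\<in>{0<..1}. ennreal (t powr (a - 1)) * fk_adj V t (\<lambda>x. ennreal (V x powr a)) y \<partial>lborel"
  have [measurable]: "F \<in> sets borel" using F by (simp add: borel_closed compact_imp_closed)
  obtain R where R: "\<And>x. x \<in> F \<Longrightarrow> norm x \<le> R"
    using compact_imp_bounded[OF F] unfolding bounded_iff by blast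
  have growth_a: "V z powr a \<le> C1 powr a * exp ((norm z)\<^sup>2 / 4)" for z
  proof -
    have "V z powr a \<le> (C1 * exp ((norm z)\<^sup>2 / (4 * a))) powr a"
      using a V0 growth by (intro powr_mono2) auto
    also have "\<dots> = C1 powr a * exp ((norm z)\<^sup>2 / 4)"
      using a C1 by (simp add: powr_mult exp_powr_real)
    finally show ?thesis .
  qed
  have large: "AE y in lborel. y \<notin> F \<longrightarrow> 1 \<le> V y \<longrightarrow> large_value M B V a C y"
    using IJ
  proof eventually_elim
    case (elim y)
    show ?case
    proof (intro impI)
      assume y: "y \<notin> F" "1 \<le> V y"
      then have "min 1 (V y powr a) = 1" "max 1 (V y) = V y"
        using a by (auto simp: ge_one_powr_ge_zero)
      with elim y show "large_value M B V a C y"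
        using V0 a C by unfold_locales (auto simp: J_fun_def I_fun_def nn_integral_completion rho_weight_def)
    qed
  qed
  have near: "AE y in lborel. AE z in lborel. V y < 1 \<longrightarrow> 1 \<le> V z \<longrightarrow> z \<notin> F \<longrightarrow>
      V z powr a \<le> (a * C + 1) * exp ((norm (y - z))\<^sup>2 / (4 * real DIM('a)))"
  proof -
    have "AE z in lborel. AE y in lborel. V y < 1 \<longrightarrow> 1 \<le> V z \<longrightarrow> z \<notin> F \<longrightarrow>
        V z powr a \<le> (a * C + 1) * exp ((norm (y - z))\<^sup>2 / (4 * real DIM('a)))"
      using large
    proof eventually_elim
      case (elim z)
      show ?case
      proof (cases "1 \<le> V z \<and> z \<notin> F")
        case True
        with elim far_from_small_values[of V a C z] show ?thesis by simp
      qed auto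
    qed
    then show ?thesis by (subst lborel_pair.AE_commute) measurable
  qed
  \<comment> \<open>The constants for points in \<open>F\<close>, for points with \<open>V y < 1\<close>, and for the remaining points. The
    summands of \<open>K2\<close> bound \<open>V z powr a\<close>, up to the Gaussian, if \<open>V z < 1\<close>, if \<open>z \<in> F\<close>, and otherwise.\<close>
  define K1 where "K1 = C1 powr a * exp (3/4 * R\<^sup>2)"
  define K2 where "K2 = 1 + C1 powr a * exp (R\<^sup>2 / 4) + (a * C + 1)"
  define K3 where "K3 = large_value.moment_const TYPE('a) a C * (Gamma a + large_value.rho_const TYPE('a) * (a * C + 1) * exp 1 * Gamma a + large_value.rho_const TYPE('a) * Gamma (a + 1) * C)"
  define K where "K = K1 * 2 ^ DIM('a) * (exp 1 * Gamma a) + K2 * 2 ^ DIM('a) * (exp 1 * Gamma a) + \<bar>K3\<bar>"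
  have nonneg: "0 \<le> K1" "0 \<le> K2" using a C by (auto simp: K1_def K2_def)
  have Kle: "K1 * 2 ^ DIM('a) * (exp 1 * Gamma a) \<le> K" "K2 * 2 ^ DIM('a) * (exp 1 * Gamma a) \<le> K" "K3 \<le> K" "0 \<le> K"
  proof -
    have "0 \<le> K1 * 2 ^ DIM('a) * (exp 1 * Gamma a)" "0 \<le> K2 * 2 ^ DIM('a) * (exp 1 * Gamma a)"
      using nonneg a by (simp_all add: Gamma_real_nonneg)
    then show "K1 * 2 ^ DIM('a) * (exp 1 * Gamma a) \<le> K" "K2 * 2 ^ DIM('a) * (exp 1 * Gamma a) \<le> K" "K3 \<le> K" "0 \<le> K"
      unfolding K_def by linarith+
  qed
  have "AE y in lborel. ?T y \<le> ennreal K"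
    using large near
  proof eventually_elim
    case (elim y)
    consider "y \<in> F" | "y \<notin> F" "1 \<le> V y" | "V y < 1" by linarith
    then show ?case
    proof cases
      case 1
      have "ennreal (V z powr a) \<le> ennreal (K1 * exp (3/8 * (norm (y - z))\<^sup>2))" for z
      proof (rule ennreal_leI)
        have "norm z \<le> R + norm (y - z)" using R[OF 1] norm_triangle_ineq4[of y "y - z"] by simp
        then have "(norm z)\<^sup>2 \<le> (R + norm (y - z))\<^sup>2" by (intro power_mono) auto
        also have "\<dots> \<le> 3 * R\<^sup>2 + 3/2 * (norm (y - z))\<^sup>2"
          using zero_le_power2[of "2 * R - norm (y - z)"] by (simp add: power2_eq_square algebra_simps)
        finally have "(norm z)\<^sup>2 / 4 \<le> 3/4 * R\<^sup>2 + 3/8 * (norm (y - z))\<^sup>2" by simp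
        then have "C1 powr a * exp ((norm z)\<^sup>2 / 4) \<le> C1 powr a * exp (3/4 * R\<^sup>2 + 3/8 * (norm (y - z))\<^sup>2)"
          by (intro mult_left_mono) auto
        with growth_a[of z] show "V z powr a \<le> K1 * exp (3/8 * (norm (y - z))\<^sup>2)"
          by (simp add: K1_def exp_add mult.assoc)
      qed
      then have "?T y \<le> ennreal (K1 * 2 ^ DIM('a) * (exp 1 * Gamma a))"
        by (intro fk_adj_time_integral_Gaussian a nonneg) auto
      then show ?thesis using Kle(1) by (meson ennreal_leI order_trans)
    next
      case 2
      with elim have "large_value M B V a C y" by simp
      from large_value.fk_adj_time_integral[OF this] show ?thesis
        using Kle(3) unfolding K3_def by (meson ennreal_leI order_trans)
    next
      case 3
      have "AE z in lborel. ennreal (V z powr a) \<le> ennreal (K2 * exp (3/8 * (norm (y - z))\<^sup>2))"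
        using elim(2)
      proof eventually_elim
        case (elim z)
        have e1: "1 \<le> exp (3/8 * (norm (y - z))\<^sup>2)" by simp
        have le1: "V z powr a \<le> k \<Longrightarrow> 0 \<le> k \<Longrightarrow> k \<le> K2 \<Longrightarrow> V z powr a \<le> K2 * exp (3/8 * (norm (y - z))\<^sup>2)" for k
          using mult_mono[of k K2 1 "exp (3/8 * (norm (y - z))\<^sup>2)"] e1 nonneg by simp
        consider "V z < 1" | "z \<in> F" | "1 \<le> V z" "z \<notin> F" by linarith
        then have "V z powr a \<le> K2 * exp (3/8 * (norm (y - z))\<^sup>2)"
        proof cases
          case 1
          then have "V z powr a \<le> 1" using a V0 by (intro powr_le1) auto
          then show ?thesis by (rule le1) (use a C in \<open>auto simp: K2_def\<close>)
        next
          case 2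
          have "(norm z)\<^sup>2 \<le> R\<^sup>2" using R[OF 2] by (intro power_mono) auto
          then have "C1 powr a * exp ((norm z)\<^sup>2 / 4) \<le> C1 powr a * exp (R\<^sup>2 / 4)" by (intro mult_left_mono) auto
          with growth_a[of z] have "V z powr a \<le> C1 powr a * exp (R\<^sup>2 / 4)" by simp
          then show ?thesis by (rule le1) (use a C in \<open>auto simp: K2_def\<close>)
        next
          case z: 3
          have "(norm (y - z))\<^sup>2 / (4 * real DIM('a)) \<le> (norm (y - z))\<^sup>2 / (4 * 1)"
            by (intro divide_left_mono mult_left_mono) (auto simp: Suc_leI)
          also have "\<dots> \<le> 3/8 * (norm (y - z))\<^sup>2" by simp
          finally have "(a * C + 1) * exp ((norm (y - z))\<^sup>2 / (4 * real DIM('a))) \<le> K2 * exp (3/8 * (norm (y - z))\<^sup>2)"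
            using a C by (intro mult_mono) (auto simp: K2_def)
          with elim 3 z show ?thesis by simp
        qed
        then show ?case by (rule ennreal_leI)
      qed
      then have "?T y \<le> ennreal (K2 * 2 ^ DIM('a) * (exp 1 * Gamma a))"
        by (intro fk_adj_time_integral_Gaussian a nonneg)
      then show ?thesis using Kle(2) by (meson ennreal_leI order_trans)
    qed
  qed
  with Kle(4) show ?thesis by blast
qed

end

section \<open>The bound on integrable functions\<close>

lemma suminf_exp_geometric:
  assumes "0 < \<delta>"
  shows "(\<Sum>n. ennreal (exp (- \<delta> * real n))) = ennreal (1 / (1 - exp (- \<delta>)))"
proof (rule suminf_ennreal_eq)
  have "(\<lambda>n. exp (- \<delta>) ^ n) sums (1 / (1 - exp (- \<delta>)))"
    using assms by (intro geometric_sums) simp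
  then show "(\<lambda>n. exp (- \<delta> * real n)) sums (1 / (1 - exp (- \<delta>)))"
    by (simp add: exp_of_nat_mult[symmetric] mult.commute)
qed simp

lemma nn_integral_unit_intervals:
  fixes h :: "real \<Rightarrow> ennreal"
  assumes [measurable]: "h \<in> borel_measurable borel"
  shows "(\<integral>\<^sup>+t\<in>{0<..}. h t \<partial>lborel) = (\<Sum>n. \<integral>\<^sup>+t\<in>{0<..1}. h (t + real n) \<partial>lborel)"
proof -
  have "{0<..} = (\<Union>n. {real n<..real n + 1})"
  proof (intro equalityI subsetI)
    fix t :: real assume "t \<in> {0<..}"
    then have "t \<in> {real (nat (\<lceil>t\<rceil> - 1))<..real (nat (\<lceil>t\<rceil> - 1)) + 1}"
      by (auto simp: of_nat_nat) linarith+
    then show "t \<in> (\<Union>n. {real n<..real n + 1})" by blast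
  qed auto
  then have "(\<integral>\<^sup>+t\<in>{0<..}. h t \<partial>lborel) = (\<integral>\<^sup>+t\<in>(\<Union>n. {real n<..real n + 1}). h t \<partial>lborel)" by simp
  also have "\<dots> = (\<Sum>n. \<integral>\<^sup>+t\<in>{real n<..real n + 1}. h t \<partial>lborel)"
  proof (rule nn_integral_disjoint_family)
    show "disjoint_family (\<lambda>n. {real n<..real n + 1})"
    proof (unfold disjoint_family_on_def, intro ballI impI)
      fix m n :: nat assume "m \<noteq> n"
      then have "real m + 1 \<le> real n \<or> real n + 1 \<le> real m" by linarith
      then show "{real m<..real m + 1} \<inter> {real n<..real n + 1} = {}" by auto
    qed
  qed auto
  also have "\<dots> = (\<Sum>n. \<integral>\<^sup>+t\<in>{0<..1}. h (t + real n) \<partial>lborel)"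
  proof (rule suminf_cong)
    fix n :: nat
    show "(\<integral>\<^sup>+t\<in>{real n<..real n + 1}. h t \<partial>lborel) = (\<integral>\<^sup>+t\<in>{0<..1}. h (t + real n) \<partial>lborel)"
      using nn_integral_lborel_shift[of "\<lambda>t. h t * indicator {real n<..real n + 1} t" "real n"]
      by (simp add: indicator_def add.commute)
  qed
  finally show ?thesis .
qed

context brownian_paths
begin

lemma weighted_unit_time_bound:
  assumes [measurable]: "V \<in> borel_measurable borel" "F \<in> borel_measurable borel" "g \<in> borel_measurable borel"
    and K: "AE y in lborel. (\<integral>\<^sup>+t\<in>{0<..1}. ennreal (t powr (a - 1)) * fk_adj V t F y \<partial>lborel) \<le> K"
  shows "(\<integral>\<^sup>+x. F x * (\<integral>\<^sup>+t\<in>{0<..1}. fk V t g x * ennreal (t powr (a - 1)) \<partial>lborel) \<partial>lborel) \<le> K * (\<integral>\<^sup>+y. g y \<partial>lborel)"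
proof -
  let ?p = "\<lambda>t. ennreal (t powr (a - 1)) * indicator {0<..1} t"
  have "(\<integral>\<^sup>+x. F x * (\<integral>\<^sup>+t\<in>{0<..1}. fk V t g x * ennreal (t powr (a - 1)) \<partial>lborel) \<partial>lborel)
      = (\<integral>\<^sup>+x. \<integral>\<^sup>+t. ?p t * (F x * fk V t g x) \<partial>lborel \<partial>lborel)"
    by (intro nn_integral_cong, subst nn_integral_cmult[symmetric]) (auto simp: mult_ac)
  also have "\<dots> = (\<integral>\<^sup>+t. \<integral>\<^sup>+x. ?p t * (F x * fk V t g x) \<partial>lborel \<partial>lborel)"
    by (rule lborel_pair.Fubini') measurable
  also have "\<dots> = (\<integral>\<^sup>+t. \<integral>\<^sup>+y. ?p t * (fk_adj V t F y * g y) \<partial>lborel \<partial>lborel)"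
  proof (rule nn_integral_cong)
    fix t :: real
    show "(\<integral>\<^sup>+x. ?p t * (F x * fk V t g x) \<partial>lborel) = (\<integral>\<^sup>+y. ?p t * (fk_adj V t F y * g y) \<partial>lborel)"
      by (simp add: nn_integral_cmult fk_dual)
  qed
  also have "\<dots> = (\<integral>\<^sup>+y. \<integral>\<^sup>+t. ?p t * (fk_adj V t F y * g y) \<partial>lborel \<partial>lborel)"
    by (rule lborel_pair.Fubini') measurable
  also have "\<dots> = (\<integral>\<^sup>+y. (\<integral>\<^sup>+t\<in>{0<..1}. ennreal (t powr (a - 1)) * fk_adj V t F y \<partial>lborel) * g y \<partial>lborel)"
    by (intro nn_integral_cong, subst nn_integral_multc[symmetric]) (auto simp: mult_ac)
  also have "\<dots> \<le> (\<integral>\<^sup>+y. K * g y \<partial>lborel)"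
    by (rule nn_integral_mono_AE) (use K in eventually_elim, auto intro: mult_right_mono)
  also have "\<dots> = K * (\<integral>\<^sup>+y. g y \<partial>lborel)" by (rule nn_integral_cmult) measurable
  finally show ?thesis .
qed

text \<open>
  The time axis is cut into unit intervals. The hypothesis on \<open>K\<close> controls the operators on the first
  interval, and every further interval is reduced to it by the semigroup law applied to the
  function \<open>g n\<close>, whose \<open>L\<^sup>1\<close> norm decays.
\<close>

lemma riesz_integral_bound:
  fixes c :: "'a \<Rightarrow> real"
  assumes V[measurable]: "V \<in> borel_measurable borel" and V0: "\<And>z. 0 \<le> V z"
    and c: "continuous_on UNIV c" "\<And>z. V z \<le> c z" and a: "0 < a" "a \<le> 1"
    and K: "0 \<le> K" "AE y in lborel. (\<integral>\<^sup>+t\<in>{0<..1}. ennreal (t powr (a - 1)) * fk_adj V t (\<lambda>x. ennreal (V x powr a)) y \<partial>lborel) \<le> ennreal K"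
    and decay: "0 < \<delta>" "0 < C" "\<And>t. 0 < t \<Longrightarrow> AE x in lborel. fk V t (\<lambda>_. 1) x \<le> ennreal (C * exp (- \<delta> * t))"
    and f[measurable]: "f \<in> borel_measurable borel" and fL: "\<And>z. f z \<le> ennreal L" and f_int: "(\<integral>\<^sup>+x. f x \<partial>lborel) < \<infinity>"
  shows "(\<integral>\<^sup>+x. ennreal (V x powr a) * (ennreal (1 / Gamma a) * (\<integral>\<^sup>+t\<in>{0<..}. fk V t f x * ennreal (t powr (a - 1)) \<partial>lborel)) \<partial>lborel)
     \<le> ennreal (1 / Gamma a * K * (1 + C) / (1 - exp (- \<delta>))) * (\<integral>\<^sup>+x. f x \<partial>lborel)"
proof -
  let ?W = "\<lambda>x. ennreal (V x powr a)"
  define g where "g n = fk V (real n) f" for n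
  let ?G = "\<lambda>n x. \<integral>\<^sup>+t\<in>{0<..1}. fk V t (g n) x * ennreal (t powr (a - 1)) \<partial>lborel"
  have [measurable]: "g n \<in> borel_measurable borel" for n unfolding g_def by measurable
  have g_int: "(\<integral>\<^sup>+x. g n x \<partial>lborel) \<le> ennreal ((1 + C) * exp (- \<delta> * real n)) * (\<integral>\<^sup>+x. f x \<partial>lborel)" for n
  proof (cases "n = 0")
    case True
    have "1 * (\<integral>\<^sup>+x. f x \<partial>lborel) \<le> ennreal (1 + C) * (\<integral>\<^sup>+x. f x \<partial>lborel)"
      using decay(2) by (intro mult_right_mono) (auto simp: ennreal_1[symmetric] ennreal_leI simp del: ennreal_1)
    with True show ?thesis by (simp add: g_def)
  next
    case False
    have "(\<integral>\<^sup>+x. g n x \<partial>lborel) \<le> (\<integral>\<^sup>+x. fk V (real n) (\<lambda>_. 1) x * f x \<partial>lborel)"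
      unfolding g_def using False by (intro fk_symmetric_le[OF V V0 c f fL f_int]) auto
    also have "\<dots> \<le> (\<integral>\<^sup>+x. ennreal ((1 + C) * exp (- \<delta> * real n)) * f x \<partial>lborel)"
    proof (rule nn_integral_mono_AE)
      have "AE x in lborel. fk V (real n) (\<lambda>_. 1) x \<le> ennreal (C * exp (- \<delta> * real n))"
        using False by (intro decay) auto
      then show "AE x in lborel. fk V (real n) (\<lambda>_. 1) x * f x \<le> ennreal ((1 + C) * exp (- \<delta> * real n)) * f x"
      proof eventually_elim
        case (elim x)
        also have "ennreal (C * exp (- \<delta> * real n)) \<le> ennreal ((1 + C) * exp (- \<delta> * real n))"
          by (intro ennreal_leI mult_right_mono) auto
        finally show ?case by (intro mult_right_mono) auto
      qed
    qed
    also have "\<dots> = ennreal ((1 + C) * exp (- \<delta> * real n)) * (\<integral>\<^sup>+x. f x \<partial>lborel)"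
      by (rule nn_integral_cmult) measurable
    finally show ?thesis .
  qed
  have slice: "fk V (t + real n) f x * ennreal ((t + real n) powr (a - 1)) \<le> fk V t (g n) x * ennreal (t powr (a - 1))"
    if t: "0 < t" for t n x
  proof (intro mult_mono ennreal_leI)
    show "fk V (t + real n) f x \<le> fk V t (g n) x"
    proof (cases "n = 0")
      case True
      have "fk V 0 f = f" by (rule ext) simp
      with True show ?thesis by (simp add: g_def)
    next
      case False
      then show ?thesis using fk_add[OF V V0 c f fL t, of "real n" x] by (simp add: g_def)
    qed
    show "(t + real n) powr (a - 1) \<le> t powr (a - 1)"
      using a t by (intro powr_mono2') auto
  qed auto
  have time: "(\<integral>\<^sup>+t\<in>{0<..}. fk V t f x * ennreal (t powr (a - 1)) \<partial>lborel)
      \<le> (\<Sum>n. ?G n x)" for x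
  proof -
    have "(\<integral>\<^sup>+t\<in>{0<..}. fk V t f x * ennreal (t powr (a - 1)) \<partial>lborel)
       = (\<Sum>n. \<integral>\<^sup>+t\<in>{0<..1}. fk V (t + real n) f x * ennreal ((t + real n) powr (a - 1)) \<partial>lborel)"
      by (rule nn_integral_unit_intervals) measurable
    also have "\<dots> \<le> (\<Sum>n. ?G n x)"
      using slice by (intro suminf_le nn_integral_mono) (auto simp: indicator_def)
    finally show ?thesis .
  qed
  have "(\<integral>\<^sup>+x. ?W x * (ennreal (1 / Gamma a) * (\<integral>\<^sup>+t\<in>{0<..}. fk V t f x * ennreal (t powr (a - 1)) \<partial>lborel)) \<partial>lborel)
     \<le> (\<integral>\<^sup>+x. ?W x * (ennreal (1 / Gamma a) * (\<Sum>n. ?G n x)) \<partial>lborel)"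
    by (intro nn_integral_mono mult_left_mono time) auto
  also have "\<dots> = (\<integral>\<^sup>+x. ennreal (1 / Gamma a) * (\<Sum>n. ?W x * ?G n x) \<partial>lborel)"
    by (intro nn_integral_cong) (simp add: mult_ac)
  also have "\<dots> = ennreal (1 / Gamma a) * (\<Sum>n. \<integral>\<^sup>+x. ?W x * ?G n x \<partial>lborel)"
    by (subst nn_integral_cmult, measurable, subst nn_integral_suminf) auto
  also have "\<dots> \<le> ennreal (1 / Gamma a) * (\<Sum>n. ennreal K * (ennreal ((1 + C) * exp (- \<delta> * real n)) * (\<integral>\<^sup>+x. f x \<partial>lborel)))"
  proof (intro mult_left_mono suminf_le)
    fix n
    have "(\<integral>\<^sup>+x. ?W x * ?G n x \<partial>lborel) \<le> ennreal K * (\<integral>\<^sup>+x. g n x \<partial>lborel)"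
      by (intro weighted_unit_time_bound K) auto
    also have "\<dots> \<le> ennreal K * (ennreal ((1 + C) * exp (- \<delta> * real n)) * (\<integral>\<^sup>+x. f x \<partial>lborel))"
      by (intro mult_left_mono g_int) auto
    finally show "(\<integral>\<^sup>+x. ?W x * ?G n x \<partial>lborel) \<le> \<dots>" .
  qed auto
  also have "(\<Sum>n. ennreal K * (ennreal ((1 + C) * exp (- \<delta> * real n)) * (\<integral>\<^sup>+x. f x \<partial>lborel)))
     = (\<Sum>n. (ennreal (K * (1 + C)) * (\<integral>\<^sup>+x. f x \<partial>lborel)) * ennreal (exp (- \<delta> * real n)))"
    using K(1) decay(2) by (intro suminf_cong) (simp add: ennreal_mult mult_ac)
  also have "\<dots> = (ennreal (K * (1 + C)) * (\<integral>\<^sup>+x. f x \<partial>lborel)) * ennreal (1 / (1 - exp (- \<delta>)))"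
    unfolding ennreal_suminf_cmult suminf_exp_geometric[OF decay(1)] ..
  also have "ennreal (1 / Gamma a) * \<dots> = (ennreal (1 / Gamma a) * (ennreal (K * (1 + C)) * ennreal (1 / (1 - exp (- \<delta>))))) * (\<integral>\<^sup>+x. f x \<partial>lborel)"
    by (simp only: mult_ac)
  also have "ennreal (1 / Gamma a) * (ennreal (K * (1 + C)) * ennreal (1 / (1 - exp (- \<delta>)))) = ennreal (1 / Gamma a * K * (1 + C) / (1 - exp (- \<delta>)))"
    using K(1) decay a by (simp add: ennreal_mult[symmetric] Gamma_real_nonneg)
  finally show ?thesis .
qed

end

section \<open>Independence of representatives and conclusion\<close>

lemma schroedinger_semigroup_eq_fk:
  assumes "brownian_paths M B'" and B: "AE \<omega> in M. \<forall>t\<ge>0. B' t \<omega> = B t \<omega>"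
    and V: "AE z in lborel. V z = V' z" and f: "AE z in lborel. f z = f' z" and t: "0 < t"
  shows "schroedinger_semigroup M B V t f x = brownian_paths.fk M B' V' t (\<lambda>z. ennreal (f' z)) x"
proof -
  interpret brownian_paths M B' by fact
  show ?thesis
    unfolding schroedinger_semigroup_def fk_def kac_def
  proof (rule nn_integral_cong_AE)
    show "AE \<omega> in M. exp_minus (\<integral>\<^sup>+s\<in>{0..t}. ennreal (V (x + B s \<omega>)) \<partial>lebesgue) * ennreal (f (x + B t \<omega>))
       = exp_minus (\<integral>\<^sup>+s\<in>{0..t}. ennreal (V' (x + B' s \<omega>)) \<partial>lborel) * ennreal (f' (x + B' t \<omega>))"
      using B AE_occupation[OF V, of x] AE_position[OF t f, of x]
    proof eventually_elim
      case (elim \<omega>)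
      have "(\<integral>\<^sup>+s\<in>{0..t}. ennreal (V (x + B s \<omega>)) \<partial>lebesgue) = (\<integral>\<^sup>+s\<in>{0..t}. ennreal (V' (x + B' s \<omega>)) \<partial>lborel)"
        unfolding nn_integral_completion
      proof (rule nn_integral_cong_AE)
        show "AE s in lborel. ennreal (V (x + B s \<omega>)) * indicator {0..t} s = ennreal (V' (x + B' s \<omega>)) * indicator {0..t} s"
          using elim(2) AE_lborel_singleton[of 0] by eventually_elim (use elim(1) in \<open>auto simp: indicator_def\<close>)
      qed
      then show ?case using elim(1,3) t by simp
    qed
  qed
qed

lemma rho_cong: "AE z in lborel. V z = V' z \<Longrightarrow> V x = V' x \<Longrightarrow> rho V x u = rho V' x u"
proof -
  assume V: "AE z in lborel. V z = V' z" and x: "V x = V' x"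
  have "(AE y in lborel. y \<in> cball x r \<longrightarrow> V x / u \<le> V y) \<longleftrightarrow> (AE y in lborel. y \<in> cball x r \<longrightarrow> V' x / u \<le> V' y)" for r
    by (rule eventually_subst) (use V in eventually_elim, simp add: x)
  then show ?thesis unfolding rho_def AE_completion_iff by (simp only:)
qed

lemma sigma_cong: "AE z in lborel. V z = V' z \<Longrightarrow> V x = V' x \<Longrightarrow> sigma V x u = sigma V' x u"
proof -
  assume V: "AE z in lborel. V z = V' z" and x: "V x = V' x"
  have "(AE y in lborel. y \<in> cball x r \<longrightarrow> V y \<le> u * V x) \<longleftrightarrow> (AE y in lborel. y \<in> cball x r \<longrightarrow> V' y \<le> u * V' x)" for r
    by (rule eventually_subst) (use V in eventually_elim, simp add: x)
  then show ?thesis unfolding sigma_def AE_completion_iff by (simp only:)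
qed

theorem theorem5p8:
  fixes M :: "'w measure"
    and B :: "real \<Rightarrow> 'w \<Rightarrow> real ^ 'd"
    and V :: "real ^ 'd \<Rightarrow> real"
    and a :: real
  assumes "brownian_motion M B"
    and "0 < a" and "a \<le> 1"
    and "locally_essentially_bounded V"
    and "AE x in lebesgue. 0 \<le> V x"
    and "\<exists>C\<^sub>1>0. AE x in lebesgue. V x \<le> C\<^sub>1 * exp ((norm x)\<^sup>2 / (4 * a))"
    and "\<exists>\<delta>>0. \<exists>C\<^sub>2>0. \<forall>t>0.
           esssup lebesgue (schroedinger_semigroup M B V t (\<lambda>_. 1)) \<le> ennreal (C\<^sub>2 * exp (- \<delta> * t))"
    and "\<exists>F C\<^sub>3. compact F \<and> 0 < C\<^sub>3 \<and>
           (AE x in lebesgue. x \<notin> F \<longrightarrow> J_fun a V x \<le> ennreal C\<^sub>3 \<and> I_fun a V x \<le> ennreal C\<^sub>3)"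
  shows "riesz_transform_bounded_L1 M B V a"
proof -
  obtain B' where paths: "brownian_paths M B'" and B': "AE \<omega> in M. \<forall>t\<ge>0. B' t \<omega> = B t \<omega>"
    using brownian_motion_paths[OF assms(1)] .
  interpret brownian_paths M B' by (rule paths)
  \<comment> \<open>Choose a Borel representative of the potential that satisfies \<open>0 \<le> V \<le> c\<close> everywhere; the
    continuous majorant \<open>c\<close> is the growth bound.\<close>
  obtain C\<^sub>1 where C1: "0 < C\<^sub>1" "AE x in lborel. V x \<le> C\<^sub>1 * exp ((norm x)\<^sup>2 / (4 * a))"
    using assms(6) by (auto simp: AE_completion_iff)
  define c where "c z = C\<^sub>1 * exp ((norm z)\<^sup>2 / (4 * a))" for z :: "real ^ 'd"
  have c: "continuous_on UNIV c" "\<And>z. 0 \<le> c z"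
    using C1(1) assms(2) unfolding c_def by (auto intro!: continuous_intros)
  obtain V\<^sub>0 where V0: "V\<^sub>0 \<in> borel_measurable borel" "AE z in lborel. V z = V\<^sub>0 z"
    using assms(4) completion_ex_borel_measurable_real[of V lborel]
    unfolding locally_essentially_bounded_def by auto
  define V' where "V' z = max 0 (min (V\<^sub>0 z) (c z))" for z
  have [measurable]: "c \<in> borel_measurable borel" using c(1) by (rule borel_measurable_continuous_onI)
  have V'[measurable]: "V' \<in> borel_measurable borel" using V0(1) unfolding V'_def[abs_def] by measurable
  have V'_bounds: "\<And>z. 0 \<le> V' z" "\<And>z. V' z \<le> c z" using c(2) by (auto simp: V'_def)
  have nonneg: "AE x in lborel. 0 \<le> V x" using assms(5) by (simp add: AE_completion_iff)
  have V_eq: "AE z in lborel. V z = V' z"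
    using V0(2) C1(2) nonneg by eventually_elim (auto simp: V'_def c_def)
  have fk_eq: "schroedinger_semigroup M B V t f x = fk V' t (\<lambda>z. ennreal (f' z)) x"
    if "0 < t" "AE z in lborel. f z = f' z" for t x f f'
    by (rule schroedinger_semigroup_eq_fk[OF paths B' V_eq that(2,1)])
  obtain \<delta> C\<^sub>2 where decay: "0 < \<delta>" "0 < C\<^sub>2"
    "\<And>t. 0 < t \<Longrightarrow> esssup lebesgue (schroedinger_semigroup M B V t (\<lambda>_. 1)) \<le> ennreal (C\<^sub>2 * exp (- \<delta> * t))"
    using assms(7) by blast
  have decay': "AE x in lborel. fk V' t (\<lambda>_. 1) x \<le> ennreal (C\<^sub>2 * exp (- \<delta> * t))" if t: "0 < t" for t
  proof -
    have "AE x in lebesgue. schroedinger_semigroup M B V t (\<lambda>_. 1) x \<le> ennreal (C\<^sub>2 * exp (- \<delta> * t))"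
      using esssup_AE[where M=lebesgue and f="schroedinger_semigroup M B V t (\<lambda>_. 1)"]
      by eventually_elim (rule order_trans[OF _ decay(3)[OF t]])
    then show ?thesis using fk_eq[OF t, of "\<lambda>_. 1" "\<lambda>_. 1"] by (simp add: AE_completion_iff)
  qed
  obtain F C\<^sub>3 where F: "compact F" "0 < C\<^sub>3"
    and IJ: "AE x in lborel. x \<notin> F \<longrightarrow> J_fun a V x \<le> ennreal C\<^sub>3 \<and> I_fun a V x \<le> ennreal C\<^sub>3"
    using assms(8) by (auto simp: AE_completion_iff)
  have IJ': "AE x in lborel. x \<notin> F \<longrightarrow> J_fun a V' x \<le> ennreal C\<^sub>3 \<and> I_fun a V' x \<le> ennreal C\<^sub>3"
    using IJ V_eq by eventually_elim (simp add: J_fun_def I_fun_def rho_cong[OF V_eq] sigma_cong[OF V_eq])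
  obtain K where K: "0 \<le> K" "AE y in lborel. (\<integral>\<^sup>+t\<in>{0<..1}. ennreal (t powr (a - 1)) * fk_adj V' t (\<lambda>x. ennreal (V' x powr a)) y \<partial>lborel) \<le> ennreal K"
    using fk_adj_time_integral_bounded[OF V' V'_bounds(1) assms(2) C1(1) V'_bounds(2)[unfolded c_def] F(1) _ IJ'] F(2) by auto
  define C where "C = 1 / Gamma a * K * (1 + C\<^sub>2) / (1 - exp (- \<delta>)) + 1"
  have C: "1 / Gamma a * K * (1 + C\<^sub>2) / (1 - exp (- \<delta>)) \<le> C" "0 < C"
  proof -
    have "0 \<le> 1 / Gamma a * K * (1 + C\<^sub>2) / (1 - exp (- \<delta>))"
      using decay(1,2) K(1) assms(2) by (simp add: Gamma_real_nonneg)
    then show "0 < C" by (simp add: C_def)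
  qed (simp add: C_def)
  have "(\<integral>\<^sup>+x. riesz_transform M B V a f x \<partial>lebesgue) \<le> ennreal C * (\<integral>\<^sup>+x. ennreal (f x) \<partial>lebesgue)"
    if f: "simple_function lebesgue f" "\<And>x. 0 \<le> f x" for f
  proof (cases "(\<integral>\<^sup>+x. ennreal (f x) \<partial>lebesgue) < \<infinity>")
    case True
    obtain L where L: "\<And>x. f x \<le> L"
    proof -
      have "finite (range f)" using f(1) by (simp add: simple_function_def)
      then show ?thesis using that[of "Max (range f)"] by simp
    qed
    obtain f\<^sub>0 where f0: "f\<^sub>0 \<in> borel_measurable borel" "AE z in lborel. f z = f\<^sub>0 z"
      using completion_ex_borel_measurable_real[OF borel_measurable_simple_function[OF f(1)]] by auto
    define f' where "f' z = min (f\<^sub>0 z) L" for z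
    have [measurable]: "f' \<in> borel_measurable borel" using f0(1) unfolding f'_def[abs_def] by measurable
    have f_eq: "AE z in lborel. f z = f' z"
      using f0(2)
    proof eventually_elim
      case (elim z)
      then show ?case using L[of z] by (simp add: f'_def)
    qed
    have f_int: "(\<integral>\<^sup>+x. ennreal (f x) \<partial>lebesgue) = (\<integral>\<^sup>+x. ennreal (f' x) \<partial>lborel)"
      unfolding nn_integral_completion by (rule nn_integral_cong_AE) (use f_eq in eventually_elim, simp)
    have "(\<integral>\<^sup>+x. riesz_transform M B V a f x \<partial>lebesgue)
       = (\<integral>\<^sup>+x. ennreal (V' x powr a) * (ennreal (1 / Gamma a) * (\<integral>\<^sup>+t\<in>{0<..}. fk V' t (\<lambda>z. ennreal (f' z)) x * ennreal (t powr (a - 1)) \<partial>lborel)) \<partial>lborel)"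
      unfolding nn_integral_completion riesz_transform_def
    proof (rule nn_integral_cong_AE)
      have "(\<integral>\<^sup>+t\<in>{0<..}. schroedinger_semigroup M B V t f x * ennreal (t powr (a - 1)) \<partial>lborel)
        = (\<integral>\<^sup>+t\<in>{0<..}. fk V' t (\<lambda>z. ennreal (f' z)) x * ennreal (t powr (a - 1)) \<partial>lborel)" for x
        using fk_eq[OF _ f_eq] by (intro nn_integral_cong) (auto simp: indicator_def)
      then show "AE x in lborel. ennreal (V x powr a) * (ennreal (1 / Gamma a) * (\<integral>\<^sup>+t\<in>{0<..}. schroedinger_semigroup M B V t f x * ennreal (t powr (a - 1)) \<partial>lborel))
        = ennreal (V' x powr a) * (ennreal (1 / Gamma a) * (\<integral>\<^sup>+t\<in>{0<..}. fk V' t (\<lambda>z. ennreal (f' z)) x * ennreal (t powr (a - 1)) \<partial>lborel))"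
        using V_eq by auto
    qed
    also have "\<dots> \<le> ennreal (1 / Gamma a * K * (1 + C\<^sub>2) / (1 - exp (- \<delta>))) * (\<integral>\<^sup>+x. ennreal (f' x) \<partial>lborel)"
    proof (rule riesz_integral_bound[OF V' V'_bounds(1) c(1) V'_bounds(2) assms(2,3) K decay(1,2) decay'])
      show "ennreal (f' z) \<le> ennreal L" for z by (intro ennreal_leI) (simp add: f'_def)
      show "(\<integral>\<^sup>+x. ennreal (f' x) \<partial>lborel) < \<infinity>" using True f_int by simp
    qed auto
    also have "\<dots> \<le> ennreal C * (\<integral>\<^sup>+x. ennreal (f' x) \<partial>lborel)"
      using C by (intro mult_right_mono ennreal_leI) auto
    finally show ?thesis by (simp add: f_int)
  next
    case False
    then have "ennreal C * (\<integral>\<^sup>+x. ennreal (f x) \<partial>lebesgue) = \<top>"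
      using C(2) by (simp add: not_less top_unique ennreal_mult_top)
    then show ?thesis by simp
  qed
  then show ?thesis
    unfolding riesz_transform_bounded_L1_def using C(2) by blast
qed

end
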